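(* Let $K$ be a field of characteristic zero, let $G=(G_a^-)^2$ with odd primitive generators $u,v$ of $K[G]$, and let $X=G_m\times G_a\times(G_a^-)^2$, with $K[X]$ generated by the group-like elements $\tau^{\pm1}$, an even primitive element $z_1$ and odd primitive elements $z_2,z_3$. Let $G$ act on $X$ (on the right, by supergroup automorphisms) by the action $\rho:X\times G\to X$ whose dual superalgebra morphism $\rho^*:K[X]\to K[X]\otimes K[G]$ is given by $$\rho^*(z_1)=z_1\otimes1,\quad \rho^*(z_2)=z_2\otimes 1-z_1\otimes v,\quad \rho^*(z_3)=z_3\otimes1+z_1\otimes u,$$ $$\rho^*(\tau)=(\tau\otimes1)\sum_{k\ge0}\frac{1}{k!}\,(z_1\otimes uv+z_2\otimes u+z_3\otimes v)^k ,$$ and let $H=X\rtimes G$ be the corresponding semi-direct product. Then $H_u=1$.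
   Context: Supergroups are group-valued functors on supercommutative $K$-superalgebras represented by supercommutative Hopf superalgebras. Tensor products of superalgebras carry the sign rule $(a\otimes b)(c\otimes d)=(-1)^{|b||c|}ac\otimes bd$. $G_m$ is the one-dimensional torus, $K[G_m]=K[\tau^{\pm1}]$ with $\tau$ group-like; $G_a$ has $K[G_a]=K[z]$, $z$ even primitive; $G_a^-$ has $K[G_a^-]=K[z]$ with $z$ odd primitive (so $z^2=0$). An algebraic supergroup is unipotent if every simple supermodule over it is trivial; $H_u$ denotes the unipotent radical, the largest normal (closed) unipotent supersubgroup of $H$. *)

theory Defs
  imports Complex_Main "HOL-Library.Poly_Mapping"
begin

section \<open>Superspaces with a homogeneous basis\<close>

text \<open>
  Over a field every superspace has a homogeneous basis.  A superspace is therefore given by the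
  index set of such a basis and the parity of each index (\<open>True\<close> means odd); its
  vectors are the finitely supported coefficient functions on the index set.  A linear map is
  given by its values on the basis (values outside the index set are irrelevant), and the basis
  of a tensor product is indexed by pairs.
\<close>

abbreviation bvec :: "'b \<Rightarrow> ('b \<Rightarrow>\<^sub>0 'k::field)" where
  "bvec b \<equiv> Poly_Mapping.single b 1"

definition scal :: "'k::field \<Rightarrow> ('b \<Rightarrow>\<^sub>0 'k) \<Rightarrow> ('b \<Rightarrow>\<^sub>0 'k)" where
  "scal c = Poly_Mapping.map ((*) c)"

lemma lookup_scal: "Poly_Mapping.lookup (scal c x) b = c * Poly_Mapping.lookup x b"
  by (auto simp: scal_def Poly_Mapping.map.rep_eq when_def)

global_interpretation pm: vector_space "scal :: 'k::field \<Rightarrow> ('b \<Rightarrow>\<^sub>0 'k) \<Rightarrow> ('b \<Rightarrow>\<^sub>0 'k)"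
  by unfold_locales
    (auto intro!: poly_mapping_eqI simp: lookup_scal Poly_Mapping.lookup_add algebra_simps)

definition lin :: "('b \<Rightarrow> ('c \<Rightarrow>\<^sub>0 'k::field)) \<Rightarrow> ('b \<Rightarrow>\<^sub>0 'k) \<Rightarrow> ('c \<Rightarrow>\<^sub>0 'k)" where
  "lin f x = (\<Sum>b\<in>Poly_Mapping.keys x. scal (Poly_Mapping.lookup x b) (f b))"

definition tens :: "('b \<Rightarrow>\<^sub>0 'k::field) \<Rightarrow> ('c \<Rightarrow>\<^sub>0 'k) \<Rightarrow> ('b \<times> 'c \<Rightarrow>\<^sub>0 'k)" (infixr "\<otimes>" 75) where
  "x \<otimes> y = (\<Sum>b\<in>Poly_Mapping.keys x. \<Sum>c\<in>Poly_Mapping.keys y.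
     Poly_Mapping.single (b, c) (Poly_Mapping.lookup x b * Poly_Mapping.lookup y c))"

record 'b superspace =
  idx :: "'b set"
  par :: "'b \<Rightarrow> bool"

definition vec :: "('b, 'm) superspace_scheme \<Rightarrow> ('b \<Rightarrow>\<^sub>0 'k::field) set" where
  "vec V = {x. Poly_Mapping.keys x \<subseteq> idx V}"

definition hpart :: "('b, 'm) superspace_scheme \<Rightarrow> bool \<Rightarrow> ('b \<Rightarrow>\<^sub>0 'k::field) set" where
  "hpart V p = {x. Poly_Mapping.keys x \<subseteq> {b \<in> idx V. par V b = p}}"

definition tens_space ::
  "('b, 'm) superspace_scheme \<Rightarrow> ('c, 'n) superspace_scheme \<Rightarrow> ('b \<times> 'c) superspace" where
  "tens_space V W = \<lparr> idx = idx V \<times> idx W, par = (\<lambda>(b, c). par V b \<noteq> par W c) \<rparr>"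

definition even_map :: "('b, 'm) superspace_scheme \<Rightarrow> ('c, 'n) superspace_scheme \<Rightarrow>
    ('b \<Rightarrow> ('c \<Rightarrow>\<^sub>0 'k::field)) \<Rightarrow> bool" where
  "even_map V W f \<longleftrightarrow> (\<forall>b\<in>idx V. f b \<in> hpart W (par V b))"


section \<open>Superalgebras\<close>

record (overloaded) ('b, 'k::zero) superalg = "'b superspace" +
  mul :: "'b \<times> 'b \<Rightarrow> ('b \<Rightarrow>\<^sub>0 'k)"
  unit_el :: "'b \<Rightarrow>\<^sub>0 'k"

definition amul :: "('b, 'k::field, 'm) superalg_scheme \<Rightarrow>
    ('b \<Rightarrow>\<^sub>0 'k) \<Rightarrow> ('b \<Rightarrow>\<^sub>0 'k) \<Rightarrow> ('b \<Rightarrow>\<^sub>0 'k)" where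
  "amul A x y = lin (mul A) (x \<otimes> y)"

fun apow :: "('b, 'k::field, 'm) superalg_scheme \<Rightarrow> ('b \<Rightarrow>\<^sub>0 'k) \<Rightarrow> nat \<Rightarrow> ('b \<Rightarrow>\<^sub>0 'k)" where
  "apow A x 0 = unit_el A"
| "apow A x (Suc n) = amul A x (apow A x n)"

definition superalgebra :: "('b, 'k::field, 'm) superalg_scheme \<Rightarrow> bool" where
  "superalgebra A \<longleftrightarrow>
     even_map (tens_space A A) A (mul A) \<and>
     unit_el A \<in> hpart A False \<and>
     (\<forall>x\<in>vec A. amul A (unit_el A) x = x \<and> amul A x (unit_el A) = x) \<and>
     (\<forall>x\<in>vec A. \<forall>y\<in>vec A. \<forall>z\<in>vec A. amul A (amul A x y) z = amul A x (amul A y z))"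

text \<open>In characteristic other than two this forces odd elements to square to zero.\<close>

definition supercommutative :: "('b, 'k::field, 'm) superalg_scheme \<Rightarrow> bool" where
  "supercommutative A \<longleftrightarrow>
     (\<forall>p q. \<forall>x\<in>hpart A p. \<forall>y\<in>hpart A q.
        amul A x y = (if p \<and> q then - amul A y x else amul A y x))"

definition superalg_hom :: "('b, 'k::field, 'm) superalg_scheme \<Rightarrow>
    ('c, 'k, 'n) superalg_scheme \<Rightarrow> ('b \<Rightarrow> ('c \<Rightarrow>\<^sub>0 'k)) \<Rightarrow> bool" where
  "superalg_hom A B f \<longleftrightarrow>
     even_map A B f \<and>
     lin f (unit_el A) = unit_el B \<and>
     (\<forall>x\<in>vec A. \<forall>y\<in>vec A. lin f (amul A x y) = amul B (lin f x) (lin f y))"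

definition tens_alg :: "('b, 'k::field, 'm) superalg_scheme \<Rightarrow>
    ('c, 'k, 'n) superalg_scheme \<Rightarrow> ('b \<times> 'c, 'k) superalg" where
  "tens_alg A B =
     \<lparr> idx = idx (tens_space A B), par = par (tens_space A B),
       mul = (\<lambda>((a, b), (c, d)).
                scal (if par B b \<and> par A c then - 1 else 1) (mul A (a, c) \<otimes> mul B (b, d))),
       unit_el = unit_el A \<otimes> unit_el B \<rparr>"

definition inc1 :: "('c, 'k::field, 'n) superalg_scheme \<Rightarrow> 'b \<Rightarrow> ('b \<times> 'c \<Rightarrow>\<^sub>0 'k)" where
  "inc1 B = (\<lambda>b. bvec b \<otimes> unit_el B)"

definition inc2 :: "('b, 'k::field, 'm) superalg_scheme \<Rightarrow> 'c \<Rightarrow> ('b \<times> 'c \<Rightarrow>\<^sub>0 'k)" where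
  "inc2 A = (\<lambda>c. unit_el A \<otimes> bvec c)"

text \<open>The exponential series of a nilpotent element: only its nonzero terms are summed.\<close>

definition aexp :: "('b, 'k::field_char_0, 'm) superalg_scheme \<Rightarrow> ('b \<Rightarrow>\<^sub>0 'k) \<Rightarrow> ('b \<Rightarrow>\<^sub>0 'k)" where
  "aexp A x = Sum_any (\<lambda>k. scal (1 / fact k) (apow A x k))"


section \<open>Affine supergroups\<close>

text \<open>An affine supergroup is handled through its coordinate Hopf superalgebra.\<close>

record (overloaded) ('b, 'k::zero) hopf = "('b, 'k) superalg" +
  comult :: "'b \<Rightarrow> ('b \<times> 'b \<Rightarrow>\<^sub>0 'k)"
  counit :: "'b \<Rightarrow> 'k"
  antip :: "'b \<Rightarrow> ('b \<Rightarrow>\<^sub>0 'k)"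

definition lin_counit :: "('b, 'k::field, 'm) hopf_scheme \<Rightarrow> ('b \<Rightarrow>\<^sub>0 'k) \<Rightarrow> 'k" where
  "lin_counit C x = (\<Sum>b\<in>Poly_Mapping.keys x. Poly_Mapping.lookup x b * counit C b)"

definition supergroup :: "('b, 'k::field, 'm) hopf_scheme \<Rightarrow> bool" where
  "supergroup C \<longleftrightarrow>
     superalgebra C \<and> supercommutative C \<and>
     superalg_hom C (tens_alg C C) (comult C) \<and>
     (\<forall>x\<in>hpart C True. lin_counit C x = 0) \<and>
     lin_counit C (unit_el C) = 1 \<and>
     (\<forall>x\<in>vec C. \<forall>y\<in>vec C. lin_counit C (amul C x y) = lin_counit C x * lin_counit C y) \<and>
     even_map C C (antip C) \<and>
     (\<forall>c\<in>idx C.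
        lin (\<lambda>(a, b). lin (\<lambda>(a1, a2). bvec (a1, (a2, b))) (comult C a)) (comult C c)
          = lin (\<lambda>(a, b). bvec a \<otimes> comult C b) (comult C c) \<and>
        lin (\<lambda>(a, b). scal (counit C a) (bvec b)) (comult C c) = bvec c \<and>
        lin (\<lambda>(a, b). scal (counit C b) (bvec a)) (comult C c) = bvec c \<and>
        lin (\<lambda>(a, b). amul C (antip C a) (bvec b)) (comult C c) = scal (counit C c) (unit_el C) \<and>
        lin (\<lambda>(a, b). amul C (bvec a) (antip C b)) (comult C c) = scal (counit C c) (unit_el C))"

definition prod_group :: "('b, 'k::field, 'm) hopf_scheme \<Rightarrow>
    ('c, 'k, 'n) hopf_scheme \<Rightarrow> ('b \<times> 'c, 'k) hopf" where
  "prod_group C D =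
     \<lparr> idx = idx (tens_alg C D), par = par (tens_alg C D),
       mul = mul (tens_alg C D), unit_el = unit_el (tens_alg C D),
       comult = (\<lambda>(c, d). lin (\<lambda>((c1, c2), (d1, d2)).
                   scal (if par C c2 \<and> par D d1 then - 1 else 1) (bvec ((c1, d1), (c2, d2))))
                   (comult C c \<otimes> comult D d)),
       counit = (\<lambda>(c, d). counit C c * counit D d),
       antip = (\<lambda>(c, d). antip C c \<otimes> antip D d) \<rparr>"

text \<open>\<open>i\<close> stands for the \<open>i\<close>-th power of the coordinate.\<close>

definition Gm :: "(int, 'k::field) hopf" where
  "Gm = \<lparr> idx = UNIV, par = (\<lambda>_. False),
          mul = (\<lambda>(i, j). bvec (i + j)), unit_el = bvec 0,
          comult = (\<lambda>i. bvec (i, i)), counit = (\<lambda>_. 1), antip = (\<lambda>i. bvec (- i)) \<rparr>"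

definition Ga :: "(nat, 'k::field) hopf" where
  "Ga = \<lparr> idx = UNIV, par = (\<lambda>_. False),
          mul = (\<lambda>(i, j). bvec (i + j)), unit_el = bvec 0,
          comult = (\<lambda>n. \<Sum>i\<le>n. Poly_Mapping.single (i, n - i) (of_nat (n choose i))),
          counit = (\<lambda>n. if n = 0 then 1 else 0),
          antip = (\<lambda>n. Poly_Mapping.single n ((- 1) ^ n)) \<rparr>"

text \<open>The index \<open>False\<close> stands for \<open>1\<close>, the index \<open>True\<close> for the odd primitive coordinate.\<close>

definition Ga_odd :: "(bool, 'k::field) hopf" where
  "Ga_odd = \<lparr> idx = UNIV, par = (\<lambda>b. b),
          mul = (\<lambda>(b, c). if b \<and> c then 0 else bvec (b \<or> c)), unit_el = bvec False,
          comult = (\<lambda>b. if b then bvec (True, False) + bvec (False, True)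
                         else bvec (False, False)),
          counit = (\<lambda>b. if b then 0 else 1),
          antip = (\<lambda>b. if b then - bvec True else bvec False) \<rparr>"


section \<open>The functor of points\<close>

text \<open>
  For a supercommutative superalgebra \<open>A\<close> the group \<open>G(A)\<close> consists of the
  superalgebra morphisms from the coordinate superalgebra to \<open>A\<close>.  The map
  \<open>pair_pt A f g\<close> is the \<open>A\<close>-point of a product with components \<open>f\<close> and \<open>g\<close>.
\<close>

definition points :: "('b, 'k::field, 'm) superalg_scheme \<Rightarrow> ('a, 'k, 'n) superalg_scheme \<Rightarrow>
    ('b \<Rightarrow> ('a \<Rightarrow>\<^sub>0 'k)) set" where
  "points C A = {f. superalg_hom C A f}"

definition pair_pt :: "('a, 'k::field, 'n) superalg_scheme \<Rightarrow> ('b \<Rightarrow> ('a \<Rightarrow>\<^sub>0 'k)) \<Rightarrow>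
    ('c \<Rightarrow> ('a \<Rightarrow>\<^sub>0 'k)) \<Rightarrow> 'b \<times> 'c \<Rightarrow> ('a \<Rightarrow>\<^sub>0 'k)" where
  "pair_pt A f g = (\<lambda>(b, c). amul A (f b) (g c))"

definition mult_pt :: "('b, 'k::field, 'm) hopf_scheme \<Rightarrow> ('a, 'k, 'n) superalg_scheme \<Rightarrow>
    ('b \<Rightarrow> ('a \<Rightarrow>\<^sub>0 'k)) \<Rightarrow> ('b \<Rightarrow> ('a \<Rightarrow>\<^sub>0 'k)) \<Rightarrow> 'b \<Rightarrow> ('a \<Rightarrow>\<^sub>0 'k)" where
  "mult_pt C A f g = (\<lambda>b. lin (pair_pt A f g) (comult C b))"

definition one_pt :: "('b, 'k::field, 'm) hopf_scheme \<Rightarrow> ('a, 'k, 'n) superalg_scheme \<Rightarrow>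
    'b \<Rightarrow> ('a \<Rightarrow>\<^sub>0 'k)" where
  "one_pt C A = (\<lambda>b. scal (counit C b) (unit_el A))"

definition inv_pt :: "('b, 'k::field, 'm) hopf_scheme \<Rightarrow>
    ('b \<Rightarrow> ('a \<Rightarrow>\<^sub>0 'k)) \<Rightarrow> 'b \<Rightarrow> ('a \<Rightarrow>\<^sub>0 'k)" where
  "inv_pt C f = (\<lambda>b. lin f (antip C b))"

text \<open>
  The result of letting a point \<open>g\<close> of \<open>G\<close> act on a point \<open>x\<close> of \<open>X\<close> from the right, where
  \<open>\<rho>\<close> is the dual of the morphism from \<open>X \<times> G\<close> to \<open>X\<close>.
\<close>

definition act_pt :: "('a, 'k::field, 'n) superalg_scheme \<Rightarrow> ('x \<Rightarrow> ('x \<times> 'g \<Rightarrow>\<^sub>0 'k)) \<Rightarrow>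
    ('x \<Rightarrow> ('a \<Rightarrow>\<^sub>0 'k)) \<Rightarrow> ('g \<Rightarrow> ('a \<Rightarrow>\<^sub>0 'k)) \<Rightarrow> 'x \<Rightarrow> ('a \<Rightarrow>\<^sub>0 'k)" where
  "act_pt A \<rho> x g = (\<lambda>b. lin (pair_pt A x g) (\<rho> b))"

text \<open>
  The superalgebras \<open>A\<close> below have their basis indexed by a subset of a fixed type.  That type is
  large enough to carry the coordinate superalgebras of \<open>X \<times> X \<times> G\<close> and \<open>X \<times> G \<times> G\<close>, which
  contain the universal points; by Yoneda the conditions then hold for all \<open>A\<close>.
\<close>

definition right_action_by_automorphisms ::
  "('x, 'k::field) hopf \<Rightarrow> ('g, 'k) hopf \<Rightarrow> ('x \<Rightarrow> ('x \<times> 'g \<Rightarrow>\<^sub>0 'k)) \<Rightarrow> bool" where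
  "right_action_by_automorphisms X G \<rho> \<longleftrightarrow>
     superalg_hom X (tens_alg X G) \<rho> \<and>
     (\<forall>A :: (('x \<times> 'x) \<times> 'g \<times> 'g, 'k) superalg. superalgebra A \<and> supercommutative A \<longrightarrow>
        (\<forall>x\<in>points X A. \<forall>y\<in>points X A. \<forall>g\<in>points G A. \<forall>h\<in>points G A. \<forall>b\<in>idx X.
           act_pt A \<rho> (act_pt A \<rho> x g) h b = act_pt A \<rho> x (mult_pt G A g h) b \<and>
           act_pt A \<rho> x (one_pt G A) b = x b \<and>
           act_pt A \<rho> (mult_pt X A x y) g b
             = mult_pt X A (act_pt A \<rho> x g) (act_pt A \<rho> y g) b))"

text \<open>
  The semi-direct product has the points \<open>(x, g)\<close> with
  \<open>(x, g) (x', g') = (x (x' \<cdot> g\<^sup>-\<^sup>1), g g')\<close>, so that \<open>x \<cdot> g = g\<^sup>-\<^sup>1 x g\<close>, and with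
  \<open>(x, g)\<^sup>-\<^sup>1 = (x\<^sup>-\<^sup>1 \<cdot> g, g\<^sup>-\<^sup>1)\<close>.  Its comultiplication and antipode are these formulas applied to
  the universal points, that is, to the inclusions of the tensor factors.
\<close>

definition semidirect :: "('x, 'k::field) hopf \<Rightarrow> ('g, 'k) hopf \<Rightarrow>
    ('x \<Rightarrow> ('x \<times> 'g \<Rightarrow>\<^sub>0 'k)) \<Rightarrow> ('x \<times> 'g, 'k) hopf" where
  "semidirect X G \<rho> =
    (let T = tens_alg X G; T2 = tens_alg T T;
         x = inc1 G; g = inc2 X;
         x1 = (\<lambda>b. lin (inc1 T) (x b)); g1 = (\<lambda>b. lin (inc1 T) (g b));
         x2 = (\<lambda>b. lin (inc2 T) (x b)); g2 = (\<lambda>b. lin (inc2 T) (g b))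
     in \<lparr> idx = idx T, par = par T, mul = mul T, unit_el = unit_el T,
          comult = pair_pt T2 (mult_pt X T2 x1 (act_pt T2 \<rho> x2 (inv_pt G g1)))
                              (mult_pt G T2 g1 g2),
          counit = (\<lambda>(b, c). counit X b * counit G c),
          antip = pair_pt T (act_pt T \<rho> (inv_pt X x) g) (inv_pt G g) \<rparr>)"


section \<open>Supermodules, unipotency and the unipotent radical\<close>

text \<open>
  Supermodules over a supergroup are right supercomodules over its coordinate Hopf superalgebra.
\<close>

definition supercomodule :: "('c, 'k::field) hopf \<Rightarrow> 'v superspace \<Rightarrow>
    ('v \<Rightarrow> ('v \<times> 'c \<Rightarrow>\<^sub>0 'k)) \<Rightarrow> bool" where
  "supercomodule C V \<delta> \<longleftrightarrow>
     even_map V (tens_space V C) \<delta> \<and>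
     (\<forall>v\<in>idx V.
        lin (\<lambda>(w, c). lin (\<lambda>(w', d). bvec (w', (d, c))) (\<delta> w)) (\<delta> v)
          = lin (\<lambda>(w, c). bvec w \<otimes> comult C c) (\<delta> v) \<and>
        lin (\<lambda>(w, c). scal (counit C c) (bvec w)) (\<delta> v) = bvec v)"

definition subsupercomodule :: "('c, 'k::field) hopf \<Rightarrow> 'v superspace \<Rightarrow>
    ('v \<Rightarrow> ('v \<times> 'c \<Rightarrow>\<^sub>0 'k)) \<Rightarrow> ('v \<Rightarrow>\<^sub>0 'k) set \<Rightarrow> bool" where
  "subsupercomodule C V \<delta> W \<longleftrightarrow>
     W \<subseteq> vec V \<and> pm.subspace W \<and>
     W = pm.span (\<Union>p. W \<inter> hpart V p) \<and>
     (\<forall>w\<in>W. lin \<delta> w \<in> pm.span {w' \<otimes> c | w' c. w' \<in> W \<and> c \<in> vec C})"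

definition simple_supercomodule :: "('c, 'k::field) hopf \<Rightarrow> 'v superspace \<Rightarrow>
    ('v \<Rightarrow> ('v \<times> 'c \<Rightarrow>\<^sub>0 'k)) \<Rightarrow> bool" where
  "simple_supercomodule C V \<delta> \<longleftrightarrow>
     supercomodule C V \<delta> \<and> idx V \<noteq> {} \<and>
     (\<forall>W. subsupercomodule C V \<delta> W \<longrightarrow> W = {0} \<or> W = vec V)"

definition trivial_supercomodule :: "('c, 'k::field) hopf \<Rightarrow> 'v superspace \<Rightarrow>
    ('v \<Rightarrow> ('v \<times> 'c \<Rightarrow>\<^sub>0 'k)) \<Rightarrow> bool" where
  "trivial_supercomodule C V \<delta> \<longleftrightarrow> (\<forall>v\<in>idx V. \<delta> v = bvec v \<otimes> unit_el C)"

text \<open>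
  Supercomodules are locally finite, so simple ones are finite-dimensional and have a basis
  indexed by natural numbers.
\<close>

definition unipotent :: "('c, 'k::field) hopf \<Rightarrow> bool" where
  "unipotent C \<longleftrightarrow>
     (\<forall>(V :: nat superspace) \<delta>. simple_supercomodule C V \<delta> \<longrightarrow> trivial_supercomodule C V \<delta>)"

text \<open>
  A closed supersubgroup of \<open>H\<close> is a supergroup \<open>N\<close> together with a surjective morphism \<open>\<pi>\<close> of
  Hopf superalgebras from \<open>K[H]\<close> to \<open>K[N]\<close>.  Since the images of the basis vectors of \<open>K[H]\<close>
  contain a basis of \<open>K[N]\<close>, it is no restriction to index the latter by elements of the same type.
\<close>

definition closed_supersubgroup :: "('b, 'k::field) hopf \<Rightarrow> ('b, 'k) hopf \<Rightarrow>
    ('b \<Rightarrow> ('b \<Rightarrow>\<^sub>0 'k)) \<Rightarrow> bool" where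
  "closed_supersubgroup H N \<pi> \<longleftrightarrow>
     supergroup N \<and> superalg_hom H N \<pi> \<and> lin \<pi> ` vec H = vec N \<and>
     (\<forall>b\<in>idx H.
        lin (\<lambda>(c, d). \<pi> c \<otimes> \<pi> d) (comult H b) = lin (comult N) (\<pi> b) \<and>
        lin_counit N (\<pi> b) = counit H b \<and>
        lin \<pi> (antip H b) = lin (antip N) (\<pi> b))"

text \<open>
  A closed supersubgroup, as a subfunctor, is determined by its defining ideal, and larger
  supersubgroups have smaller defining ideals.
\<close>

definition defining_ideal :: "('b, 'k::field) hopf \<Rightarrow> ('b \<Rightarrow> ('b \<Rightarrow>\<^sub>0 'k)) \<Rightarrow> ('b \<Rightarrow>\<^sub>0 'k) set" where
  "defining_ideal H \<pi> = {f \<in> vec H. lin \<pi> f = 0}"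

definition sub_points :: "('b, 'k::field) hopf \<Rightarrow> ('b \<Rightarrow>\<^sub>0 'k) set \<Rightarrow> ('a, 'k) superalg \<Rightarrow>
    ('b \<Rightarrow> ('a \<Rightarrow>\<^sub>0 'k)) set" where
  "sub_points H I A = {n \<in> points H A. \<forall>f\<in>I. lin n f = 0}"

text \<open>
  \<open>N(A)\<close> is a normal subgroup of \<open>H(A)\<close> for all \<open>A\<close>; the type of \<open>A\<close> is large enough to carry the
  coordinate superalgebra of \<open>N \<times> H\<close>, which contains the universal points.
\<close>

definition normal_supersubgroup :: "('b, 'k::field) hopf \<Rightarrow> ('b \<Rightarrow>\<^sub>0 'k) set \<Rightarrow> bool" where
  "normal_supersubgroup H I \<longleftrightarrow>
     (\<forall>A :: ('b \<times> 'b, 'k) superalg. superalgebra A \<and> supercommutative A \<longrightarrow>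
        (\<forall>n\<in>sub_points H I A. \<forall>h\<in>points H A.
           mult_pt H A (mult_pt H A (inv_pt H h) n) h \<in> sub_points H I A))"

definition normal_unipotent :: "('b, 'k::field) hopf \<Rightarrow> ('b \<Rightarrow>\<^sub>0 'k) set \<Rightarrow> bool" where
  "normal_unipotent H I \<longleftrightarrow>
     (\<exists>N \<pi>. closed_supersubgroup H N \<pi> \<and> I = defining_ideal H \<pi> \<and> unipotent N) \<and>
     normal_supersubgroup H I"

text \<open>\<open>I\<close> is the defining ideal of the largest normal unipotent closed supersubgroup of \<open>H\<close>.\<close>

definition is_unipotent_radical :: "('b, 'k::field) hopf \<Rightarrow> ('b \<Rightarrow>\<^sub>0 'k) set \<Rightarrow> bool" where
  "is_unipotent_radical H I \<longleftrightarrow>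
     normal_unipotent H I \<and> (\<forall>J. normal_unipotent H J \<longrightarrow> I \<subseteq> J)"

definition trivial_supersubgroup :: "('b, 'k::field) hopf \<Rightarrow> ('b \<Rightarrow>\<^sub>0 'k) set" where
  "trivial_supersubgroup H = {f \<in> vec H. lin_counit H f = 0}"


section \<open>The supergroups of the example\<close>

type_synonym g_idx = "bool \<times> bool"
type_synonym x_idx = "int \<times> nat \<times> bool \<times> bool"

definition G_grp :: "(g_idx, 'k::field) hopf" where
  "G_grp = prod_group Ga_odd Ga_odd"

definition X_grp :: "(x_idx, 'k::field) hopf" where
  "X_grp = prod_group Gm (prod_group Ga (prod_group Ga_odd Ga_odd))"

definition gen_u :: "g_idx \<Rightarrow>\<^sub>0 'k::field" where
  "gen_u = bvec True \<otimes> bvec False"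

definition gen_v :: "g_idx \<Rightarrow>\<^sub>0 'k::field" where
  "gen_v = bvec False \<otimes> bvec True"

definition gen_tau :: "x_idx \<Rightarrow>\<^sub>0 'k::field" where
  "gen_tau = bvec 1 \<otimes> bvec 0 \<otimes> bvec False \<otimes> bvec False"

definition gen_z1 :: "x_idx \<Rightarrow>\<^sub>0 'k::field" where
  "gen_z1 = bvec 0 \<otimes> bvec 1 \<otimes> bvec False \<otimes> bvec False"

definition gen_z2 :: "x_idx \<Rightarrow>\<^sub>0 'k::field" where
  "gen_z2 = bvec 0 \<otimes> bvec 0 \<otimes> bvec True \<otimes> bvec False"

definition gen_z3 :: "x_idx \<Rightarrow>\<^sub>0 'k::field" where
  "gen_z3 = bvec 0 \<otimes> bvec 0 \<otimes> bvec False \<otimes> bvec True"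

end

theory Submission
  imports Defs
begin

text \<open>
  \<open>H\<close> has a faithful simple supermodule \<open>V\<close>: the exterior algebra on two generators, on which the
  odd directions of \<open>G\<close> act by exterior multiplications \<open>P\<close>, \<open>Q\<close>, those of \<open>X\<close> by the dual
  contractions \<open>B\<close>, \<open>C\<close>, the even unipotent direction by \<open>- B C\<close>, and the torus by scalars.  If \<open>N\<close>
  is a normal unipotent supersubgroup, then \<open>V\<close> has a nonzero vector fixed by \<open>N\<close>; by normality the
  fixed vectors form an \<open>H\<close>-submodule, hence are all of \<open>V\<close>, and \<open>N\<close> is trivial because \<open>V\<close> is
  faithful.  Faithfulness also yields the group laws of \<open>H\<close>: they hold for the representing
  matrices.
\<close>

section \<open>Linear maps on finitely supported functions\<close>

text \<open>The even part of H is G_m x G_a, with unipotent radical G_a, so the triviality of H_u is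
  invisible there and has to come from the odd directions. The action dictates the operators on
  \<open>V\<close>. The terms z_2 \<otimes> u and z_3 \<otimes> v in the exponential make odd
  directions of X and of G anticommute to the direction of the torus; with the torus in weight one
  this reads B P + P B = 1 and C Q + Q C = 1, all other pairs anticommuting to 0. These are Clifford
  relations, and the exterior algebra is their simple module. The terms z_1 \<otimes> u and - z_1
  \<otimes> v in the images of z_3 and z_2 ask for an even operator D with [D, P] = C and [D, Q] = -
  B, and D = - B C satisfies this. As P, Q, B, C generate all 4 x 4 matrices, any nonzero vector
  generates \<open>V\<close>; the proof makes this explicit by reading off single coefficients of
  matrix entries.\<close>

abbreviation lk where "lk \<equiv> Poly_Mapping.lookup"
abbreviation ky where "ky \<equiv> Poly_Mapping.keys"

text \<open>Otherwise simp turns \<open>bvec 0\<close> into the ring element \<open>1\<close>, and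
  the rules about \<open>bvec\<close> no longer match.\<close>

declare single_one [simp del]

lemma scal_0 [simp]: "scal 0 x = 0" "scal c 0 = 0"
  and scal_1 [simp]: "scal 1 x = x"
  and scal_scal [simp]: "scal a (scal b x) = scal (a * b) x"
  and scal_add_left: "scal (a + b) x = scal a x + scal b x"
  and scal_minus_left [simp]: "scal (- a) x = - scal a x"
  and scal_minus_right [simp]: "scal a (- x) = - scal a x"
  and scal_single [simp]: "scal a (Poly_Mapping.single i k) = Poly_Mapping.single i (a * k)"
  by (auto intro!: poly_mapping_eqI
      simp: lookup_scal lookup_add lookup_minus lookup_single when_def algebra_simps)

lemma scal_sum: "scal a (sum f S) = (\<Sum>i\<in>S. scal a (f i))"
  by (rule pm.scale_sum_right)

lemma keys_scal: "ky (scal a x) \<subseteq> ky x"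
  by (auto simp: in_keys_iff lookup_scal)

lemma lin_superset:
  assumes "finite S" "ky x \<subseteq> S"
  shows "lin f x = (\<Sum>b\<in>S. scal (lk x b) (f b))"
  unfolding lin_def by (rule sum.mono_neutral_left) (use assms in \<open>auto simp: in_keys_iff\<close>)

lemma lookup_lin: "lk (lin f x) c = (\<Sum>b\<in>ky x. lk x b * lk (f b) c)"
  by (simp add: lin_def lookup_sum lookup_scal)

lemma lin_zero [simp]: "lin f 0 = 0"
  by (simp add: lin_def)

text \<open>Keys of a sum may cancel, so all three terms are expanded over the common finite set
  \<open>ky x \<union> ky y\<close>.\<close>

lemma lin_add: "lin f (x + y) = lin f x + lin f y"
proof -
  have "lin f z = (\<Sum>b\<in>ky x \<union> ky y. scal (lk z b) (f b))" if "ky z \<subseteq> ky x \<union> ky y" for z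
    by (rule lin_superset) (use that in auto)
  then show ?thesis
    by (simp add: Poly_Mapping.keys_add lookup_add scal_add_left sum.distrib)
qed

lemma lin_scal: "lin f (scal a x) = scal a (lin f x)"
  by (subst lin_superset[of "ky x"]) (auto simp: keys_scal lookup_scal lin_def scal_sum)

lemma lin_minus: "lin f (- x) = - lin f x"
  using lin_scal[of f "-1" x] by simp

lemma lin_diff: "lin f (x - y) = lin f x - lin f y"
  using lin_add[of f x "- y"] by (simp add: lin_minus)

lemma lin_sum: "lin f (sum g S) = (\<Sum>i\<in>S. lin f (g i))"
  by (induction S rule: infinite_finite_induct) (auto simp: lin_add)

lemma lin_single [simp]: "lin f (Poly_Mapping.single b k) = scal k (f b)"
  by (subst lin_superset[of "{b}"]) auto

lemma lin_bvec [simp]: "lin bvec x = x"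
  by (rule poly_mapping_eqI)
    (auto simp: lookup_lin lookup_single when_def in_keys_iff if_distrib[of "(*) _"] cong: if_cong)

lemma lin_cong: "(\<And>b. b \<in> ky x \<Longrightarrow> f b = g b) \<Longrightarrow> lin f x = lin g x"
  by (simp add: lin_def)

lemma lin_lin: "lin g (lin f x) = lin (\<lambda>b. lin g (f b)) x"
  by (simp add: lin_def[of f] lin_def[of "\<lambda>b. lin g (f b)"] lin_sum lin_scal)

lemma lin_fun_zero [simp]: "lin (\<lambda>b. 0) x = 0"
  by (simp add: lin_def)

lemma lin_fun_scal: "lin (\<lambda>b. scal a (f b)) x = scal a (lin f x)"
  by (simp add: lin_def scal_sum mult.commute)

lemma lin_swap: "lin (\<lambda>b. lin (\<lambda>c. f b c) y) x = lin (\<lambda>c. lin (\<lambda>b. f b c) x) y"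
  by (simp add: lin_def scal_sum sum.swap[of _ "ky y"] mult.commute)

section \<open>Tensors of vectors\<close>

lemma lookup_tens [simp]: "lk (x \<otimes> y) (b, c) = lk x b * lk y c"
proof -
  have "lk (x \<otimes> y) (b, c) = (\<Sum>b'\<in>ky x. if b' = b then (\<Sum>c'\<in>ky y. if c' = c then lk x b' * lk y c' else 0) else 0)"
    unfolding tens_def lookup_sum
    by (intro sum.cong refl) (auto simp: lookup_single when_def intro!: sum.neutral sum.cong)
  also have "\<dots> = lk x b * lk y c"
    by (auto simp: in_keys_iff)
  finally show ?thesis .
qed

lemma keys_tens: "ky (x \<otimes> y) = ky x \<times> ky y"
  by (auto simp: in_keys_iff)

lemma tens_zero [simp]: "0 \<otimes> y = 0" "x \<otimes> 0 = 0"
  and tens_add_left: "(x + x') \<otimes> y = x \<otimes> y + x' \<otimes> y"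
  and tens_add_right: "x \<otimes> (y + y') = x \<otimes> y + x \<otimes> y'"
  and tens_diff_left: "(x - x') \<otimes> y = x \<otimes> y - x' \<otimes> y"
  and tens_diff_right: "x \<otimes> (y - y') = x \<otimes> y - x \<otimes> y'"
  and tens_minus_left [simp]: "(- x) \<otimes> y = - (x \<otimes> y)"
  and tens_minus_right [simp]: "x \<otimes> (- y) = - (x \<otimes> y)"
  and tens_scal_left [simp]: "scal a x \<otimes> y = scal a (x \<otimes> y)"
  and tens_scal_right [simp]: "x \<otimes> scal a y = scal a (x \<otimes> y)"
  by (auto intro!: poly_mapping_eqI simp: lookup_add lookup_minus lookup_scal algebra_simps)

lemma tens_single [simp]:
  "Poly_Mapping.single b k \<otimes> Poly_Mapping.single c l = Poly_Mapping.single (b, c) (k * l)"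
  by (auto intro!: poly_mapping_eqI simp: lookup_single when_def)

lemma tens_sum_left: "sum f S \<otimes> y = (\<Sum>i\<in>S. f i \<otimes> y)"
  by (induction S rule: infinite_finite_induct) (auto simp: tens_add_left)

lemma tens_sum_right: "x \<otimes> sum f S = (\<Sum>i\<in>S. x \<otimes> f i)"
  by (induction S rule: infinite_finite_induct) (auto simp: tens_add_right)

lemma lin_tens: "lin f (x \<otimes> y) = lin (\<lambda>b. lin (\<lambda>c. f (b, c)) y) x"
  unfolding tens_def[of x] lin_sum
  by (simp add: lin_def[of _ x] lin_def[of _ y] scal_sum)

lemma tens_lin_left: "lin f x \<otimes> y = lin (\<lambda>b. f b \<otimes> y) x"
  by (simp add: lin_def tens_sum_left)

lemma tens_lin_right: "x \<otimes> lin f y = lin (\<lambda>c. x \<otimes> f c) y"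
  by (simp add: lin_def tens_sum_right)

lemma lin_tens_tens: "lin (\<lambda>(b, c). f b \<otimes> g c) (x \<otimes> y) = lin f x \<otimes> lin g y"
  by (simp add: lin_tens tens_lin_left) (simp add: tens_lin_right)


section \<open>Superalgebras and their morphisms\<close>

lemma hpart_vec: "x \<in> hpart V p \<Longrightarrow> x \<in> vec V"
  by (auto simp: hpart_def vec_def)

lemma vec_closed [simp, intro]:
  shows vec_zero: "0 \<in> vec V"
    and vec_add: "x \<in> vec V \<Longrightarrow> y \<in> vec V \<Longrightarrow> x + y \<in> vec V"
    and vec_minus: "x \<in> vec V \<Longrightarrow> - x \<in> vec V"
    and vec_diff: "x \<in> vec V \<Longrightarrow> y \<in> vec V \<Longrightarrow> x - y \<in> vec V"
    and vec_scal: "x \<in> vec V \<Longrightarrow> scal a x \<in> vec V"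
  using Poly_Mapping.keys_add[of x y] keys_diff[of x y] keys_scal[of a x]
  by (auto simp: vec_def)

lemma vec_sum: "(\<And>i. i \<in> S \<Longrightarrow> f i \<in> vec V) \<Longrightarrow> sum f S \<in> vec V"
  by (induction S rule: infinite_finite_induct) auto

lemma hpart_closed [simp, intro]:
  shows hpart_zero: "0 \<in> hpart V p"
    and hpart_add: "x \<in> hpart V p \<Longrightarrow> y \<in> hpart V p \<Longrightarrow> x + y \<in> hpart V p"
    and hpart_minus: "x \<in> hpart V p \<Longrightarrow> - x \<in> hpart V p"
    and hpart_diff: "x \<in> hpart V p \<Longrightarrow> y \<in> hpart V p \<Longrightarrow> x - y \<in> hpart V p"
    and hpart_scal: "x \<in> hpart V p \<Longrightarrow> scal a x \<in> hpart V p"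
  using Poly_Mapping.keys_add[of x y] keys_diff[of x y] keys_scal[of a x]
  unfolding hpart_def by (simp, blast, simp, blast+)

lemma hpart_sum: "(\<And>i. i \<in> S \<Longrightarrow> f i \<in> hpart V p) \<Longrightarrow> sum f S \<in> hpart V p"
  by (induction S rule: infinite_finite_induct) auto

lemma bvec_vec [simp]: "(bvec b :: _ \<Rightarrow>\<^sub>0 'k::field) \<in> vec V \<longleftrightarrow> b \<in> idx V"
  and bvec_hpart [simp]: "(bvec b :: _ \<Rightarrow>\<^sub>0 'k::field) \<in> hpart V p \<longleftrightarrow> b \<in> idx V \<and> par V b = p"
  by (auto simp: vec_def hpart_def)

lemma vec_keysD: "x \<in> vec V \<Longrightarrow> b \<in> ky x \<Longrightarrow> b \<in> idx V"
  by (auto simp: vec_def)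

lemma hpart_keysD: "x \<in> hpart V p \<Longrightarrow> b \<in> ky x \<Longrightarrow> b \<in> idx V \<and> par V b = p"
  by (auto simp: hpart_def)

lemma lin_vec: "(\<And>b. b \<in> ky x \<Longrightarrow> f b \<in> vec W) \<Longrightarrow> lin f x \<in> vec W"
  unfolding lin_def by (intro vec_sum vec_scal)

lemma lin_hpart: "(\<And>b. b \<in> ky x \<Longrightarrow> f b \<in> hpart W p) \<Longrightarrow> lin f x \<in> hpart W p"
  unfolding lin_def by (intro hpart_sum hpart_scal)

lemma even_map_vec: "even_map V W f \<Longrightarrow> x \<in> vec V \<Longrightarrow> lin f x \<in> vec W"
  unfolding even_map_def by (rule lin_vec, rule hpart_vec) (blast dest: vec_keysD)

lemma even_map_hpart: "even_map V W f \<Longrightarrow> x \<in> hpart V p \<Longrightarrow> lin f x \<in> hpart W p"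
  by (rule lin_hpart) (auto simp: even_map_def dest: hpart_keysD)

lemma tens_vec: "x \<in> vec V \<Longrightarrow> y \<in> vec W \<Longrightarrow> x \<otimes> y \<in> vec (tens_space V W)"
  by (auto simp: vec_def keys_tens tens_space_def)

lemma tens_hpart: "x \<in> hpart V p \<Longrightarrow> y \<in> hpart W q \<Longrightarrow> x \<otimes> y \<in> hpart (tens_space V W) (p \<noteq> q)"
  by (fastforce simp: hpart_def keys_tens tens_space_def)

text \<open>The case distinctions in \<open>supercommutative\<close> and \<open>tens_alg\<close>
  become a scalar here, so that signs from several exchanges can be multiplied and compared.\<close>

definition koszul_sign :: "bool \<Rightarrow> bool \<Rightarrow> 'k::field" where
  "koszul_sign p q = (if p \<and> q then - 1 else 1)"

lemma koszul_sign_simps [simp]: "koszul_sign False q = 1" "koszul_sign p False = 1" "koszul_sign True True = - 1"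
  by (auto simp: koszul_sign_def)

lemma amul_add_left: "amul A (x + y) z = amul A x z + amul A y z"
  and amul_add_right: "amul A z (x + y) = amul A z x + amul A z y"
  and amul_diff_left: "amul A (x - y) z = amul A x z - amul A y z"
  and amul_diff_right: "amul A z (x - y) = amul A z x - amul A z y"
  and amul_minus_left [simp]: "amul A (- x) z = - amul A x z"
  and amul_minus_right [simp]: "amul A z (- x) = - amul A z x"
  and amul_zero [simp]: "amul A 0 z = 0" "amul A z 0 = 0"
  and amul_scal_left [simp]: "amul A (scal a x) z = scal a (amul A x z)"
  and amul_scal_right [simp]: "amul A z (scal a x) = scal a (amul A z x)"
  by (simp_all add: amul_def tens_add_left tens_add_right tens_diff_left tens_diff_right
      lin_add lin_diff lin_minus lin_scal)

lemma amul_sum_left: "amul A (sum f S) z = (\<Sum>i\<in>S. amul A (f i) z)"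
  by (induction S rule: infinite_finite_induct) (auto simp: amul_add_left)

lemma amul_sum_right: "amul A z (sum f S) = (\<Sum>i\<in>S. amul A z (f i))"
  by (induction S rule: infinite_finite_induct) (auto simp: amul_add_right)

lemma amul_lin_left: "amul A (lin f x) y = lin (\<lambda>b. amul A (f b) y) x"
  by (simp add: lin_def amul_sum_left)

lemma amul_lin_right: "amul A y (lin f x) = lin (\<lambda>b. amul A y (f b)) x"
  by (simp add: lin_def amul_sum_right)

lemma amul_bvec [simp]: "amul A (bvec a) (bvec b) = mul A (a, b)"
  by (simp add: amul_def)

lemma amul_single [simp]:
  "amul A (Poly_Mapping.single a k) (Poly_Mapping.single b l) = scal (k * l) (mul A (a, b))"
  by (simp add: amul_def)

lemma amul_basis: "amul A x y = lin (\<lambda>a. lin (\<lambda>b. mul A (a, b)) y) x"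
  by (simp add: amul_def lin_tens)

lemma superalgebra_mul_hpart:
  "superalgebra A \<Longrightarrow> a \<in> idx A \<Longrightarrow> b \<in> idx A \<Longrightarrow> mul A (a, b) \<in> hpart A (par A a \<noteq> par A b)"
  by (auto simp: superalgebra_def even_map_def tens_space_def)

lemma amul_hpart:
  assumes "superalgebra A" "x \<in> hpart A p" "y \<in> hpart A q"
  shows "amul A x y \<in> hpart A (p \<noteq> q)"
  using even_map_hpart[OF _ tens_hpart[OF assms(2,3)], of A "mul A"] assms(1)
  by (auto simp: superalgebra_def amul_def)

lemma amul_vec:
  assumes "superalgebra A" "x \<in> vec A" "y \<in> vec A"
  shows "amul A x y \<in> vec A"
  using even_map_vec[OF _ tens_vec[OF assms(2,3)], of A "mul A"] assms(1)
  by (auto simp: superalgebra_def amul_def)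

lemma superalgebraD:
  assumes "superalgebra A"
  shows amul_unit_left: "x \<in> vec A \<Longrightarrow> amul A (unit_el A) x = x"
    and amul_unit_right: "x \<in> vec A \<Longrightarrow> amul A x (unit_el A) = x"
    and amul_assoc: "x \<in> vec A \<Longrightarrow> y \<in> vec A \<Longrightarrow> z \<in> vec A \<Longrightarrow>
      amul A (amul A x y) z = amul A x (amul A y z)"
    and unit_hpart: "unit_el A \<in> hpart A False"
  using assms by (auto simp: superalgebra_def)

text \<open>The laws are multilinear, so they are inherited from the structure constants on basis
  vectors.\<close>

lemma superalgebraI:
  fixes A :: "('a, 'b::field, 'm) superalg_scheme"
  assumes "\<And>a b. a \<in> idx A \<Longrightarrow> b \<in> idx A \<Longrightarrow> mul A (a, b) \<in> hpart A (par A a \<noteq> par A b)"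
    and "unit_el A \<in> hpart A False"
    and "\<And>a. a \<in> idx A \<Longrightarrow> amul A (unit_el A) (bvec a) = bvec a"
    and "\<And>a. a \<in> idx A \<Longrightarrow> amul A (bvec a) (unit_el A) = bvec a"
    and "\<And>a b c. a \<in> idx A \<Longrightarrow> b \<in> idx A \<Longrightarrow> c \<in> idx A \<Longrightarrow>
      amul A (mul A (a, b)) (bvec c) = amul A (bvec a) (mul A (b, c))"
  shows "superalgebra A"
  unfolding superalgebra_def
proof (intro conjI ballI)
  show "even_map (tens_space A A) A (mul A)"
    using assms(1) by (auto simp: even_map_def tens_space_def)
  fix x :: "'a \<Rightarrow>\<^sub>0 'b" assume x: "x \<in> vec A"
  have "amul A (unit_el A) x = lin (\<lambda>b. amul A (unit_el A) (bvec b)) x"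
    by (metis amul_lin_right lin_bvec)
  also have "\<dots> = x"
    using assms(3) vec_keysD[OF x] by (metis (mono_tags, lifting) lin_bvec lin_cong)
  finally show "amul A (unit_el A) x = x" .
  have "amul A x (unit_el A) = lin (\<lambda>b. amul A (bvec b) (unit_el A)) x"
    by (metis amul_lin_left lin_bvec)
  also have "\<dots> = x"
    using assms(4) vec_keysD[OF x] by (metis (mono_tags, lifting) lin_bvec lin_cong)
  finally show "amul A x (unit_el A) = x" .
next
  fix x y z :: "'a \<Rightarrow>\<^sub>0 'b" assume v: "x \<in> vec A" "y \<in> vec A" "z \<in> vec A"
  have "amul A (amul A x y) z = lin (\<lambda>a. lin (\<lambda>b. lin (\<lambda>c. amul A (amul A (bvec a) (bvec b)) (bvec c)) z) y) x"
    by (simp only: amul_lin_left[symmetric] amul_lin_right[symmetric] lin_bvec)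
  also have "\<dots> = lin (\<lambda>a. lin (\<lambda>b. lin (\<lambda>c. amul A (bvec a) (amul A (bvec b) (bvec c))) z) y) x"
    using assms(5) v by (intro lin_cong) (auto dest!: vec_keysD)
  also have "\<dots> = amul A x (amul A y z)"
    by (simp only: amul_lin_left[symmetric] amul_lin_right[symmetric] lin_bvec)
  finally show "amul A (amul A x y) z = amul A x (amul A y z)" .
qed (use assms in auto)

lemma supercommutativeD:
  assumes "supercommutative A" "x \<in> hpart A p" "y \<in> hpart A q"
  shows "amul A x y = scal (koszul_sign p q) (amul A y x)"
proof -
  have "amul A x y = (if p \<and> q then - amul A y x else amul A y x)"
    using assms unfolding supercommutative_def by blast
  also have "\<dots> = scal (koszul_sign p q) (amul A y x)" by (simp add: koszul_sign_def)
  finally show ?thesis .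
qed

lemma supercommutativeI:
  fixes A :: "('a, 'b::field, 'm) superalg_scheme"
  assumes "\<And>a b. a \<in> idx A \<Longrightarrow> b \<in> idx A \<Longrightarrow> mul A (a, b) = scal (koszul_sign (par A a) (par A b)) (mul A (b, a))"
  shows "supercommutative A"
  unfolding supercommutative_def
proof (intro allI ballI)
  fix p q and x y :: "'a \<Rightarrow>\<^sub>0 'b" assume x: "x \<in> hpart A p" and y: "y \<in> hpart A q"
  have "amul A x y = lin (\<lambda>a. lin (\<lambda>b. scal (koszul_sign p q) (mul A (b, a))) y) x"
    unfolding amul_basis
    by (intro lin_cong) (use assms hpart_keysD[OF x] hpart_keysD[OF y] in blast)
  also have "\<dots> = scal (koszul_sign p q) (amul A y x)"
    unfolding amul_basis lin_fun_scal by (subst lin_swap) simp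
  finally show "amul A x y = (if p \<and> q then - amul A y x else amul A y x)"
    by (simp add: koszul_sign_def)
qed

lemma superalg_homD:
  assumes "superalg_hom A B f"
  shows hom_vec: "x \<in> vec A \<Longrightarrow> lin f x \<in> vec B"
    and hom_hpart: "x \<in> hpart A p \<Longrightarrow> lin f x \<in> hpart B p"
    and hom_basis_hpart: "a \<in> idx A \<Longrightarrow> f a \<in> hpart B (par A a)"
    and hom_basis_vec: "a \<in> idx A \<Longrightarrow> f a \<in> vec B"
    and hom_unit: "lin f (unit_el A) = unit_el B"
    and hom_amul: "x \<in> vec A \<Longrightarrow> y \<in> vec A \<Longrightarrow> lin f (amul A x y) = amul B (lin f x) (lin f y)"
proof -
  have e: "even_map A B f" using assms by (simp add: superalg_hom_def)
  show "x \<in> vec A \<Longrightarrow> lin f x \<in> vec B" "x \<in> hpart A p \<Longrightarrow> lin f x \<in> hpart B p"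
    by (rule even_map_vec[OF e], assumption) (rule even_map_hpart[OF e], assumption)
  show "a \<in> idx A \<Longrightarrow> f a \<in> hpart B (par A a)"
    using e by (simp add: even_map_def)
  then show "a \<in> idx A \<Longrightarrow> f a \<in> vec B" by (blast intro: hpart_vec)
qed (use assms in \<open>simp_all add: superalg_hom_def\<close>)

lemma superalg_homI:
  fixes A :: "('a, 'b::field, 'm) superalg_scheme"
  assumes "\<And>a. a \<in> idx A \<Longrightarrow> f a \<in> hpart B (par A a)"
    and "lin f (unit_el A) = unit_el B"
    and "\<And>a b. a \<in> idx A \<Longrightarrow> b \<in> idx A \<Longrightarrow> lin f (mul A (a, b)) = amul B (f a) (f b)"
  shows "superalg_hom A B f"
  unfolding superalg_hom_def
proof (intro conjI ballI)
  fix x y :: "'a \<Rightarrow>\<^sub>0 'b" assume v: "x \<in> vec A" "y \<in> vec A"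
  have "lin f (amul A x y) = lin (\<lambda>a. lin (\<lambda>b. amul B (f a) (f b)) y) x"
    unfolding amul_basis[of A] lin_lin using assms(3) v by (intro lin_cong) (auto dest!: vec_keysD)
  then show "lin f (amul A x y) = amul B (lin f x) (lin f y)"
    by (simp only: amul_lin_left[symmetric] amul_lin_right[symmetric])
qed (use assms in \<open>auto simp: even_map_def\<close>)

lemma superalg_hom_comp:
  assumes "superalg_hom A B f" "superalg_hom B C g"
  shows "superalg_hom A C (\<lambda>b. lin g (f b))"
  unfolding superalg_hom_def even_map_def lin_lin[symmetric]
proof (intro conjI ballI)
  show "lin g (f b) \<in> hpart C (par A b)" if "b \<in> idx A" for b
    by (intro hom_hpart[OF assms(2)] hom_basis_hpart[OF assms(1)] that)
  show "lin g (lin f (unit_el A)) = unit_el C"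
    by (simp add: hom_unit[OF assms(1)] hom_unit[OF assms(2)])
  show "lin g (lin f (amul A x y)) = amul C (lin g (lin f x)) (lin g (lin f y))"
    if "x \<in> vec A" "y \<in> vec A" for x y
    using that by (simp add: hom_amul[OF assms(1)] hom_amul[OF assms(2)] hom_vec[OF assms(1)])
qed

lemma superalg_hom_id: "superalgebra A \<Longrightarrow> superalg_hom A A bvec"
  by (rule superalg_homI) (auto simp: superalgebraD)

section \<open>Tensor products of superalgebras\<close>

lemma tens_alg_simps [simp]:
  "idx (tens_alg A B) = idx A \<times> idx B"
  "par (tens_alg A B) = (\<lambda>(a, b). par A a \<noteq> par B b)"
  "unit_el (tens_alg A B) = unit_el A \<otimes> unit_el B"
  by (simp_all add: tens_alg_def tens_space_def)

lemma mul_tens_alg: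
  "mul (tens_alg A B) ((a, b), (c, d)) = scal (koszul_sign (par B b) (par A c)) (mul A (a, c) \<otimes> mul B (b, d))"
  by (simp add: tens_alg_def koszul_sign_def)

lemma hpart_tens_alg: "hpart (tens_alg A B) p = hpart (tens_space A B) p"
  and vec_tens_alg: "vec (tens_alg A B) = vec (tens_space A B)"
  by (simp_all add: hpart_def vec_def tens_alg_def)

lemma tens_alg_hpart:
  "x \<in> hpart A p \<Longrightarrow> y \<in> hpart B q \<Longrightarrow> x \<otimes> y \<in> hpart (tens_alg A B) (p \<noteq> q)"
  unfolding hpart_tens_alg by (rule tens_hpart)

lemma tens_alg_vec: "x \<in> vec A \<Longrightarrow> y \<in> vec B \<Longrightarrow> x \<otimes> y \<in> vec (tens_alg A B)"
  unfolding vec_tens_alg by (rule tens_vec)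

text \<open>Only the two inner factors pass each other, so the sign is determined by their parities
  alone and the outer factors may be inhomogeneous.\<close>

lemma amul_tens_alg:
  assumes "y \<in> hpart B q" "x' \<in> hpart A p"
  shows "amul (tens_alg A B) (x \<otimes> y) (x' \<otimes> y') = scal (koszul_sign q p) (amul A x x' \<otimes> amul B y y')"
proof -
  have "amul (tens_alg A B) (x \<otimes> y) (x' \<otimes> y') =
      lin (\<lambda>a. lin (\<lambda>b. lin (\<lambda>a'. lin (\<lambda>b'. scal (koszul_sign q p) (mul A (a, a') \<otimes> mul B (b, b'))) y') x') y) x"
    unfolding amul_basis lin_tens mul_tens_alg
    using hpart_keysD[OF assms(1)] hpart_keysD[OF assms(2)] by (intro lin_cong) auto
  also have "\<dots> = lin (\<lambda>a. lin (\<lambda>a'. lin (\<lambda>b. lin (\<lambda>b'. scal (koszul_sign q p) (mul A (a, a') \<otimes> mul B (b, b'))) y') y) x') x"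
    by (intro lin_cong) (subst lin_swap, rule refl)
  also have "\<dots> = scal (koszul_sign q p) (amul A x x' \<otimes> amul B y y')"
    unfolding amul_basis tens_lin_left unfolding tens_lin_right lin_fun_scal by simp
  finally show ?thesis .
qed

lemma superalgebra_tens_alg:
  assumes A: "superalgebra A" and B: "superalgebra B"
  shows "superalgebra (tens_alg A B)"
proof (rule superalgebraI)
  fix x y assume *: "x \<in> idx (tens_alg A B)" "y \<in> idx (tens_alg A B)"
  obtain a b c d where xy: "x = (a, b)" "y = (c, d)" by fastforce
  have "mul A (a, c) \<otimes> mul B (b, d) \<in> hpart (tens_alg A B) ((par A a \<noteq> par A c) \<noteq> (par B b \<noteq> par B d))"
    using * xy by (intro tens_alg_hpart superalgebra_mul_hpart A B) auto
  moreover have "((par A a \<noteq> par A c) \<noteq> (par B b \<noteq> par B d)) =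
      (par (tens_alg A B) x \<noteq> par (tens_alg A B) y)"
    using xy by auto
  ultimately show "mul (tens_alg A B) (x, y) \<in> hpart (tens_alg A B) (par (tens_alg A B) x \<noteq> par (tens_alg A B) y)"
    unfolding xy mul_tens_alg by auto
next
  show "unit_el (tens_alg A B) \<in> hpart (tens_alg A B) False"
    using tens_alg_hpart[OF unit_hpart[OF A] unit_hpart[OF B]] by simp
next
  fix x assume *: "x \<in> idx (tens_alg A B)"
  obtain a b where x: "x = (a, b)" by fastforce
  have e: "bvec x = bvec a \<otimes> bvec b" "bvec a \<in> hpart A (par A a)" "bvec b \<in> hpart B (par B b)"
      "bvec a \<in> vec A" "bvec b \<in> vec B"
    using * x by auto
  show "amul (tens_alg A B) (unit_el (tens_alg A B)) (bvec x) = bvec x"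
    unfolding e(1) tens_alg_simps
    using e by (subst amul_tens_alg[OF unit_hpart[OF B] e(2)]) (simp add: superalgebraD A B del: tens_single)
  show "amul (tens_alg A B) (bvec x) (unit_el (tens_alg A B)) = bvec x"
    unfolding e(1) tens_alg_simps
    using e by (subst amul_tens_alg[OF e(3) unit_hpart[OF A]]) (simp add: superalgebraD A B del: tens_single)
next
  fix x y z assume *: "x \<in> idx (tens_alg A B)" "y \<in> idx (tens_alg A B)" "z \<in> idx (tens_alg A B)"
  obtain a a' b b' c c' where x: "x = (a, a')" "y = (b, b')" "z = (c, c')" by (metis surj_pair)
  have i: "a \<in> idx A" "b \<in> idx A" "c \<in> idx A" "a' \<in> idx B" "b' \<in> idx B" "c' \<in> idx B"
    using * x by auto
  have z: "bvec z = bvec c \<otimes> bvec c'" "bvec x = bvec a \<otimes> bvec a'" using x by auto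
  have 1: "amul A (mul A (a, b)) (bvec c) = amul A (bvec a) (mul A (b, c))"
    using amul_assoc[OF A, of "bvec a" "bvec b" "bvec c"] i by simp
  have 2: "amul B (mul B (a', b')) (bvec c') = amul B (bvec a') (mul B (b', c'))"
    using amul_assoc[OF B, of "bvec a'" "bvec b'" "bvec c'"] i by simp
  have "amul (tens_alg A B) (mul (tens_alg A B) (x, y)) (bvec z) =
     scal (koszul_sign (par B a') (par A b) * koszul_sign (par B a' \<noteq> par B b') (par A c))
      (amul A (mul A (a, b)) (bvec c) \<otimes> amul B (mul B (a', b')) (bvec c'))"
    unfolding x(1,2) mul_tens_alg z amul_scal_left
    using i by (subst amul_tens_alg[OF superalgebra_mul_hpart[OF B], of a' b' "bvec c" A "par A c"]) auto
  moreover have "amul (tens_alg A B) (bvec x) (mul (tens_alg A B) (y, z)) =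
     scal (koszul_sign (par B b') (par A c) * koszul_sign (par B a') (par A b \<noteq> par A c))
      (amul A (bvec a) (mul A (b, c)) \<otimes> amul B (bvec a') (mul B (b', c')))"
    unfolding x(2,3) mul_tens_alg z amul_scal_right
    using i by (subst amul_tens_alg[OF _ superalgebra_mul_hpart[OF A], of "bvec a'" B "par B a'"]) auto
  moreover have "koszul_sign (par B a') (par A b) * koszul_sign (par B a' \<noteq> par B b') (par A c) =
      (koszul_sign (par B b') (par A c) * koszul_sign (par B a') (par A b \<noteq> par A c) :: 'b)"
    by (auto simp: koszul_sign_def)
  ultimately show "amul (tens_alg A B) (mul (tens_alg A B) (x, y)) (bvec z)
      = amul (tens_alg A B) (bvec x) (mul (tens_alg A B) (y, z))"
    using 1 2 by simp
qed

lemma supercommutative_tens_alg: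
  assumes "superalgebra A" "superalgebra B" "supercommutative A" "supercommutative B"
  shows "supercommutative (tens_alg A B)"
proof (rule supercommutativeI)
  fix x y assume *: "x \<in> idx (tens_alg A B)" "y \<in> idx (tens_alg A B)"
  obtain a b c d where xy: "x = (a, b)" "y = (c, d)" by fastforce
  have 1: "mul A (a, c) = scal (koszul_sign (par A a) (par A c)) (mul A (c, a))"
    using supercommutativeD[OF assms(3), of "bvec a" "par A a" "bvec c" "par A c"] * xy by simp
  have 2: "mul B (b, d) = scal (koszul_sign (par B b) (par B d)) (mul B (d, b))"
    using supercommutativeD[OF assms(4), of "bvec b" "par B b" "bvec d" "par B d"] * xy by simp
  show "mul (tens_alg A B) (x, y) = scal (koszul_sign (par (tens_alg A B) x) (par (tens_alg A B) y)) (mul (tens_alg A B) (y, x))"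
    unfolding xy mul_tens_alg 1 2 by (auto simp: koszul_sign_def)
qed


section \<open>Tensor products and points\<close>

definition supercomm_alg :: "('b, 'k::field, 'm) superalg_scheme \<Rightarrow> bool" where
  "supercomm_alg A \<longleftrightarrow> superalgebra A \<and> supercommutative A"

lemma supercomm_alg_tens_alg: "supercomm_alg A \<Longrightarrow> supercomm_alg B \<Longrightarrow> supercomm_alg (tens_alg A B)"
  by (simp add: supercomm_alg_def superalgebra_tens_alg supercommutative_tens_alg)

text \<open>This is the sign of the product in \<open>tens_alg\<close>, reproduced inside a
  supercommutative algebra; it is what makes \<open>pair_pt\<close> multiplicative.\<close>

lemma amul_middle_swap:
  assumes A: "supercomm_alg A" and "x \<in> vec A" "y \<in> hpart A q" "z \<in> hpart A p" "w \<in> vec A"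
  shows "amul A (amul A x y) (amul A z w) = scal (koszul_sign q p) (amul A (amul A x z) (amul A y w))"
proof -
  have S: "superalgebra A" "supercommutative A" using A by (auto simp: supercomm_alg_def)
  have v: "y \<in> vec A" "z \<in> vec A" using assms hpart_vec by blast+
  have "amul A (amul A x y) (amul A z w) = amul A x (amul A (amul A y z) w)"
    using assms v S by (simp add: amul_assoc amul_vec)
  also have "\<dots> = scal (koszul_sign q p) (amul A x (amul A (amul A z y) w))"
    by (subst supercommutativeD[OF S(2) assms(3,4)]) simp
  also have "\<dots> = scal (koszul_sign q p) (amul A (amul A x z) (amul A y w))"
    using assms v S by (simp add: amul_assoc amul_vec)
  finally show ?thesis .
qed

lemma lin_pair_pt_tens: "lin (pair_pt A f g) (x \<otimes> y) = amul A (lin f x) (lin g y)"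
  unfolding pair_pt_def lin_tens by (simp only: prod.case amul_lin_left[symmetric] amul_lin_right[symmetric])

text \<open>Universal property: a pair of morphisms into a supercommutative algebra extends to the
  tensor product, because the sign rule there agrees with the commutation rule in the
  target.\<close>

lemma pair_pt_hom:
  assumes A: "supercomm_alg A" and f: "superalg_hom B A f" and g: "superalg_hom C A g"
  shows "superalg_hom (tens_alg B C) A (pair_pt A f g)"
proof (rule superalg_homI)
  have S: "superalgebra A" using A by (auto simp: supercomm_alg_def)
  show "lin (pair_pt A f g) (unit_el (tens_alg B C)) = unit_el A"
    using S by (simp add: lin_pair_pt_tens hom_unit[OF f] hom_unit[OF g] amul_unit_left hpart_vec[OF unit_hpart])
  fix x assume "x \<in> idx (tens_alg B C)"
  then show "pair_pt A f g x \<in> hpart A (par (tens_alg B C) x)"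
    using amul_hpart[OF S hom_basis_hpart[OF f] hom_basis_hpart[OF g]] by (auto simp: pair_pt_def)
next
  fix x y assume *: "x \<in> idx (tens_alg B C)" "y \<in> idx (tens_alg B C)"
  obtain a b c d where xy: "x = (a, b)" "y = (c, d)" by fastforce
  have i: "a \<in> idx B" "c \<in> idx B" "b \<in> idx C" "d \<in> idx C" using * xy by auto
  have 1: "lin f (mul B (a, c)) = amul A (f a) (f c)"
    using hom_amul[OF f, of "bvec a" "bvec c"] i by simp
  have 2: "lin g (mul C (b, d)) = amul A (g b) (g d)"
    using hom_amul[OF g, of "bvec b" "bvec d"] i by simp
  show "lin (pair_pt A f g) (mul (tens_alg B C) (x, y)) = amul A (pair_pt A f g x) (pair_pt A f g y)"
    unfolding xy mul_tens_alg lin_scal lin_pair_pt_tens 1 2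
    unfolding pair_pt_def prod.case
    by (rule amul_middle_swap[OF A, symmetric])
       (use i hom_basis_hpart[OF f] hom_basis_hpart[OF g] hom_basis_vec[OF f] hom_basis_vec[OF g] in auto)
qed

lemma lin_inc1: "lin (inc1 B) x = x \<otimes> unit_el B"
  unfolding inc1_def tens_lin_left[symmetric] by simp

lemma lin_inc2: "lin (inc2 A) x = unit_el A \<otimes> x"
  unfolding inc2_def tens_lin_right[symmetric] by simp

lemma inc1_hom:
  assumes "supercomm_alg A" "supercomm_alg B"
  shows "superalg_hom A (tens_alg A B) (inc1 B)"
proof (rule superalg_homI)
  fix a b assume i: "a \<in> idx A" "b \<in> idx A"
  have S: "superalgebra A" "superalgebra B" using assms by (auto simp: supercomm_alg_def)
  show "inc1 B a \<in> hpart (tens_alg A B) (par A a)"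
    using tens_alg_hpart[OF _ unit_hpart[OF S(2)], of "bvec a" A "par A a"] i by (simp add: inc1_def)
  have "amul (tens_alg A B) (bvec a \<otimes> unit_el B) (bvec b \<otimes> unit_el B) = scal (koszul_sign False (par A b)) (amul A (bvec a) (bvec b) \<otimes> amul B (unit_el B) (unit_el B))"
    by (rule amul_tens_alg[OF unit_hpart[OF S(2)]]) (use i in auto)
  then show "lin (inc1 B) (mul A (a, b)) = amul (tens_alg A B) (inc1 B a) (inc1 B b)"
    unfolding lin_inc1 using S by (simp add: inc1_def amul_unit_left hpart_vec[OF unit_hpart])
qed (simp add: lin_inc1)

lemma inc2_hom:
  assumes "supercomm_alg A" "supercomm_alg B"
  shows "superalg_hom B (tens_alg A B) (inc2 A)"
proof (rule superalg_homI)
  fix a b assume i: "a \<in> idx B" "b \<in> idx B"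
  have S: "superalgebra A" "superalgebra B" using assms by (auto simp: supercomm_alg_def)
  show "inc2 A a \<in> hpart (tens_alg A B) (par B a)"
    using tens_alg_hpart[OF unit_hpart[OF S(1)], of "bvec a" B "par B a"] i by (simp add: inc2_def)
  have "amul (tens_alg A B) (unit_el A \<otimes> bvec a) (unit_el A \<otimes> bvec b) = scal (koszul_sign (par B a) False) (amul A (unit_el A) (unit_el A) \<otimes> amul B (bvec a) (bvec b))"
    by (rule amul_tens_alg[OF _ unit_hpart[OF S(1)]]) (use i in auto)
  then show "lin (inc2 A) (mul B (a, b)) = amul (tens_alg A B) (inc2 A a) (inc2 A b)"
    unfolding lin_inc2 using S by (simp add: inc2_def amul_unit_left hpart_vec[OF unit_hpart])
qed (simp add: lin_inc2)

lemma amul_inc1_inc2: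
  assumes "supercomm_alg A" "supercomm_alg B" "x \<in> vec A" "y \<in> vec B"
  shows "amul (tens_alg A B) (x \<otimes> unit_el B) (unit_el A \<otimes> y) = x \<otimes> y"
proof -
  have S: "superalgebra A" "superalgebra B" using assms by (auto simp: supercomm_alg_def)
  show ?thesis
    using assms S by (subst amul_tens_alg[OF unit_hpart[OF S(2)] unit_hpart[OF S(1)]])
      (simp add: amul_unit_left amul_unit_right)
qed

lemma hom_pair_pt:
  assumes "superalg_hom A B \<phi>" "f b \<in> vec A" "g c \<in> vec A"
  shows "lin \<phi> (pair_pt A f g (b, c)) = pair_pt B (\<lambda>b. lin \<phi> (f b)) (\<lambda>c. lin \<phi> (g c)) (b, c)"
  using assms by (simp add: pair_pt_def hom_amul)

lemma hom_lin_pair_pt: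
  assumes "superalg_hom A B \<phi>" "z \<in> vec (tens_alg C D)"
    "\<And>b. b \<in> idx C \<Longrightarrow> f b \<in> vec A" "\<And>c. c \<in> idx D \<Longrightarrow> g c \<in> vec A"
  shows "lin \<phi> (lin (pair_pt A f g) z) = lin (pair_pt B (\<lambda>b. lin \<phi> (f b)) (\<lambda>c. lin \<phi> (g c))) z"
  unfolding lin_lin
proof (rule lin_cong)
  fix x assume "x \<in> ky z"
  then have "fst x \<in> idx C" "snd x \<in> idx D" using vec_keysD[OF assms(2), of x] by (auto simp: mem_Times_iff)
  then show "lin \<phi> (pair_pt A f g x) = pair_pt B (\<lambda>b. lin \<phi> (f b)) (\<lambda>c. lin \<phi> (g c)) x"
    using hom_pair_pt[OF assms(1), of f "fst x" g "snd x"] assms(3,4) by simp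
qed

text \<open>Values outside the index set are arbitrary, so structure maps are known only on
  \<open>idx A\<close>; being a morphism does not depend on the rest.\<close>

lemma superalg_hom_cong:
  assumes A: "superalgebra A" and eq: "\<And>a. a \<in> idx A \<Longrightarrow> f a = g a" and g: "superalg_hom A B g"
  shows "superalg_hom A B f"
proof -
  have l: "lin f x = lin g x" if "x \<in> vec A" for x
    using that by (intro lin_cong eq) (rule vec_keysD)
  show ?thesis
    using g A unfolding superalg_hom_def even_map_def
    by (simp add: l eq amul_vec hpart_vec[OF unit_hpart])
qed

text \<open>This is what closes the points over any supercommutative \<open>A\<close> under
  \<open>mult_pt\<close> and \<open>inv_pt\<close>. The antipode is multiplicative rather than
  antimultiplicative because of supercommutativity.\<close>

definition hopf_homs :: "('b, 'k::field, 'm) hopf_scheme \<Rightarrow> bool" where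
  "hopf_homs C \<longleftrightarrow> supercomm_alg C \<and> superalg_hom C (tens_alg C C) (comult C) \<and> superalg_hom C C (antip C)"

lemma mult_pt_hom:
  assumes "hopf_homs C" "supercomm_alg A" "superalg_hom C A f" "superalg_hom C A g"
  shows "superalg_hom C A (mult_pt C A f g)"
  unfolding mult_pt_def
  by (rule superalg_hom_comp[OF _ pair_pt_hom[OF assms(2,3,4)]]) (use assms in \<open>simp add: hopf_homs_def\<close>)

lemma inv_pt_hom:
  assumes "hopf_homs C" "superalg_hom C A f"
  shows "superalg_hom C A (inv_pt C f)"
  unfolding inv_pt_def
  by (rule superalg_hom_comp[OF _ assms(2)]) (use assms in \<open>simp add: hopf_homs_def\<close>)

lemma act_pt_hom:
  assumes "superalg_hom X (tens_alg X G) \<rho>" "supercomm_alg A" "superalg_hom X A x" "superalg_hom G A g"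
  shows "superalg_hom X A (act_pt A \<rho> x g)"
  unfolding act_pt_def by (rule superalg_hom_comp[OF assms(1) pair_pt_hom[OF assms(2,3,4)]])

text \<open>Naturality in the algebra of values. With its analogues for \<open>act_pt\<close> and
  \<open>inv_pt\<close> it transports formulas from the universal points to arbitrary ones.\<close>

lemma hom_mult_pt:
  assumes "hopf_homs C" "superalg_hom C A f" "superalg_hom C A g" "superalg_hom A B \<phi>" "b \<in> idx C"
  shows "lin \<phi> (mult_pt C A f g b) = mult_pt C B (\<lambda>b. lin \<phi> (f b)) (\<lambda>b. lin \<phi> (g b)) b"
  unfolding mult_pt_def
proof (rule hom_lin_pair_pt[OF assms(4)])
  show "comult C b \<in> vec (tens_alg C C)"
    using assms by (auto simp: hopf_homs_def intro: hom_basis_vec)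
qed (use assms in \<open>auto intro: hom_basis_vec\<close>)

lemma hom_act_pt:
  assumes "superalg_hom X (tens_alg X G) \<rho>" "superalg_hom X A x" "superalg_hom G A g"
    "superalg_hom A B \<phi>" "b \<in> idx X"
  shows "lin \<phi> (act_pt A \<rho> x g b) = act_pt B \<rho> (\<lambda>b. lin \<phi> (x b)) (\<lambda>b. lin \<phi> (g b)) b"
  unfolding act_pt_def
  by (rule hom_lin_pair_pt[OF assms(4) hom_basis_vec[OF assms(1,5)]])
    (use assms in \<open>auto intro: hom_basis_vec\<close>)

lemma hom_inv_pt: "lin \<phi> (inv_pt C f b) = inv_pt C (\<lambda>b. lin \<phi> (f b)) b"
  by (simp add: inv_pt_def lin_lin)

lemma lin_pair_pt_lin_inc:
  assumes "supercomm_alg A" "superalg_hom C A f" "superalg_hom D A g"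
  shows "z \<in> vec C \<Longrightarrow> lin (pair_pt A f g) (lin (inc1 D) z) = lin f z"
    "w \<in> vec D \<Longrightarrow> lin (pair_pt A f g) (lin (inc2 C) w) = lin g w"
  using assms hom_vec[OF assms(2)] hom_vec[OF assms(3)]
  by (simp_all add: lin_inc1 lin_inc2 lin_pair_pt_tens hom_unit[OF assms(2)] hom_unit[OF assms(3)]
      supercomm_alg_def superalgebraD)

section \<open>Direct products of supergroups\<close>

lemma tens_alg_prod_group:
  "tens_alg (prod_group C D) E = tens_alg (tens_alg C D) E"
  "tens_alg E (prod_group C D) = tens_alg E (tens_alg C D)"
  by (simp_all add: tens_alg_def[of _ E] tens_alg_def[of E] prod_group_def tens_space_def)

lemma prod_group_simps [simp]:
  "idx (prod_group C D) = idx C \<times> idx D"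
  "par (prod_group C D) = (\<lambda>(c, d). par C c \<noteq> par D d)"
  "mul (prod_group C D) = mul (tens_alg C D)"
  "unit_el (prod_group C D) = unit_el C \<otimes> unit_el D"
  "counit (prod_group C D) = (\<lambda>(c, d). counit C c * counit D d)"
  "antip (prod_group C D) = (\<lambda>(c, d). antip C c \<otimes> antip D d)"
  by (simp_all add: prod_group_def)

lemma vec_hpart_prod_group [simp]:
  "vec (prod_group C D) = vec (tens_alg C D)"
  "hpart (prod_group C D) = hpart (tens_alg C D)"
  "amul (prod_group C D) = amul (tens_alg C D)"
  by (auto simp: vec_def hpart_def amul_def fun_eq_iff prod_group_def)

text \<open>A \<open>hopf\<close> and a \<open>superalg\<close> record have different types and
  cannot be equated; the algebra notions see only the four common fields.\<close>

lemma superalg_cong: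
  assumes "idx A = idx A'" "par A = par A'" "mul A = mul A'" "unit_el A = unit_el A'"
  shows "supercomm_alg A = supercomm_alg A'" "superalg_hom A B f = superalg_hom A' B f"
    "superalg_hom B A g = superalg_hom B A' g"
    "vec A = vec A'" "hpart A = hpart A'" "amul A = amul A'"
proof -
  show v: "vec A = vec A'" "hpart A = hpart A'" "amul A = amul A'"
    by (auto simp: assms vec_def hpart_def amul_def fun_eq_iff)
  show "superalg_hom A B f = superalg_hom A' B f" "superalg_hom B A g = superalg_hom B A' g"
    by (simp_all add: superalg_hom_def even_map_def v assms)
  show "supercomm_alg A = supercomm_alg A'"
    by (simp add: supercomm_alg_def superalgebra_def supercommutative_def even_map_def tens_space_def v assms)
qed

lemma prod_group_cong:
  "supercomm_alg (prod_group C D) = supercomm_alg (tens_alg C D)"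
  "superalg_hom (prod_group C D) B f = superalg_hom (tens_alg C D) B f"
  "superalg_hom B (prod_group C D) g = superalg_hom B (tens_alg C D) g"
  by (rule superalg_cong; simp)+

text \<open>On basis vectors the comultiplication is the componentwise product of the two universal
  points in the twofold tensor product. Such a \<open>pair_pt\<close> is a morphism by construction,
  so the signs have to be compared only for the formula, not for multiplicativity.\<close>

lemma hopf_homs_prod_group:
  assumes C: "hopf_homs C" and D: "hopf_homs D"
  shows "hopf_homs (prod_group C D)"
proof -
  let ?T = "tens_alg C D"
  let ?T2 = "tens_alg ?T ?T"
  have s: "supercomm_alg C" "supercomm_alg D" using assms by (auto simp: hopf_homs_def)
  have sT: "supercomm_alg ?T" and sT2: "supercomm_alg ?T2" using s by (auto intro: supercomm_alg_tens_alg)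
  have S: "superalgebra C" "superalgebra D" "superalgebra ?T" using s sT by (auto simp: supercomm_alg_def)
  note u = unit_hpart[OF S(1)] unit_hpart[OF S(2)] hpart_vec[OF unit_hpart[OF S(1)]] hpart_vec[OF unit_hpart[OF S(2)]]
  let ?f1 = "\<lambda>c. lin (inc1 ?T) (inc1 D c)" and ?f2 = "\<lambda>c. lin (inc2 ?T) (inc1 D c)"
  let ?g1 = "\<lambda>d. lin (inc1 ?T) (inc2 C d)" and ?g2 = "\<lambda>d. lin (inc2 ?T) (inc2 C d)"
  have h: "superalg_hom C ?T2 ?f1" "superalg_hom C ?T2 ?f2" "superalg_hom D ?T2 ?g1" "superalg_hom D ?T2 ?g2"
    by (intro superalg_hom_comp[OF _ inc1_hom] superalg_hom_comp[OF _ inc2_hom] inc1_hom inc2_hom s sT)+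
  let ?m = "pair_pt ?T2 (mult_pt C ?T2 ?f1 ?f2) (mult_pt D ?T2 ?g1 ?g2)"
  have m: "superalg_hom ?T ?T2 ?m"
    by (intro pair_pt_hom sT2 mult_pt_hom C D h)
  have eq: "comult (prod_group C D) x = ?m x" if "x \<in> idx ?T" for x
  proof -
    obtain c d where x: "x = (c, d)" by fastforce
    have cd: "comult C c \<in> vec (tens_alg C C)" "comult D d \<in> vec (tens_alg D D)"
      using that x C D by (auto simp: hopf_homs_def dest: hom_basis_vec)
    have "comult (prod_group C D) x = lin (\<lambda>cc. lin (\<lambda>dd.
        scal (koszul_sign (par C (snd cc)) (par D (fst dd))) (bvec ((fst cc, fst dd), (snd cc, snd dd)))) (comult D d)) (comult C c)"
      unfolding prod_group_def x lin_tens by (simp add: koszul_sign_def case_prod_beta)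
    also have "\<dots> = lin (\<lambda>cc. lin (\<lambda>dd. amul ?T2 (pair_pt ?T2 ?f1 ?f2 cc) (pair_pt ?T2 ?g1 ?g2 dd)) (comult D d)) (comult C c)"
    proof (intro lin_cong)
      fix cc dd assume "cc \<in> ky (comult C c)" "dd \<in> ky (comult D d)"
      then have i: "fst cc \<in> idx C" "snd cc \<in> idx C" "fst dd \<in> idx D" "snd dd \<in> idx D"
        using vec_keysD[OF cd(1), of cc] vec_keysD[OF cd(2), of dd] by (auto simp: mem_Times_iff)
      have p1: "pair_pt ?T2 ?f1 ?f2 cc = (bvec (fst cc) \<otimes> unit_el D) \<otimes> (bvec (snd cc) \<otimes> unit_el D)"
        unfolding pair_pt_def case_prod_beta lin_inc1 lin_inc2
        using i u by (simp add: inc1_def inc2_def, subst amul_inc1_inc2[OF sT sT, simplified])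
          (auto intro!: tens_alg_vec)
      have p2: "pair_pt ?T2 ?g1 ?g2 dd = (unit_el C \<otimes> bvec (fst dd)) \<otimes> (unit_el C \<otimes> bvec (snd dd))"
        unfolding pair_pt_def case_prod_beta lin_inc1 lin_inc2
        using i u by (simp add: inc1_def inc2_def, subst amul_inc1_inc2[OF sT sT, simplified])
          (auto intro!: tens_alg_vec)
      have "amul ?T2 (pair_pt ?T2 ?f1 ?f2 cc) (pair_pt ?T2 ?g1 ?g2 dd) =
          scal (koszul_sign (par C (snd cc)) (par D (fst dd)))
            (amul ?T (bvec (fst cc) \<otimes> unit_el D) (unit_el C \<otimes> bvec (fst dd)) \<otimes>
             amul ?T (bvec (snd cc) \<otimes> unit_el D) (unit_el C \<otimes> bvec (snd dd)))"
        unfolding p1 p2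
        by (rule amul_tens_alg)
          (use i u tens_alg_hpart[of "bvec (snd cc)" C "par C (snd cc)" "unit_el D" D False]
             tens_alg_hpart[of "unit_el C" C False "bvec (fst dd)" D "par D (fst dd)"] in auto)
      then show "scal (koszul_sign (par C (snd cc)) (par D (fst dd))) (bvec ((fst cc, fst dd), (snd cc, snd dd)))
          = amul ?T2 (pair_pt ?T2 ?f1 ?f2 cc) (pair_pt ?T2 ?g1 ?g2 dd)"
        using i by (simp add: amul_inc1_inc2[OF s])
    qed
    also have "\<dots> = ?m x"
    proof -
      have "?m x = amul ?T2 (mult_pt C ?T2 ?f1 ?f2 c) (mult_pt D ?T2 ?g1 ?g2 d)"
        by (simp only: x pair_pt_def prod.case)
      then show ?thesis
        unfolding mult_pt_def by (simp only: amul_lin_left[symmetric] amul_lin_right[symmetric])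
    qed
    finally show ?thesis .
  qed
  have "superalg_hom ?T ?T2 (comult (prod_group C D))"
    using superalg_hom_cong[OF S(3) eq m] .
  moreover have "superalg_hom ?T ?T (antip (prod_group C D))"
  proof -
    have ah: "superalg_hom C C (antip C)" "superalg_hom D D (antip D)" using C D by (auto simp: hopf_homs_def)
    have h: "superalg_hom ?T ?T (pair_pt ?T (\<lambda>c. lin (inc1 D) (antip C c)) (\<lambda>d. lin (inc2 C) (antip D d)))"
      by (intro pair_pt_hom sT superalg_hom_comp[OF ah(1)] superalg_hom_comp[OF ah(2)] inc1_hom inc2_hom s)
    have "antip (prod_group C D) x = pair_pt ?T (\<lambda>c. lin (inc1 D) (antip C c)) (\<lambda>d. lin (inc2 C) (antip D d)) x"
      if "x \<in> idx ?T" for x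
      using that hom_basis_vec[OF ah(1)] hom_basis_vec[OF ah(2)]
      by (cases x) (simp add: pair_pt_def lin_inc1 lin_inc2 amul_inc1_inc2[OF s])
    from superalg_hom_cong[OF S(3) this h] show ?thesis .
  qed
  ultimately show ?thesis
    by (simp add: hopf_homs_def prod_group_cong tens_alg_prod_group sT)
qed


section \<open>The supergroups \<open>G\<close> and \<open>X\<close>\<close>

lemma hopf_homsI:
  assumes "superalgebra C" "supercommutative C" "superalg_hom C (tens_alg C C) (comult C)"
    "superalg_hom C C (antip C)"
  shows "hopf_homs C"
  using assms by (simp add: hopf_homs_def supercomm_alg_def)

lemma hopf_homs_Gm: "hopf_homs (Gm :: (int, 'k::field) hopf)"
  by (rule hopf_homsI)
    (auto intro!: superalgebraI supercommutativeI superalg_homI simp: Gm_def add.assoc mul_tens_alg, simp_all add: add.commute minus_diff_commute)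

lemma hopf_homs_Ga_odd: "hopf_homs (Ga_odd :: (bool, 'k::field) hopf)"
  by (rule hopf_homsI)
    (auto intro!: superalgebraI supercommutativeI superalg_homI simp: Ga_odd_def mul_tens_alg
      lin_add lin_minus amul_add_left amul_add_right koszul_sign_def add_ac single_add[symmetric])

text \<open>The coefficients of the product of two powers of z \<otimes> 1 + 1 \<otimes> z: this is
  Vandermonde's convolution.\<close>

lemma Ga_comult_add:
  "lin (\<lambda>n. comult Ga n) (bvec (m + n)) =
    amul (tens_alg Ga Ga) (comult Ga m) (comult (Ga :: (nat, 'k::field) hopf) n)"
proof -
  let ?f = "\<lambda>i j. Poly_Mapping.single (i + j, (m + n) - (i + j)) (of_nat (m choose i) * of_nat (n choose j) :: 'k)"
  have "amul (tens_alg Ga Ga) (comult Ga m) (comult (Ga :: (nat, 'k) hopf) n) = (\<Sum>i\<le>m. \<Sum>j\<le>n.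
      Poly_Mapping.single (i + j, (m - i) + (n - j)) (of_nat (m choose i) * of_nat (n choose j) :: 'k))"
    unfolding Ga_def by (simp add: amul_sum_left, simp add: amul_sum_right mul_tens_alg add.commute)
  also have "\<dots> = (\<Sum>i\<le>m. \<Sum>j\<le>n. ?f i j)"
    by (intro sum.cong refl) (auto intro!: arg_cong2[where f = Poly_Mapping.single])
  also have "\<dots> = (\<Sum>(i, j)\<in>{..m} \<times> {..n}. ?f i j)"
    by (simp add: sum.cartesian_product)
  \<comment> \<open>Binomials vanish outside the rectangle, so the sum may run over a triangle,
    which can be regrouped by the value of \<open>i + j\<close>.\<close>
  also have "\<dots> = (\<Sum>(i, j)\<in>{(i, j). i + j \<le> m + n}. ?f i j)"
  proof (intro sum.mono_neutral_left ballI)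
    have "?f i j = 0" if "\<not> (i \<le> m \<and> j \<le> n)" for i j
      using that by (cases "i \<le> m") (simp_all add: binomial_eq_0)
    then show "(case x of (i, j) \<Rightarrow> ?f i j) = 0"
      if "x \<in> {(i, j). i + j \<le> m + n} - {..m} \<times> {..n}" for x
      using that by (cases x) auto
  qed (auto intro: finite_subset[of _ "{..m + n} \<times> {..m + n}"])
  also have "\<dots> = (\<Sum>k\<le>m + n. \<Sum>i\<le>k. ?f i (k - i))"
    by (rule sum.triangle_reindex_eq)
  also have "\<dots> = (\<Sum>k\<le>m + n. \<Sum>i\<le>k. Poly_Mapping.single (k, (m + n) - k) (of_nat ((m choose i) * (n choose (k - i))) :: 'k))"
    by (intro sum.cong refl) simp
  also have "\<dots> = (\<Sum>k\<le>m + n. Poly_Mapping.single (k, (m + n) - k) (of_nat ((m + n) choose k) :: 'k))"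
    unfolding vandermonde[symmetric] of_nat_sum
    by (intro sum.cong refl poly_mapping_eqI) (simp add: lookup_sum lookup_single when_def)
  also have "\<dots> = lin (\<lambda>n. comult Ga n) (bvec (m + n))"
    by (simp add: Ga_def)
  finally show ?thesis by simp
qed

lemma hopf_homs_Ga: "hopf_homs (Ga :: (nat, 'k::field) hopf)"
proof (rule hopf_homsI)
  show "superalg_hom Ga (tens_alg Ga Ga) (comult (Ga :: (nat, 'k) hopf))"
  proof (rule superalg_homI)
    show "comult (Ga :: (nat, 'k) hopf) a \<in> hpart (tens_alg Ga Ga) (par (Ga :: (nat, 'k) hopf) a)" for a
      by (auto simp: Ga_def hpart_def)
    show "lin (comult Ga) (mul Ga (a, b)) = amul (tens_alg Ga Ga) (comult Ga a) (comult (Ga :: (nat, 'k) hopf) b)" for a b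
      using Ga_comult_add[of a b] by (simp add: Ga_def)
  qed (simp add: Ga_def)
qed (auto intro!: superalgebraI supercommutativeI superalg_homI simp: Ga_def add_ac power_add hpart_def)

lemma hopf_homs_G: "hopf_homs (G_grp :: (g_idx, 'k::field) hopf)"
  and hopf_homs_X: "hopf_homs (X_grp :: (x_idx, 'k::field) hopf)"
  unfolding G_grp_def X_grp_def
  by (intro hopf_homs_prod_group hopf_homs_Gm hopf_homs_Ga hopf_homs_Ga_odd)+

text \<open>The indices of \<tau>, z_1, z_2, z_3 and 1 in K[X], then of u, v and 1 in K[G]. The
  letters t, a, b, c, p, q name the values of these generators at a point throughout.\<close>

abbreviation "tI \<equiv> (1, 0, False, False) :: x_idx"
abbreviation "aI \<equiv> (0, 1, False, False) :: x_idx"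
abbreviation "bI \<equiv> (0, 0, True, False) :: x_idx"
abbreviation "cI \<equiv> (0, 0, False, True) :: x_idx"
abbreviation "eX \<equiv> (0, 0, False, False) :: x_idx"
abbreviation "pI \<equiv> (True, False) :: g_idx"
abbreviation "qI \<equiv> (False, True) :: g_idx"
abbreviation "eG \<equiv> (False, False) :: g_idx"

lemma idx_XG [simp]: "idx X_grp = UNIV" "idx G_grp = UNIV"
  and unit_XG [simp]: "unit_el X_grp = bvec eX" "unit_el G_grp = bvec eG"
  and par_XG [simp]: "par X_grp (i, n, d, e) = (d \<noteq> e)" "par G_grp (d, e) = (d \<noteq> e)"
  and counit_XG: "counit X_grp (i, n, d, e) = (if n = 0 \<and> \<not> d \<and> \<not> e then 1 else 0)"
    "counit G_grp (d, e) = (if \<not> d \<and> \<not> e then 1 else 0)"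
  by (auto simp: X_grp_def G_grp_def Gm_def Ga_def Ga_odd_def)

lemma mul_X:
  "mul X_grp ((i, n, d, e), (i', n', d', e')) =
    (if d \<and> d' \<or> e \<and> e' then 0 else scal (koszul_sign e d') (bvec (i + i', n + n', d \<or> d', e \<or> e')))"
  and mul_G: "mul G_grp ((d, e), (d', e')) =
    (if d \<and> d' \<or> e \<and> e' then 0 else scal (koszul_sign e d') (bvec (d \<or> d', e \<or> e')))"
  by (auto simp: X_grp_def G_grp_def mul_tens_alg Gm_def Ga_def Ga_odd_def)

lemma comult_X:
  "comult X_grp (i, 0, False, False) = bvec ((i, 0, False, False), (i, 0, False, False))"
  "comult X_grp aI = bvec (aI, eX) + bvec (eX, aI)"
  "comult X_grp bI = bvec (bI, eX) + bvec (eX, bI)"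
  "comult X_grp cI = bvec (cI, eX) + bvec (eX, cI)"
  by (simp_all add: X_grp_def prod_group_def Gm_def Ga_def Ga_odd_def lin_add tens_add_left tens_add_right add_ac)

lemma comult_G:
  "comult G_grp eG = bvec (eG, eG)"
  "comult G_grp pI = bvec (pI, eG) + bvec (eG, pI)"
  "comult G_grp qI = bvec (qI, eG) + bvec (eG, qI)"
  by (simp_all add: G_grp_def prod_group_def Ga_odd_def lin_add tens_add_left tens_add_right)

lemma antip_XG:
  "antip X_grp (i, 0, False, False) = bvec (- i, 0, False, False)"
  "antip X_grp aI = - bvec aI"
  "antip X_grp bI = - bvec bI"
  "antip X_grp cI = - bvec cI"
  "antip G_grp pI = - bvec pI"
  "antip G_grp qI = - bvec qI"
  by (simp_all add: X_grp_def G_grp_def Gm_def Ga_def Ga_odd_def single_uminus[symmetric])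

lemma supercomm_algD:
  assumes "supercomm_alg A"
  shows supercomm_alg_superalgebra: "superalgebra A"
    and supercomm_alg_amul_vec: "x \<in> vec A \<Longrightarrow> y \<in> vec A \<Longrightarrow> amul A x y \<in> vec A"
    and supercomm_alg_assoc: "x \<in> vec A \<Longrightarrow> y \<in> vec A \<Longrightarrow> z \<in> vec A \<Longrightarrow>
      amul A (amul A x y) z = amul A x (amul A y z)"
    and supercomm_alg_unit_left: "x \<in> vec A \<Longrightarrow> amul A (unit_el A) x = x"
    and supercomm_alg_unit_right: "x \<in> vec A \<Longrightarrow> amul A x (unit_el A) = x"
    and supercomm_alg_unit_hpart: "unit_el A \<in> hpart A False"
    and supercomm_alg_unit_vec: "unit_el A \<in> vec A"
  using assms by (auto simp: supercomm_alg_def superalgebraD amul_vec hpart_vec[OF unit_hpart])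

text \<open>The second form acts inside right-nested products; with associativity, instances of both
  sort monomials as rewrite rules.\<close>

lemma supercomm_alg_swap:
  assumes A: "supercomm_alg A" and x: "x \<in> hpart A p" and y: "y \<in> hpart A q"
  shows "amul A x y = scal (koszul_sign p q) (amul A y x)"
    and "z \<in> vec A \<Longrightarrow> amul A x (amul A y z) = scal (koszul_sign p q) (amul A y (amul A x z))"
proof -
  show 1: "amul A x y = scal (koszul_sign p q) (amul A y x)"
    using A x y supercommutativeD by (auto simp: supercomm_alg_def)
  assume "z \<in> vec A"
  then show "amul A x (amul A y z) = scal (koszul_sign p q) (amul A y (amul A x z))"
    using A hpart_vec[OF x] hpart_vec[OF y]
    by (simp add: supercomm_algD[OF A] flip: supercomm_alg_assoc[OF A]) (simp add: 1)
qed

text \<open>Commuting an odd element with itself gives 2 x x = 0, and 2 is invertible.\<close>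

lemma supercomm_alg_odd_square:
  fixes A :: "('a, 'k::field_char_0, 'm) superalg_scheme"
  assumes A: "supercomm_alg A" and x: "x \<in> hpart A True"
  shows "amul A x x = 0"
    and "z \<in> vec A \<Longrightarrow> amul A x (amul A x z) = 0"
proof -
  have "amul A x x = - amul A x x"
    using supercomm_alg_swap(1)[OF A x x] by simp
  then have "scal 2 (amul A x x) = 0"
    using scal_add_left[of 1 1 "amul A x x"] by (simp add: eq_neg_iff_add_eq_0)
  then show 1: "amul A x x = 0" by (simp add: pm.scale_eq_0_iff)
  assume "z \<in> vec A"
  then show "amul A x (amul A x z) = 0"
    using hpart_vec[OF x] by (simp flip: supercomm_alg_assoc[OF A]) (simp add: 1)
qed

section \<open>Representing matrices\<close>

text \<open>Entries beyond the four rows and columns are 0, so that equality of matrices is equality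
  of functions on all indices.\<close>

definition mat4 :: "'v::zero list list \<Rightarrow> nat \<Rightarrow> nat \<Rightarrow> 'v" where
  "mat4 R i j = (if i < 4 \<and> j < 4 then R ! i ! j else 0)"

definition mat_mult :: "('a, 'k::field, 'm) superalg_scheme \<Rightarrow> (nat \<Rightarrow> nat \<Rightarrow> ('a \<Rightarrow>\<^sub>0 'k)) \<Rightarrow>
    (nat \<Rightarrow> nat \<Rightarrow> ('a \<Rightarrow>\<^sub>0 'k)) \<Rightarrow> nat \<Rightarrow> nat \<Rightarrow> ('a \<Rightarrow>\<^sub>0 'k)" where
  "mat_mult A M N i j = (\<Sum>k<4. amul A (M i k) (N k j))"

definition mat_in :: "('a, 'k::field, 'm) superalg_scheme \<Rightarrow> (nat \<Rightarrow> nat \<Rightarrow> ('a \<Rightarrow>\<^sub>0 'k)) \<Rightarrow> bool" where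
  "mat_in A M \<longleftrightarrow> (\<forall>i j. M i j \<in> vec A)"

lemma less_4_iff: "i < 4 \<longleftrightarrow> i = 0 \<or> i = 1 \<or> i = 2 \<or> i = (3::nat)"
  by auto

lemma sum_4: "(\<Sum>k<4. f k) = f 0 + f 1 + f 2 + f (3::nat)"
  by (simp add: eval_nat_numeral)

lemma mat_mult_mat4:
  "mat_mult A (mat4 [[r11, r12, r13, r14], [r21, r22, r23, r24], [r31, r32, r33, r34], [r41, r42, r43, r44]])
        (mat4 [[s11, s12, s13, s14], [s21, s22, s23, s24], [s31, s32, s33, s34], [s41, s42, s43, s44]]) =
   mat4 [[amul A r11 s11 + amul A r12 s21 + amul A r13 s31 + amul A r14 s41,
       amul A r11 s12 + amul A r12 s22 + amul A r13 s32 + amul A r14 s42,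
       amul A r11 s13 + amul A r12 s23 + amul A r13 s33 + amul A r14 s43,
       amul A r11 s14 + amul A r12 s24 + amul A r13 s34 + amul A r14 s44],
      [amul A r21 s11 + amul A r22 s21 + amul A r23 s31 + amul A r24 s41,
       amul A r21 s12 + amul A r22 s22 + amul A r23 s32 + amul A r24 s42,
       amul A r21 s13 + amul A r22 s23 + amul A r23 s33 + amul A r24 s43,
       amul A r21 s14 + amul A r22 s24 + amul A r23 s34 + amul A r24 s44],
      [amul A r31 s11 + amul A r32 s21 + amul A r33 s31 + amul A r34 s41,
       amul A r31 s12 + amul A r32 s22 + amul A r33 s32 + amul A r34 s42,
       amul A r31 s13 + amul A r32 s23 + amul A r33 s33 + amul A r34 s43,
       amul A r31 s14 + amul A r32 s24 + amul A r33 s34 + amul A r34 s44],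
      [amul A r41 s11 + amul A r42 s21 + amul A r43 s31 + amul A r44 s41,
       amul A r41 s12 + amul A r42 s22 + amul A r43 s32 + amul A r44 s42,
       amul A r41 s13 + amul A r42 s23 + amul A r43 s33 + amul A r44 s43,
       amul A r41 s14 + amul A r42 s24 + amul A r43 s34 + amul A r44 s44]]"
  (is "?L = ?R")
proof (intro ext)
  fix i j show "?L i j = ?R i j"
  proof (cases "i < 4 \<and> j < 4")
    case True
    then show ?thesis
      unfolding less_4_iff by (elim conjE disjE) (simp_all add: mat_mult_def sum_4 mat4_def)
  next
    case False
    then show ?thesis by (auto simp: mat_mult_def mat4_def)
  qed
qed

lemma mat_in_mat4:
  assumes "r11 \<in> vec A" "r12 \<in> vec A" "r13 \<in> vec A" "r14 \<in> vec A"
    "r21 \<in> vec A" "r22 \<in> vec A" "r23 \<in> vec A" "r24 \<in> vec A"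
    "r31 \<in> vec A" "r32 \<in> vec A" "r33 \<in> vec A" "r34 \<in> vec A"
    "r41 \<in> vec A" "r42 \<in> vec A" "r43 \<in> vec A" "r44 \<in> vec A"
  shows "mat_in A (mat4 [[r11, r12, r13, r14], [r21, r22, r23, r24], [r31, r32, r33, r34], [r41, r42, r43, r44]])"
proof -
  have "mat4 [[r11, r12, r13, r14], [r21, r22, r23, r24], [r31, r32, r33, r34], [r41, r42, r43, r44]] i j \<in> vec A" for i j
  proof (cases "i < 4 \<and> j < 4")
    case True
    then show ?thesis
      unfolding less_4_iff using assms by (elim conjE disjE) (simp_all add: mat4_def)
  next
    case False
    then show ?thesis by (auto simp: mat4_def)
  qed
  then show ?thesis by (simp add: mat_in_def)
qed

lemma mat_in_mat_mult: "supercomm_alg A \<Longrightarrow> mat_in A M \<Longrightarrow> mat_in A N \<Longrightarrow> mat_in A (mat_mult A M N)"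
  by (auto simp: mat_in_def mat_mult_def intro!: vec_sum supercomm_alg_amul_vec)

lemma mat_mult_assoc:
  assumes "supercomm_alg A" "mat_in A M" "mat_in A N" "mat_in A L"
  shows "mat_mult A (mat_mult A M N) L = mat_mult A M (mat_mult A N L)"
proof (intro ext)
  fix i j
  have "mat_mult A (mat_mult A M N) L i j = (\<Sum>k<4. \<Sum>l<4. amul A (M i l) (amul A (N l k) (L k j)))"
    using assms by (simp add: mat_mult_def amul_sum_left supercomm_alg_assoc mat_in_def)
  also have "\<dots> = mat_mult A M (mat_mult A N L) i j"
    by (subst sum.swap) (simp add: mat_mult_def amul_sum_right)
  finally show "mat_mult A (mat_mult A M N) L i j = mat_mult A M (mat_mult A N L) i j" .
qed

lemma hom_mat4:
  "lin f (mat4 [[r11, r12, r13, r14], [r21, r22, r23, r24], [r31, r32, r33, r34], [r41, r42, r43, r44]] i j) =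
   mat4 [[lin f r11, lin f r12, lin f r13, lin f r14],
      [lin f r21, lin f r22, lin f r23, lin f r24],
      [lin f r31, lin f r32, lin f r33, lin f r34],
      [lin f r41, lin f r42, lin f r43, lin f r44]] i j"
proof (cases "i < 4 \<and> j < 4")
  case True
  then show ?thesis
    unfolding less_4_iff by (elim conjE disjE) (simp_all add: mat4_def)
qed (auto simp: mat4_def)

lemma hom_mat_mult:
  assumes "superalg_hom A B f" "mat_in A M" "mat_in A N"
  shows "lin f (mat_mult A M N i j) = mat_mult B (\<lambda>i j. lin f (M i j)) (\<lambda>i j. lin f (N i j)) i j"
  using assms by (simp add: mat_mult_def lin_sum hom_amul mat_in_def)

definition id4 :: "('a, 'k::field, 'm) superalg_scheme \<Rightarrow> nat \<Rightarrow> nat \<Rightarrow> ('a \<Rightarrow>\<^sub>0 'k)" where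
  "id4 A = (let e = unit_el A in mat4 [[e, 0, 0, 0], [0, e, 0, 0], [0, 0, e, 0], [0, 0, 0, e]])"

text \<open>
  In the basis \<open>1\<close>, \<open>P 1\<close>, \<open>Q 1\<close>, \<open>P Q 1\<close> of \<open>V\<close> a point of \<open>X\<close> with coordinates \<open>t\<close>, \<open>a\<close>, \<open>b\<close>, \<open>c\<close>
  (the values of \<open>\<tau>\<close>, \<open>z\<^sub>1\<close>, \<open>z\<^sub>2\<close>, \<open>z\<^sub>3\<close>) acts by \<open>t (1 + b B) (1 + c C) (1 - a B C)\<close>, and a point of
  \<open>G\<close> with coordinates \<open>p\<close>, \<open>q\<close> (the values of \<open>u\<close>, \<open>v\<close>) by \<open>(1 + p P) (1 + q Q)\<close>.  The scalar
  matrices \<open>P\<close>, \<open>Q\<close>, \<open>B\<close>, \<open>C\<close> commute with the coordinates, so that matrix products involve no signs.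
\<close>

definition mat_X :: "('a, 'k::field, 'm) superalg_scheme \<Rightarrow> ('a \<Rightarrow>\<^sub>0 'k) \<Rightarrow> ('a \<Rightarrow>\<^sub>0 'k) \<Rightarrow> ('a \<Rightarrow>\<^sub>0 'k) \<Rightarrow>
    ('a \<Rightarrow>\<^sub>0 'k) \<Rightarrow> nat \<Rightarrow> nat \<Rightarrow> ('a \<Rightarrow>\<^sub>0 'k)" where
  "mat_X A t a b c = mat4
     [[t, amul A t b, amul A t c, amul A t a - amul A t (amul A b c)],
      [0, t, 0, - amul A t c],
      [0, 0, t, amul A t b],
      [0, 0, 0, t]]"

definition mat_G :: "('a, 'k::field, 'm) superalg_scheme \<Rightarrow> ('a \<Rightarrow>\<^sub>0 'k) \<Rightarrow> ('a \<Rightarrow>\<^sub>0 'k) \<Rightarrow>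
    nat \<Rightarrow> nat \<Rightarrow> ('a \<Rightarrow>\<^sub>0 'k)" where
  "mat_G A p q = mat4
     [[unit_el A, 0, 0, 0],
      [p, unit_el A, 0, 0],
      [q, 0, unit_el A, 0],
      [amul A p q, - q, p, unit_el A]]"

lemma id4_mat_mult:
  assumes "supercomm_alg A" "mat_in A M" "\<And>i j. \<not> (i < 4 \<and> j < 4) \<Longrightarrow> M i j = 0"
  shows "mat_mult A (id4 A) M = M" "mat_mult A M (id4 A) = M"
proof -
  have 1: "mat_mult A (id4 A) M i j = M i j" for i j
  proof (cases "i < 4")
    case True
    then show ?thesis using assms unfolding less_4_iff
      by (elim disjE) (simp_all add: mat_mult_def id4_def mat4_def sum_4 supercomm_alg_unit_left mat_in_def Let_def)
  next
    case False
    then show ?thesis using assms(3)[of i j] by (simp add: mat_mult_def id4_def mat4_def Let_def)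
  qed
  have 2: "mat_mult A M (id4 A) i j = M i j" for i j
  proof (cases "j < 4")
    case True
    then show ?thesis using assms unfolding less_4_iff
      by (elim disjE) (simp_all add: mat_mult_def id4_def mat4_def sum_4 supercomm_alg_unit_right mat_in_def Let_def)
  next
    case False
    then show ?thesis using assms(3)[of i j] by (simp add: mat_mult_def id4_def mat4_def Let_def)
  qed
  show "mat_mult A (id4 A) M = M" "mat_mult A M (id4 A) = M"
    using 1 2 by (auto simp: fun_eq_iff)
qed

lemma mat_in_mat_X: "supercomm_alg A \<Longrightarrow> t \<in> vec A \<Longrightarrow> a \<in> vec A \<Longrightarrow> b \<in> vec A \<Longrightarrow> c \<in> vec A \<Longrightarrow> mat_in A (mat_X A t a b c)"
  unfolding mat_X_def by (rule mat_in_mat4) (auto intro: supercomm_alg_amul_vec)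

lemma mat_in_mat_G: "supercomm_alg A \<Longrightarrow> p \<in> vec A \<Longrightarrow> q \<in> vec A \<Longrightarrow> mat_in A (mat_G A p q)"
  unfolding mat_G_def by (rule mat_in_mat4) (auto intro: supercomm_alg_amul_vec supercomm_alg_unit_vec)

lemma mat4_cong:
  assumes "r11 = s11" "r12 = s12" "r13 = s13" "r14 = s14"
    "r21 = s21" "r22 = s22" "r23 = s23" "r24 = s24"
    "r31 = s31" "r32 = s32" "r33 = s33" "r34 = s34"
    "r41 = s41" "r42 = s42" "r43 = s43" "r44 = s44"
  shows "mat4 [[r11, r12, r13, r14],
      [r21, r22, r23, r24],
      [r31, r32, r33, r34],
      [r41, r42, r43, r44]] = mat4 [[s11, s12, s13, s14],
      [s21, s22, s23, s24],
      [s31, s32, s33, s34],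
      [s41, s42, s43, s44]]"
  by (simp only: assms)

text \<open>The factors 1 + b B, 1 + c C, 1 - a B C of both points commute: B and C square to 0, and
  an exchange of b B with c C changes the sign twice. Each factor is additive in its
  coordinate.\<close>

lemma mat_X_mult:
  fixes A :: "('a, 'k::field_char_0, 'm) superalg_scheme"
  assumes A: "supercomm_alg A"
    and h: "t \<in> hpart A False" "a \<in> hpart A False" "b \<in> hpart A True" "c \<in> hpart A True"
      "t' \<in> hpart A False" "a' \<in> hpart A False" "b' \<in> hpart A True" "c' \<in> hpart A True"
  shows "mat_mult A (mat_X A t a b c) (mat_X A t' a' b' c') = mat_X A (amul A t t') (a + a') (b + b') (c + c')"
proof -
  note v = h[THEN hpart_vec]
  note sw = supercomm_alg_swap[OF A h(2) h(5)] supercomm_alg_swap[OF A h(3) h(5)] supercomm_alg_swap[OF A h(4) h(5)]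
    supercomm_alg_swap[OF A h(4) h(7)]
  show ?thesis
    unfolding mat_X_def mat_mult_mat4
    by (rule mat4_cong)
      (simp_all add: amul_add_left amul_add_right amul_diff_left amul_diff_right
        supercomm_algD[OF A] v sw add_ac)
qed

text \<open>As for X: P and Q square to 0, and p P and q Q commute because coordinates and operators
  both anticommute.\<close>

lemma mat_G_mult:
  fixes A :: "('a, 'k::field_char_0, 'm) superalg_scheme"
  assumes A: "supercomm_alg A"
    and h: "p \<in> hpart A True" "q \<in> hpart A True" "p' \<in> hpart A True" "q' \<in> hpart A True"
  shows "mat_mult A (mat_G A p q) (mat_G A p' q') = mat_G A (p + p') (q + q')"
proof -
  note v = h[THEN hpart_vec]
  note sw = supercomm_alg_swap[OF A h(2) h(3)]
  show ?thesis
    unfolding mat_G_def mat_mult_mat4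
    by (rule mat4_cong)
      (simp_all add: amul_add_left amul_add_right supercomm_algD[OF A] v sw algebra_simps)
qed

text \<open>The relation \<open>(x \<cdot> g\<^sup>-\<^sup>1) g = g x\<close> of the semi-direct product.\<close>

lemma mat_X_mat_G_twist:
  fixes A :: "('a, 'k::field_char_0, 'm) superalg_scheme"
  assumes A: "supercomm_alg A"
    and t: "t \<in> hpart A False" and a: "a \<in> hpart A False" and b: "b \<in> hpart A True" and c: "c \<in> hpart A True"
    and p: "p \<in> hpart A True" and q: "q \<in> hpart A True"
  shows "mat_mult A (mat_X A (t - amul A t (amul A b p) - amul A t (amul A c q) + amul A t (amul A a (amul A p q))
          - amul A t (amul A b (amul A c (amul A p q)))) a (b + amul A a q) (c - amul A a p)) (mat_G A p q)
     = mat_mult A (mat_G A p q) (mat_X A t a b c)"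
proof -
  note v = t[THEN hpart_vec] a[THEN hpart_vec] b[THEN hpart_vec] c[THEN hpart_vec] p[THEN hpart_vec] q[THEN hpart_vec]
  \<comment> \<open>One oriented rule per pair sorts every monomial into the order t, a, b, c, p, q;
    with vanishing squares of odd factors this is a normal form.\<close>
  note sw = supercomm_alg_swap[OF A a t]
    supercomm_alg_swap[OF A b t]
    supercomm_alg_swap[OF A c t]
    supercomm_alg_swap[OF A p t]
    supercomm_alg_swap[OF A q t]
    supercomm_alg_swap[OF A b a]
    supercomm_alg_swap[OF A c a]
    supercomm_alg_swap[OF A p a]
    supercomm_alg_swap[OF A q a]
    supercomm_alg_swap[OF A c b]
    supercomm_alg_swap[OF A p b]
    supercomm_alg_swap[OF A q b]
    supercomm_alg_swap[OF A p c]
    supercomm_alg_swap[OF A q c]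
    supercomm_alg_swap[OF A q p]
  note sq = supercomm_alg_odd_square[OF A b] supercomm_alg_odd_square[OF A c] supercomm_alg_odd_square[OF A p] supercomm_alg_odd_square[OF A q]
  show ?thesis
    unfolding mat_X_def mat_G_def mat_mult_mat4
    by (rule mat4_cong)
      (simp_all add: amul_add_left amul_add_right amul_diff_left amul_diff_right
        supercomm_algD[OF A] v sw sq add_ac)
qed


section \<open>Points of \<open>X\<close> and \<open>G\<close>\<close>

lemma supercomm_alg_XG: "supercomm_alg (X_grp :: (x_idx, 'k::field) hopf)" "supercomm_alg (G_grp :: (g_idx, 'k::field) hopf)"
  using hopf_homs_X hopf_homs_G by (auto simp: hopf_homs_def)

abbreviation T_alg :: "(x_idx \<times> g_idx, 'k::field) superalg" where
  "T_alg \<equiv> tens_alg X_grp G_grp"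

abbreviation T2_alg :: "((x_idx \<times> g_idx) \<times> (x_idx \<times> g_idx), 'k::field) superalg" where
  "T2_alg \<equiv> tens_alg T_alg T_alg"

lemma supercomm_alg_T: "supercomm_alg T_alg" "supercomm_alg T2_alg"
  by (intro supercomm_alg_tens_alg supercomm_alg_XG)+

context
  fixes A :: "('a, 'k::field, 'm) superalg_scheme" and x :: "x_idx \<Rightarrow> ('a \<Rightarrow>\<^sub>0 'k)"
  assumes A: "supercomm_alg A" and x: "superalg_hom X_grp A x"
begin

lemma X_pt_unit: "x eX = unit_el A"
  using hom_unit[OF x] by simp

lemma X_pt_mult: "lin x (mul X_grp (b, b')) = amul A (x b) (x b')"
  using hom_amul[OF x, of "bvec b" "bvec b'"] by simp

lemma X_pt_vec [simp]: "x b \<in> vec A"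
  using hom_basis_vec[OF x] by simp

lemma X_pt_hpart: "x tI \<in> hpart A False" "x aI \<in> hpart A False" "x bI \<in> hpart A True" "x cI \<in> hpart A True"
  using hom_basis_hpart[OF x, of tI] hom_basis_hpart[OF x, of aI] hom_basis_hpart[OF x, of bI]
    hom_basis_hpart[OF x, of cI] by simp_all

lemma X_pt_t: "x (i + j, n, d, e) = amul A (x (i, 0, False, False)) (x (j, n, d, e))"
  and X_pt_a: "x (0, Suc n, d, e) = amul A (x aI) (x (0, n, d, e))"
  and X_pt_b: "x (0, 0, True, e) = amul A (x bI) (x (0, 0, False, e))"
  using X_pt_mult[of "(i, 0, False, False)" "(j, n, d, e)"] X_pt_mult[of aI "(0, n, d, e)"]
    X_pt_mult[of bI "(0, 0, False, e)"]
  by (simp_all add: mul_X)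

lemma X_pt_inverse:
  "amul A (x (- i, 0, False, False)) (x (i, 0, False, False)) = unit_el A"
  "amul A (x (i, 0, False, False)) (x (- i, 0, False, False)) = unit_el A"
  using X_pt_t[of "- i" i 0 False False] X_pt_t[of i "- i" 0 False False] by (simp_all add: X_pt_unit)

lemma X_pt_prods:
  "x (1, 0, True, False) = amul A (x tI) (x bI)"
  "x (1, 0, False, True) = amul A (x tI) (x cI)"
  "x (1, 1, False, False) = amul A (x tI) (x aI)"
  "x (1, 0, True, True) = amul A (x tI) (amul A (x bI) (x cI))"
  using X_pt_t[of 1 0 0 True False] X_pt_t[of 1 0 0 False True] X_pt_t[of 1 0 1 False False]
    X_pt_t[of 1 0 0 True True] X_pt_b[of True] by simp_all

end

text \<open>Basis monomials are products of the generators and of \<tau>^{-1}, whose value is the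
  inverse of the value of \<tau>.\<close>

lemma X_pt_agree:
  assumes A: "supercomm_alg A" and x: "superalg_hom X_grp A x" and y: "superalg_hom X_grp A y"
    and t: "x tI = y tI" and a: "x aI = y aI" and b: "x bI = y bI" and c: "x cI = y cI"
  shows "x = y"
proof -
  note u = X_pt_unit[OF A x] X_pt_unit[OF A y]
  note xv [simp] = X_pt_vec[OF A x] X_pt_vec[OF A y]
  have t1: "x (int k, 0, False, False) = y (int k, 0, False, False)" for k
  proof (induction k)
    case (Suc k)
    then show ?case
      using X_pt_t[OF A x, of 1 "int k" 0 False False] X_pt_t[OF A y, of 1 "int k" 0 False False] t by simp
  qed (simp add: u)
  \<comment> \<open>Uniqueness of inverses: insert the product of the \<open>y\<close>-values of
    \<tau>^k and \<tau>^{-k}, then cancel using that \<open>x\<close> and \<open>y\<close> agree on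
    \<tau>^k.\<close>
  have t2: "x (- int k, 0, False, False) = y (- int k, 0, False, False)" for k
  proof -
    let ?i = "(- int k, 0, False, False)" and ?j = "(int k, 0, False, False)"
    have "x ?i = amul A (x ?i) (amul A (y ?j) (y ?i))"
      using X_pt_inverse(2)[OF A y, of "int k"] by (simp add: supercomm_alg_unit_right[OF A])
    also have "\<dots> = amul A (amul A (x ?i) (x ?j)) (y ?i)"
      by (simp add: t1 supercomm_alg_assoc[OF A])
    also have "\<dots> = y ?i"
      using X_pt_inverse(1)[OF A x, of "int k"] by (simp add: supercomm_alg_unit_left[OF A])
    finally show ?thesis .
  qed
  have ti: "x (i, 0, False, False) = y (i, 0, False, False)" for i
    by (cases i rule: int_cases2) (use t1 t2 in auto)
  have bc: "x (0, 0, d, e) = y (0, 0, d, e)" for d e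
    using X_pt_b[OF A x, of e] X_pt_b[OF A y, of e] b c u by (cases d; cases e) simp_all
  have abc: "x (0, n, d, e) = y (0, n, d, e)" for n d e
    by (induction n) (simp_all only: bc X_pt_a[OF A x, of _ d e] X_pt_a[OF A y, of _ d e] a)
  show ?thesis
  proof
    fix b :: x_idx
    obtain i n d e where b: "b = (i, n, d, e)" by (metis surj_pair)
    show "x b = y b"
      unfolding b using X_pt_t[OF A x, of i 0 n d e] X_pt_t[OF A y, of i 0 n d e] ti abc by simp
  qed
qed

context
  fixes A :: "('a, 'k::field, 'm) superalg_scheme" and g :: "g_idx \<Rightarrow> ('a \<Rightarrow>\<^sub>0 'k)"
  assumes A: "supercomm_alg A" and g: "superalg_hom G_grp A g"
begin

lemma G_pt_unit: "g eG = unit_el A"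
  using hom_unit[OF g] by simp

lemma G_pt_vec [simp]: "g b \<in> vec A"
  using hom_basis_vec[OF g] by simp

lemma G_pt_hpart: "g pI \<in> hpart A True" "g qI \<in> hpart A True"
  using hom_basis_hpart[OF g, of pI] hom_basis_hpart[OF g, of qI] by simp_all

lemma G_pt_prod: "g (True, True) = amul A (g pI) (g qI)"
  using hom_amul[OF g, of "bvec pI" "bvec qI"] by (simp add: mul_G)

end

lemma G_pt_agree:
  assumes A: "supercomm_alg A" and g: "superalg_hom G_grp A g" and h: "superalg_hom G_grp A h"
    and p: "g pI = h pI" and q: "g qI = h qI"
  shows "g = h"
proof
  fix b :: g_idx show "g b = h b"
    using p q G_pt_unit[OF A g] G_pt_unit[OF A h] G_pt_prod[OF A g] G_pt_prod[OF A h]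
    by (cases b) (metis (full_types))
qed

lemma mult_pt_X:
  assumes A: "supercomm_alg A" and x: "superalg_hom X_grp A x" and y: "superalg_hom X_grp A y"
  shows "mult_pt X_grp A x y tI = amul A (x tI) (y tI)"
    "mult_pt X_grp A x y aI = x aI + y aI"
    "mult_pt X_grp A x y bI = x bI + y bI"
    "mult_pt X_grp A x y cI = x cI + y cI"
  by (simp_all add: mult_pt_def comult_X comult_X(1)[of 1] lin_add pair_pt_def X_pt_unit[OF A x] X_pt_unit[OF A y]
    supercomm_alg_unit_left[OF A] supercomm_alg_unit_right[OF A] X_pt_vec[OF A x] X_pt_vec[OF A y] del: One_nat_def)

lemma mult_pt_G:
  assumes A: "supercomm_alg A" and g: "superalg_hom G_grp A g" and h: "superalg_hom G_grp A h"
  shows "mult_pt G_grp A g h pI = g pI + h pI" "mult_pt G_grp A g h qI = g qI + h qI"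
  by (simp_all add: mult_pt_def comult_G lin_add pair_pt_def G_pt_unit[OF A g] G_pt_unit[OF A h]
    supercomm_alg_unit_left[OF A] supercomm_alg_unit_right[OF A] G_pt_vec[OF A g] G_pt_vec[OF A h])

lemma inv_pt_XG:
  "inv_pt X_grp x tI = x (-1, 0, False, False)"
  "inv_pt X_grp x aI = - x aI"
  "inv_pt X_grp x bI = - x bI"
  "inv_pt X_grp x cI = - x cI"
  "inv_pt G_grp g pI = - g pI"
  "inv_pt G_grp g qI = - g qI"
  by (simp_all add: inv_pt_def antip_XG antip_XG(1)[of 1] lin_minus del: One_nat_def)

definition rep_X :: "('a, 'k::field, 'm) superalg_scheme \<Rightarrow> (x_idx \<Rightarrow> ('a \<Rightarrow>\<^sub>0 'k)) \<Rightarrow> nat \<Rightarrow> nat \<Rightarrow> ('a \<Rightarrow>\<^sub>0 'k)" where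
  "rep_X A x = mat_X A (x tI) (x aI) (x bI) (x cI)"

definition rep_G :: "('a, 'k::field, 'm) superalg_scheme \<Rightarrow> (g_idx \<Rightarrow> ('a \<Rightarrow>\<^sub>0 'k)) \<Rightarrow> nat \<Rightarrow> nat \<Rightarrow> ('a \<Rightarrow>\<^sub>0 'k)" where
  "rep_G A g = mat_G A (g pI) (g qI)"

lemma mat_in_pt:
  "supercomm_alg A \<Longrightarrow> superalg_hom X_grp A x \<Longrightarrow> mat_in A (rep_X A x)"
  "supercomm_alg A \<Longrightarrow> superalg_hom G_grp A g \<Longrightarrow> mat_in A (rep_G A g)"
  by (simp_all add: rep_X_def rep_G_def mat_in_mat_X mat_in_mat_G X_pt_vec G_pt_vec)

lemma rep_X_mult:
  fixes A :: "('a, 'k::field_char_0, 'm) superalg_scheme"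
  assumes A: "supercomm_alg A" and x: "superalg_hom X_grp A x" and y: "superalg_hom X_grp A y"
  shows "rep_X A (mult_pt X_grp A x y) = mat_mult A (rep_X A x) (rep_X A y)"
  unfolding rep_X_def mult_pt_X[OF assms]
  by (rule mat_X_mult[symmetric, OF A X_pt_hpart[OF A x] X_pt_hpart[OF A y]])

lemma rep_G_mult:
  fixes A :: "('a, 'k::field_char_0, 'm) superalg_scheme"
  assumes A: "supercomm_alg A" and g: "superalg_hom G_grp A g" and h: "superalg_hom G_grp A h"
  shows "rep_G A (mult_pt G_grp A g h) = mat_mult A (rep_G A g) (rep_G A h)"
  unfolding rep_G_def mult_pt_G[OF assms]
  by (rule mat_G_mult[symmetric, OF A G_pt_hpart[OF A g] G_pt_hpart[OF A h]])

lemma mat_X_one: "mat_X A (unit_el A) 0 0 0 = id4 A"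
  and mat_G_one: "mat_G A 0 0 = id4 A"
  by (simp_all add: mat_X_def mat_G_def id4_def Let_def)

lemma rep_X_inverse:
  fixes A :: "('a, 'k::field_char_0, 'm) superalg_scheme"
  assumes A: "supercomm_alg A" and x: "superalg_hom X_grp A x"
  shows "mat_mult A (rep_X A (inv_pt X_grp x)) (rep_X A x) = id4 A"
    "mat_mult A (rep_X A x) (rep_X A (inv_pt X_grp x)) = id4 A"
proof -
  note i = inv_pt_hom[OF hopf_homs_X x]
  show "mat_mult A (rep_X A (inv_pt X_grp x)) (rep_X A x) = id4 A"
    using mat_X_mult[OF A X_pt_hpart[OF A i] X_pt_hpart[OF A x]] X_pt_inverse(1)[OF A x, of 1]
    by (simp add: rep_X_def inv_pt_XG mat_X_one del: One_nat_def)
  show "mat_mult A (rep_X A x) (rep_X A (inv_pt X_grp x)) = id4 A"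
    using mat_X_mult[OF A X_pt_hpart[OF A x] X_pt_hpart[OF A i]] X_pt_inverse(2)[OF A x, of 1]
    by (simp add: rep_X_def inv_pt_XG mat_X_one del: One_nat_def)
qed

lemma rep_G_inverse:
  fixes A :: "('a, 'k::field_char_0, 'm) superalg_scheme"
  assumes A: "supercomm_alg A" and g: "superalg_hom G_grp A g"
  shows "mat_mult A (rep_G A (inv_pt G_grp g)) (rep_G A g) = id4 A"
    "mat_mult A (rep_G A g) (rep_G A (inv_pt G_grp g)) = id4 A"
proof -
  note i = inv_pt_hom[OF hopf_homs_G g]
  show "mat_mult A (rep_G A (inv_pt G_grp g)) (rep_G A g) = id4 A"
    using mat_G_mult[OF A G_pt_hpart[OF A i] G_pt_hpart[OF A g]] by (simp add: rep_G_def inv_pt_XG mat_G_one)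
  show "mat_mult A (rep_G A g) (rep_G A (inv_pt G_grp g)) = id4 A"
    using mat_G_mult[OF A G_pt_hpart[OF A g] G_pt_hpart[OF A i]] by (simp add: rep_G_def inv_pt_XG mat_G_one)
qed

text \<open>\<open>rho_t\<close> is the exponential already multiplied out. By the sign rule its
  quadratic term is - z_2 z_3 \<otimes> uv, and all higher terms vanish.\<close>

locale example_action =
  fixes \<rho> :: "x_idx \<Rightarrow> (x_idx \<times> g_idx \<Rightarrow>\<^sub>0 'k::field_char_0)"
  assumes rho_hom: "superalg_hom X_grp T_alg \<rho>"
    and rho_a: "\<rho> aI = bvec (aI, eG)"
    and rho_b: "\<rho> bI = bvec (bI, eG) - bvec (aI, qI)"
    and rho_c: "\<rho> cI = bvec (cI, eG) + bvec (aI, pI)"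
    and rho_t: "\<rho> tI = bvec (tI, eG) + bvec ((1, 0, True, False), pI) + bvec ((1, 0, False, True), qI)
      + bvec ((1, 1, False, False), (True, True)) - bvec ((1, 0, True, True), (True, True))"
begin

text \<open>Here the prescribed action meets \<open>V\<close>. The inverse of g has coordinates -p,
  -q, so the terms of \<open>\<rho>\<close> in u or v alone change sign while those in uv do not;
  this gives the left-hand matrix of \<open>mat_X_mat_G_twist\<close>.\<close>

lemma rep_X_act:
  fixes A :: "('a, 'k, 'm) superalg_scheme"
  assumes A: "supercomm_alg A" and x: "superalg_hom X_grp A x" and g: "superalg_hom G_grp A g"
  shows "mat_mult A (rep_X A (act_pt A \<rho> x (inv_pt G_grp g))) (rep_G A g) = mat_mult A (rep_G A g) (rep_X A x)"
proof -
  note i = inv_pt_hom[OF hopf_homs_G g]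
  note v = X_pt_vec[OF A x] G_pt_vec[OF A g]
  have 1: "act_pt A \<rho> x (inv_pt G_grp g) tI =
      x tI - amul A (x tI) (amul A (x bI) (g pI)) - amul A (x tI) (amul A (x cI) (g qI))
      + amul A (x tI) (amul A (x aI) (amul A (g pI) (g qI)))
      - amul A (x tI) (amul A (x bI) (amul A (x cI) (amul A (g pI) (g qI))))"
    by (simp add: act_pt_def rho_t lin_add lin_diff pair_pt_def X_pt_prods[OF A x] inv_pt_XG
        G_pt_unit[OF A i] G_pt_prod[OF A i] supercomm_algD[OF A] v del: One_nat_def)
  have 2: "act_pt A \<rho> x (inv_pt G_grp g) aI = x aI"
    "act_pt A \<rho> x (inv_pt G_grp g) bI = x bI + amul A (x aI) (g qI)"
    "act_pt A \<rho> x (inv_pt G_grp g) cI = x cI - amul A (x aI) (g pI)"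
    by (simp_all add: act_pt_def rho_a rho_b rho_c lin_add lin_diff pair_pt_def inv_pt_XG
        G_pt_unit[OF A i] supercomm_algD[OF A] v del: One_nat_def)
  show ?thesis
    unfolding rep_X_def rep_G_def 1 2
    by (rule mat_X_mat_G_twist[OF A X_pt_hpart[OF A x] G_pt_hpart[OF A g]])
qed

end


section \<open>The semi-direct product\<close>

text \<open>The component x of a point (x, g) of the semi-direct product, by restriction along the
  inclusion of K[X]; \<open>G_part\<close> is the component g, and \<open>pair_pt\<close>
  reassembles them.\<close>

definition X_part :: "(x_idx \<times> g_idx \<Rightarrow> ('a \<Rightarrow>\<^sub>0 'k::field)) \<Rightarrow> x_idx \<Rightarrow> ('a \<Rightarrow>\<^sub>0 'k)" where
  "X_part h = (\<lambda>b. lin h (inc1 G_grp b))"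

definition G_part :: "(x_idx \<times> g_idx \<Rightarrow> ('a \<Rightarrow>\<^sub>0 'k::field)) \<Rightarrow> g_idx \<Rightarrow> ('a \<Rightarrow>\<^sub>0 'k)" where
  "G_part h = (\<lambda>b. lin h (inc2 X_grp b))"

lemma X_part_apply: "X_part h b = h (b, eG)" and G_part_apply: "G_part h c = h (eX, c)"
  by (simp_all add: X_part_def G_part_def inc1_def inc2_def)

lemma X_part_hom: "superalg_hom T_alg A h \<Longrightarrow> superalg_hom X_grp A (X_part h)"
  unfolding X_part_def by (rule superalg_hom_comp[OF inc1_hom[OF supercomm_alg_XG]])

lemma G_part_hom: "superalg_hom T_alg A h \<Longrightarrow> superalg_hom G_grp A (G_part h)"
  unfolding G_part_def by (rule superalg_hom_comp[OF inc2_hom[OF supercomm_alg_XG]])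

lemma pair_X_part_G_part:
  fixes h :: "x_idx \<times> g_idx \<Rightarrow> ('a \<Rightarrow>\<^sub>0 'k::field)"
  assumes "superalg_hom T_alg A h"
  shows "pair_pt A (X_part h) (G_part h) = h"
proof
  fix bc :: "x_idx \<times> g_idx"
  obtain b c where bc: "bc = (b, c)" by (cases bc)
  have "lin h (amul T_alg (bvec b \<otimes> unit_el G_grp) (unit_el X_grp \<otimes> bvec c)) = amul A (X_part h b) (G_part h c)"
    unfolding X_part_def G_part_def inc1_def inc2_def by (rule hom_amul[OF assms]) (auto intro!: tens_alg_vec)
  then show "pair_pt A (X_part h) (G_part h) bc = h bc"
    using amul_inc1_inc2[OF supercomm_alg_XG, of "bvec b :: _ \<Rightarrow>\<^sub>0 'k" "bvec c"]
    by (simp add: bc pair_pt_def)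
qed

lemma X_part_G_part_pair:
  assumes A: "supercomm_alg A" and "superalg_hom X_grp A x" "superalg_hom G_grp A g"
  shows "X_part (pair_pt A x g) = x" "G_part (pair_pt A x g) = g"
proof -
  have "x b \<in> vec A" "g c \<in> vec A" for b c
    using assms hom_basis_vec by fastforce+
  then show "X_part (pair_pt A x g) = x" "G_part (pair_pt A x g) = g"
    using assms G_pt_unit[OF A assms(3)] X_pt_unit[OF A assms(2)]
    by (auto simp: fun_eq_iff X_part_apply G_part_apply pair_pt_def supercomm_algD[OF A])
qed

definition rep :: "('a, 'k::field, 'm) superalg_scheme \<Rightarrow> (x_idx \<times> g_idx \<Rightarrow> ('a \<Rightarrow>\<^sub>0 'k)) \<Rightarrow> nat \<Rightarrow> nat \<Rightarrow> ('a \<Rightarrow>\<^sub>0 'k)" where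
  "rep A h = mat_mult A (rep_X A (X_part h)) (rep_G A (G_part h))"

lemma mat_in_rep: "supercomm_alg A \<Longrightarrow> superalg_hom T_alg A h \<Longrightarrow> mat_in A (rep A h)"
  unfolding rep_def by (intro mat_in_mat_mult mat_in_pt X_part_hom G_part_hom)

lemma rep_entries:
  assumes A: "supercomm_alg A" and h: "superalg_hom T_alg A h"
  shows "rep A h 3 3 = X_part h tI"
    "rep A h 2 3 = amul A (X_part h tI) (X_part h bI)"
    "rep A h 1 3 = - amul A (X_part h tI) (X_part h cI)"
    "rep A h 0 3 = amul A (X_part h tI) (X_part h aI) - amul A (X_part h tI) (amul A (X_part h bI) (X_part h cI))"
    "rep A h 3 2 = amul A (X_part h tI) (G_part h pI)"
    "rep A h 3 1 = - amul A (X_part h tI) (G_part h qI)"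
  using X_pt_vec[OF A X_part_hom[OF h]] G_pt_vec[OF A G_part_hom[OF h]]
  by (simp_all add: rep_def rep_X_def rep_G_def mat_X_def mat_G_def mat_mult_mat4 mat4_def supercomm_algD[OF A] del: One_nat_def)

text \<open>The last column contains t, t b, - t c and t a - t b c, the last row contains t p and -
  t q. Since t is invertible, with inverse the value of \<tau>^{-1}, all coordinates can be
  recovered in this order.\<close>

lemma rep_inject:
  assumes A: "supercomm_alg A" and h: "superalg_hom T_alg A h" and h': "superalg_hom T_alg A h'"
    and eq: "rep A h = rep A h'"
  shows "h = h'"
proof -
  let ?t = "X_part h tI" and ?s = "X_part h (-1, 0, False, False)"
  have t: "X_part h tI = X_part h' tI"
    using rep_entries(1)[OF A h] rep_entries(1)[OF A h'] eq by simp
  note v = X_pt_vec[OF A X_part_hom[OF h]] G_pt_vec[OF A G_part_hom[OF h]]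
    X_pt_vec[OF A X_part_hom[OF h']] G_pt_vec[OF A G_part_hom[OF h']]
  have cancel: "z = w" if "amul A ?t z = amul A ?t w" "z \<in> vec A" "w \<in> vec A" for z w
  proof -
    have k: "amul A ?s (amul A ?t z) = z" if "z \<in> vec A" for z
    proof -
      have "amul A ?s (amul A ?t z) = amul A (amul A ?s ?t) z"
        by (rule supercomm_alg_assoc[OF A v(1) v(1) that, symmetric])
      then show ?thesis
        using X_pt_inverse(1)[OF A X_part_hom[OF h], of 1] that by (simp add: supercomm_alg_unit_left[OF A])
    qed
    show ?thesis using arg_cong[OF that(1), of "amul A ?s"] unfolding k[OF that(2)] k[OF that(3)] .
  qed
  have b: "X_part h bI = X_part h' bI"
    using rep_entries(2)[OF A h] rep_entries(2)[OF A h'] eq t by (intro cancel[OF _ v(1) v(3)]) simp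
  have c: "X_part h cI = X_part h' cI"
    using rep_entries(3)[OF A h] rep_entries(3)[OF A h'] eq t by (intro cancel[OF _ v(1) v(3)]) simp
  have a: "X_part h aI = X_part h' aI"
    using rep_entries(4)[OF A h] rep_entries(4)[OF A h'] eq t b c by (intro cancel[OF _ v(1) v(3)]) simp
  have p: "G_part h pI = G_part h' pI"
    using rep_entries(5)[OF A h] rep_entries(5)[OF A h'] eq t by (intro cancel[OF _ v(2) v(4)]) simp
  have q: "G_part h qI = G_part h' qI"
    using rep_entries(6)[OF A h] rep_entries(6)[OF A h'] eq t by (intro cancel[OF _ v(2) v(4)]) simp
  have "X_part h = X_part h'" by (rule X_pt_agree[OF A X_part_hom[OF h] X_part_hom[OF h'] t a b c])
  moreover have "G_part h = G_part h'" by (rule G_pt_agree[OF A G_part_hom[OF h] G_part_hom[OF h'] p q])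
  ultimately show ?thesis using pair_X_part_G_part[OF h] pair_X_part_G_part[OF h'] by metis
qed

lemma one_pt_XG_hom:
  assumes A: "supercomm_alg A"
  shows "superalg_hom X_grp A (one_pt X_grp A)" "superalg_hom G_grp A (one_pt G_grp A)"
proof -
  note u = supercomm_alg_unit_hpart[OF A] supercomm_alg_unit_vec[OF A] supercomm_alg_unit_left[OF A]
  show "superalg_hom X_grp A (one_pt X_grp A)"
  proof (rule superalg_homI)
    fix x y :: x_idx
    obtain i n d e i' n' d' e' where xy: "x = (i, n, d, e)" "y = (i', n', d', e')" by (metis surj_pair)
    show "one_pt X_grp A x \<in> hpart A (par (X_grp :: (x_idx, 'b) hopf) x)"
      using u by (auto simp: xy one_pt_def counit_XG)
    show "lin (one_pt X_grp A) (mul X_grp (x, y)) = amul A (one_pt X_grp A x) (one_pt X_grp A y)"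
      using u by (auto simp: xy one_pt_def counit_XG mul_X)
  qed (simp add: one_pt_def counit_XG)
  show "superalg_hom G_grp A (one_pt G_grp A)"
  proof (rule superalg_homI)
    fix x y :: g_idx
    obtain d e d' e' where xy: "x = (d, e)" "y = (d', e')" by (metis surj_pair)
    show "one_pt G_grp A x \<in> hpart A (par (G_grp :: (g_idx, 'b) hopf) x)"
      using u by (auto simp: xy one_pt_def counit_XG)
    show "lin (one_pt G_grp A) (mul G_grp (x, y)) = amul A (one_pt G_grp A x) (one_pt G_grp A y)"
      using u by (auto simp: xy one_pt_def counit_XG mul_G)
  qed (simp add: one_pt_def counit_XG)
qed

section \<open>The group law of H expressed by matrices\<close>

context example_action
begin

abbreviation H :: "(x_idx \<times> g_idx, 'k) hopf" where "H \<equiv> semidirect X_grp G_grp \<rho>"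

lemma H_simps [simp]:
  "idx H = UNIV" "par H = par (T_alg :: (x_idx \<times> g_idx, 'k) superalg)" "mul H = mul T_alg" "unit_el H = unit_el T_alg"
  "counit H = (\<lambda>(b, c). counit X_grp b * counit G_grp c)"
  by (simp_all add: semidirect_def Let_def)

lemma vec_H: "vec H = vec (T_alg :: (x_idx \<times> g_idx, 'k) superalg)"
  and superalg_hom_H: "superalg_hom H A f = superalg_hom T_alg A f"
  by (subst superalg_cong[of H T_alg]; simp)+

lemma one_pt_H: "supercomm_alg A \<Longrightarrow> one_pt H A = pair_pt A (one_pt X_grp A) (one_pt G_grp A)"
  by (auto simp: fun_eq_iff one_pt_def pair_pt_def supercomm_alg_unit_left supercomm_alg_unit_vec)

lemma one_pt_H_hom: "supercomm_alg A \<Longrightarrow> superalg_hom T_alg A (one_pt H A)"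
  unfolding one_pt_H by (intro pair_pt_hom one_pt_XG_hom)

lemma rep_one:
  assumes A: "supercomm_alg A"
  shows "rep A (one_pt H A) = id4 A"
proof -
  have "rep_X A (one_pt X_grp A) = id4 A" "rep_G A (one_pt G_grp A) = id4 A"
    by (simp_all add: rep_X_def rep_G_def one_pt_def counit_XG mat_X_one mat_G_one)
  moreover have "mat_in A (id4 A)"
    unfolding id4_def Let_def using supercomm_alg_unit_vec[OF A] by (intro mat_in_mat4) auto
  ultimately show ?thesis
    unfolding one_pt_H[OF A] rep_def X_part_G_part_pair[OF A one_pt_XG_hom[OF A]]
    by (simp add: id4_mat_mult(1)[OF A]) (rule id4_mat_mult(1)[OF A], auto simp: id4_def mat4_def Let_def)
qed

text \<open>\<open>comult H\<close> is this formula at the universal points. The morphism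
  \<open>pair_pt A h h'\<close> sends those points to the components of \<open>h\<close> and
  \<open>h'\<close>, and naturality carries the formula along.\<close>

lemma mult_pt_H:
  fixes A :: "('a, 'k, 'm) superalg_scheme"
  assumes A: "supercomm_alg A" and h: "superalg_hom T_alg A h" and h': "superalg_hom T_alg A h'"
  shows "mult_pt H A h h' = pair_pt A
    (mult_pt X_grp A (X_part h) (act_pt A \<rho> (X_part h') (inv_pt G_grp (G_part h)))) (mult_pt G_grp A (G_part h) (G_part h'))"
proof
  fix bc :: "x_idx \<times> g_idx"
  obtain b c where bc: "bc = (b, c)" by (cases bc)
  let ?x1 = "\<lambda>b. lin (inc1 T_alg) (inc1 G_grp b)" and ?g1 = "\<lambda>b. lin (inc1 T_alg) (inc2 X_grp b)"
  let ?x2 = "\<lambda>b. lin (inc2 T_alg) (inc1 G_grp b)" and ?g2 = "\<lambda>b. lin (inc2 T_alg) (inc2 X_grp b)"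
  note s = supercomm_alg_XG supercomm_alg_T
  have hx: "superalg_hom X_grp T2_alg ?x1" "superalg_hom X_grp T2_alg ?x2"
    and hg: "superalg_hom G_grp T2_alg ?g1" "superalg_hom G_grp T2_alg ?g2"
    by (intro superalg_hom_comp[OF _ inc1_hom] superalg_hom_comp[OF _ inc2_hom] inc1_hom inc2_hom s)+
  let ?f = "pair_pt A h h'"
  have f: "superalg_hom T2_alg A ?f" by (rule pair_pt_hom[OF A h h'])
  have i1: "inc1 G_grp b \<in> vec T_alg" "inc2 X_grp c \<in> vec T_alg" for b c
    by (simp_all add: inc1_def inc2_def)
  have e: "(\<lambda>b. lin ?f (?x1 b)) = X_part h" "(\<lambda>b. lin ?f (?x2 b)) = X_part h'"
    "(\<lambda>b. lin ?f (?g1 b)) = G_part h" "(\<lambda>b. lin ?f (?g2 b)) = G_part h'"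
    by (simp_all add: lin_pair_pt_lin_inc[OF A h h'] i1 X_part_def G_part_def)
  note ig = inv_pt_hom[OF hopf_homs_G hg(1)]
  note ac = act_pt_hom[OF rho_hom supercomm_alg_T(2) hx(2) ig]
  note mx = mult_pt_hom[OF hopf_homs_X supercomm_alg_T(2) hx(1) ac]
  note mg = mult_pt_hom[OF hopf_homs_G supercomm_alg_T(2) hg]
  have cm: "comult H = pair_pt T2_alg (mult_pt X_grp T2_alg ?x1 (act_pt T2_alg \<rho> ?x2 (inv_pt G_grp ?g1))) (mult_pt G_grp T2_alg ?g1 ?g2)"
    by (simp add: semidirect_def Let_def)
  show "mult_pt H A h h' bc = pair_pt A
    (mult_pt X_grp A (X_part h) (act_pt A \<rho> (X_part h') (inv_pt G_grp (G_part h)))) (mult_pt G_grp A (G_part h) (G_part h')) bc"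
    unfolding mult_pt_def[of H] cm bc
    by (subst hom_pair_pt[OF f]; (intro hom_basis_vec[OF mx] hom_basis_vec[OF mg])?)
      (simp_all add: hom_mult_pt[OF hopf_homs_X hx(1) ac f] hom_act_pt[OF rho_hom hx(2) ig f] hom_inv_pt
       hom_mult_pt[OF hopf_homs_G hg f] e)
qed

lemma inv_pt_H:
  fixes A :: "('a, 'k, 'm) superalg_scheme"
  assumes A: "supercomm_alg A" and h: "superalg_hom T_alg A h"
  shows "inv_pt H h = pair_pt A (act_pt A \<rho> (inv_pt X_grp (X_part h)) (G_part h)) (inv_pt G_grp (G_part h))"
proof
  fix bc :: "x_idx \<times> g_idx"
  obtain b c where bc: "bc = (b, c)" by (cases bc)
  note ix = inv_pt_hom[OF hopf_homs_X inc1_hom[OF supercomm_alg_XG]] and ig = inv_pt_hom[OF hopf_homs_G inc2_hom[OF supercomm_alg_XG]]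
  note ac = act_pt_hom[OF rho_hom supercomm_alg_T(1) ix inc2_hom[OF supercomm_alg_XG]]
  have cm: "antip H = pair_pt T_alg (act_pt T_alg \<rho> (inv_pt X_grp (inc1 G_grp)) (inc2 X_grp)) (inv_pt G_grp (inc2 X_grp))"
    by (simp add: semidirect_def Let_def)
  show "inv_pt H h bc = pair_pt A (act_pt A \<rho> (inv_pt X_grp (X_part h)) (G_part h)) (inv_pt G_grp (G_part h)) bc"
    unfolding inv_pt_def[of H] cm bc
    by (subst hom_pair_pt[OF h]; (intro hom_basis_vec[OF ac] hom_basis_vec[OF ig])?)
      (simp_all add: hom_act_pt[OF rho_hom ix inc2_hom[OF supercomm_alg_XG] h] hom_inv_pt X_part_def G_part_def)
qed

context
  fixes A :: "('a, 'k, 'm) superalg_scheme" and h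
  assumes A: "supercomm_alg A" and h: "superalg_hom T_alg A h"
begin

lemma inv_pt_H_hom: "superalg_hom T_alg A (inv_pt H h)"
  unfolding inv_pt_H[OF A h]
  by (intro pair_pt_hom A act_pt_hom[OF rho_hom] inv_pt_hom hopf_homs_X hopf_homs_G X_part_hom G_part_hom h)

lemma mult_pt_H_hom:
  assumes h': "superalg_hom T_alg A h'"
  shows "superalg_hom T_alg A (mult_pt H A h h')"
  unfolding mult_pt_H[OF A h h']
  by (intro pair_pt_hom A act_pt_hom[OF rho_hom] inv_pt_hom mult_pt_hom hopf_homs_X hopf_homs_G X_part_hom G_part_hom h h')

text \<open>For points (x, g) and (x', g') the product has matrix x (x' \<cdot> g^{-1}) g g', and
  \<open>rep_X_act\<close> turns (x' \<cdot> g^{-1}) g into g x'.\<close>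

lemma rep_mult:
  assumes h': "superalg_hom T_alg A h'"
  shows "rep A (mult_pt H A h h') = mat_mult A (rep A h) (rep A h')"
proof -
  note x = X_part_hom[OF h] and g = G_part_hom[OF h] and x' = X_part_hom[OF h'] and g' = G_part_hom[OF h']
  note ac = act_pt_hom[OF rho_hom A x' inv_pt_hom[OF hopf_homs_G g]]
  note v = mat_in_pt(1)[OF A x] mat_in_pt(1)[OF A x'] mat_in_pt(2)[OF A g] mat_in_pt(2)[OF A g'] mat_in_pt(1)[OF A ac]
  have "rep A (mult_pt H A h h') = mat_mult A (mat_mult A (rep_X A (X_part h)) (rep_X A (act_pt A \<rho> (X_part h') (inv_pt G_grp (G_part h)))))
      (mat_mult A (rep_G A (G_part h)) (rep_G A (G_part h')))"
    unfolding mult_pt_H[OF A h h'] rep_def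
      X_part_G_part_pair[OF A mult_pt_hom[OF hopf_homs_X A x ac] mult_pt_hom[OF hopf_homs_G A g g']]
      rep_X_mult[OF A x ac] rep_G_mult[OF A g g'] ..
  also have "\<dots> = mat_mult A (rep_X A (X_part h)) (mat_mult A (mat_mult A (rep_X A (act_pt A \<rho> (X_part h') (inv_pt G_grp (G_part h)))) (rep_G A (G_part h))) (rep_G A (G_part h')))"
    by (simp add: mat_mult_assoc[OF A] mat_in_mat_mult[OF A] v)
  also have "\<dots> = mat_mult A (rep A h) (rep A h')"
    unfolding rep_X_act[OF A x' g] rep_def by (simp add: mat_mult_assoc[OF A] mat_in_mat_mult[OF A] v)
  finally show ?thesis .
qed

lemma rep_outside: "\<not> (i < 4 \<and> j < 4) \<Longrightarrow> rep A h i j = 0"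
  by (auto simp: rep_def mat_mult_def rep_X_def rep_G_def mat_X_def mat_G_def mat4_def)

lemma rep_inv:
  shows "mat_mult A (rep A (inv_pt H h)) (rep A h) = id4 A" "mat_mult A (rep A h) (rep A (inv_pt H h)) = id4 A"
proof -
  note x = X_part_hom[OF h] and g = G_part_hom[OF h]
  note ix = inv_pt_hom[OF hopf_homs_X x] and ig = inv_pt_hom[OF hopf_homs_G g]
  have ii: "inv_pt G_grp (inv_pt G_grp (G_part h)) = G_part h"
    by (rule G_pt_agree[OF A inv_pt_hom[OF hopf_homs_G ig] g]) (simp_all add: inv_pt_XG)
  note ac = act_pt_hom[OF rho_hom A ix g]
  note v = mat_in_pt(1)[OF A x] mat_in_pt(1)[OF A ix] mat_in_pt(2)[OF A g] mat_in_pt(2)[OF A ig]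
  \<comment> \<open>The twisted relation at g^{-1} turns the matrix of (x^{-1} \<cdot> g, g^{-1})
    into g^{-1} x^{-1}, which visibly cancels against x g.\<close>
  have M: "rep A (inv_pt H h) = mat_mult A (rep_G A (inv_pt G_grp (G_part h))) (rep_X A (inv_pt X_grp (X_part h)))"
    using rep_X_act[OF A ix ig] unfolding ii inv_pt_H[OF A h] rep_def X_part_G_part_pair[OF A ac ig] .
  have o: "rep_X A x' i j = 0" "rep_G A g' i j = 0" if "\<not> (i < 4 \<and> j < 4)" for i j x' g'
    using that by (auto simp: rep_X_def rep_G_def mat_X_def mat_G_def mat4_def)
  have "mat_mult A (rep A (inv_pt H h)) (rep A h) = mat_mult A (rep_G A (inv_pt G_grp (G_part h)))
     (mat_mult A (mat_mult A (rep_X A (inv_pt X_grp (X_part h))) (rep_X A (X_part h))) (rep_G A (G_part h)))"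
    unfolding M unfolding rep_def by (simp add: mat_mult_assoc[OF A] mat_in_mat_mult[OF A] v)
  then show "mat_mult A (rep A (inv_pt H h)) (rep A h) = id4 A"
    by (simp add: rep_X_inverse[OF A x] rep_G_inverse[OF A g] id4_mat_mult[OF A] v o)
  have "mat_mult A (rep A h) (rep A (inv_pt H h)) = mat_mult A (rep_X A (X_part h))
     (mat_mult A (mat_mult A (rep_G A (G_part h)) (rep_G A (inv_pt G_grp (G_part h)))) (rep_X A (inv_pt X_grp (X_part h))))"
    unfolding M unfolding rep_def by (simp add: mat_mult_assoc[OF A] mat_in_mat_mult[OF A] v)
  then show "mat_mult A (rep A h) (rep A (inv_pt H h)) = id4 A"
    by (simp add: rep_X_inverse[OF A x] rep_G_inverse[OF A g] id4_mat_mult[OF A] v o)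
qed

lemma mult_pt_H_one: "mult_pt H A h (one_pt H A) = h"
  by (rule rep_inject[OF A mult_pt_H_hom[OF one_pt_H_hom[OF A]] h])
    (simp add: rep_mult[OF one_pt_H_hom[OF A]] rep_one[OF A] id4_mat_mult[OF A mat_in_rep[OF A h] rep_outside])

end

lemma mult_pt_H_inv:
  fixes A :: "('a, 'k, 'm) superalg_scheme"
  assumes A: "supercomm_alg A" and h: "superalg_hom T_alg A h"
  shows "mult_pt H A (inv_pt H h) h = one_pt H A"
  by (rule rep_inject[OF A mult_pt_H_hom[OF A inv_pt_H_hom[OF A h] h] one_pt_H_hom[OF A]])
    (simp add: rep_mult[OF A inv_pt_H_hom[OF A h] h] rep_one[OF A] rep_inv[OF A h])

section \<open>Matrix coefficients as elements of K[H]\<close>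

lemma rep_hom:
  assumes A: "supercomm_alg A" and B: "supercomm_alg B" and h: "superalg_hom T_alg A h" and f: "superalg_hom A B f"
  shows "lin f (rep A h i j) = rep B (\<lambda>b. lin f (h b)) i j"
proof -
  note v = X_pt_vec[OF A X_part_hom[OF h]] G_pt_vec[OF A G_part_hom[OF h]]
  have c: "X_part (\<lambda>b. lin f (h b)) b = lin f (X_part h b)" "G_part (\<lambda>b. lin f (h b)) g = lin f (G_part h g)" for b g
    by (simp_all add: X_part_apply G_part_apply)
  have "lin f (rep_X A (X_part h) i j) = rep_X B (X_part (\<lambda>b. lin f (h b))) i j"
    "lin f (rep_G A (G_part h) i j) = rep_G B (G_part (\<lambda>b. lin f (h b))) i j" for i j
    unfolding rep_X_def rep_G_def mat_X_def mat_G_def hom_mat4 c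
    by (simp_all add: lin_diff lin_minus hom_amul[OF f] hom_unit[OF f] v supercomm_alg_amul_vec[OF A])
  then show ?thesis
    unfolding rep_def
    by (simp only: hom_mat_mult[OF f mat_in_pt(1)[OF A X_part_hom[OF h]] mat_in_pt(2)[OF A G_part_hom[OF h]]])
qed

text \<open>The identity of K[H] is the universal point, so its matrix consists of the coefficient
  functions of \<open>V\<close>; evaluating them at a point gives the matrix of that point.\<close>

definition rep_coeff :: "nat \<Rightarrow> nat \<Rightarrow> (x_idx \<times> g_idx \<Rightarrow>\<^sub>0 'k)" where
  "rep_coeff = rep T_alg bvec"

lemma bvec_hom: "superalg_hom T_alg (T_alg :: (x_idx \<times> g_idx, 'k) superalg) bvec"
  by (rule superalg_hom_id[OF supercomm_alg_superalgebra[OF supercomm_alg_T(1)]])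

lemma hom_rep_coeff:
  assumes B: "supercomm_alg B" and h: "superalg_hom T_alg B h"
  shows "lin h (rep_coeff i j) = rep B h i j"
  using rep_hom[OF supercomm_alg_T(1) B bvec_hom h, of i j] by (simp add: rep_coeff_def)

text \<open>The comultiplication is itself the product of the two universal points. This turns
  multiplicativity of \<open>rep\<close> into the coproduct of the matrix coefficients.\<close>

lemma comult_H: "mult_pt H T2_alg (inc1 T_alg) (inc2 T_alg) = comult H"
proof -
  have "lin (pair_pt T2_alg (inc1 T_alg) (inc2 T_alg)) z = lin bvec z" for z :: "_ \<Rightarrow>\<^sub>0 'k"
  proof (rule lin_cong)
    fix bc :: "(x_idx \<times> g_idx) \<times> (x_idx \<times> g_idx)"
    show "pair_pt T2_alg (inc1 T_alg) (inc2 T_alg) bc = (bvec bc :: _ \<Rightarrow>\<^sub>0 'k)"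
      using amul_inc1_inc2[OF supercomm_alg_T(1) supercomm_alg_T(1), of "bvec (fst bc)" "bvec (snd bc)"]
      by (cases bc) (simp add: pair_pt_def inc1_def inc2_def)
  qed
  then show ?thesis by (simp add: mult_pt_def fun_eq_iff)
qed

lemma comult_rep_coeff: "lin (comult H) (rep_coeff i j) = (\<Sum>k<4. rep_coeff i k \<otimes> rep_coeff k j)"
proof -
  note i1 = inc1_hom[OF supercomm_alg_T(1) supercomm_alg_T(1)] and i2 = inc2_hom[OF supercomm_alg_T(1) supercomm_alg_T(1)]
  have v: "rep_coeff i j \<in> vec (T_alg :: (x_idx \<times> g_idx, 'k) superalg)" for i j
    unfolding rep_coeff_def using mat_in_rep[OF supercomm_alg_T(1) bvec_hom] unfolding mat_in_def by blast
  have "lin (comult H) (rep_coeff i j) = rep T2_alg (comult H) i j"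
    using hom_rep_coeff[OF supercomm_alg_T(2) mult_pt_H_hom[OF supercomm_alg_T(2) i1 i2]] by (simp only: comult_H)
  also have "\<dots> = mat_mult T2_alg (rep T2_alg (inc1 T_alg)) (rep T2_alg (inc2 T_alg)) i j"
    using rep_mult[OF supercomm_alg_T(2) i1 i2] by (simp only: comult_H)
  also have "\<dots> = (\<Sum>k<4. amul T2_alg (lin (inc1 T_alg) (rep_coeff i k)) (lin (inc2 T_alg) (rep_coeff k j)))"
    by (simp add: mat_mult_def hom_rep_coeff[OF supercomm_alg_T(2) i1] hom_rep_coeff[OF supercomm_alg_T(2) i2])
  also have "\<dots> = (\<Sum>k<4. rep_coeff i k \<otimes> rep_coeff k j)"
    unfolding lin_inc1 lin_inc2 amul_inc1_inc2[OF supercomm_alg_T(1) supercomm_alg_T(1) v v] ..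
  finally show ?thesis .
qed

end


section \<open>Fixed vectors of unipotent supergroups\<close>

lemma lookup_restrict: "lk (lin (\<lambda>b. if P b then bvec b else 0) x) b = (if P b then lk x b else 0)"
proof -
  have "lk (lin (\<lambda>b. if P b then bvec b else 0) x) b =
      (\<Sum>b'\<in>ky x. if b' = b then (if P b then lk x b else 0) else 0)"
    unfolding lookup_lin by (intro sum.cong refl) (auto simp: lookup_single when_def)
  then show ?thesis by (auto simp: in_keys_iff)
qed

lemma lin_bvec_pair: "lin (\<lambda>c. bvec (b, c)) x = bvec b \<otimes> x"
  using tens_lin_right[of "bvec b" bvec x] by simp

text \<open>The coaction maps \<open>W\<close> into a span of tensors w \<otimes> c, so identities
  after the coaction can be checked on these pure tensors.\<close>

lemma span_lin_eq:
  assumes "y \<in> pm.span B" "\<And>x. x \<in> B \<Longrightarrow> lin f (lin g x) = lin f' (lin g' x)"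
  shows "lin f (lin g y) = lin f' (lin g' y)"
  using assms(1)
proof (rule pm.span_induct)
  show "pm.subspace {y. lin f (lin g y) = lin f' (lin g' y)}"
    by (auto simp: pm.subspace_def lin_add lin_scal)
qed (use assms(2) in auto)

text \<open>A nonzero supercomodule of least dimension is simple; instead of choosing one, descend from
  a proper subsupercomodule \<open>W\<close>.  For a minimal set \<open>S\<close> of coordinates separating the points of \<open>W\<close>,
  restriction to \<open>S\<close> identifies \<open>W\<close> with the superspace based on \<open>S\<close>.\<close>

lemma unipotent_fixed_vector:
  fixes N :: "('c, 'k::field) hopf" and V :: "nat superspace"
  assumes N: "unipotent N" and "supercomodule N V \<delta>" "finite (idx V)" "idx V \<noteq> {}"
  shows "\<exists>v\<in>vec V. v \<noteq> 0 \<and> lin \<delta> v = v \<otimes> unit_el N"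
  using assms(2-)
proof (induction "card (idx V)" arbitrary: V \<delta> rule: less_induct)
  case less
  note V = \<open>supercomodule N V \<delta>\<close> and fin = \<open>finite (idx V)\<close>
  show ?case
  proof (cases "simple_supercomodule N V \<delta>")
    case True
    then have "trivial_supercomodule N V \<delta>" using N by (auto simp: unipotent_def)
    moreover obtain b where "b \<in> idx V" using less.prems by auto
    ultimately show ?thesis
      by (intro bexI[of _ "bvec b"]) (auto simp: trivial_supercomodule_def dest!: arg_cong[where f = ky])
  next
    case False
    then obtain W where sW: "subsupercomodule N V \<delta> W" and W: "W \<noteq> {0}" "W \<noteq> vec V"
      using less.prems by (auto simp: simple_supercomodule_def)
    have WV: "W \<subseteq> vec V" and sub: "pm.subspace W" and gr: "W = pm.span (\<Union>p. W \<inter> hpart V p)"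
      and st: "\<And>w. w \<in> W \<Longrightarrow> lin \<delta> w \<in> pm.span {w' \<otimes> c | w' c. w' \<in> W \<and> c \<in> vec N}"
      using sW by (auto simp: subsupercomodule_def)
    note cl = pm.subspace_0[OF sub] pm.subspace_add[OF sub] pm.subspace_scale[OF sub] pm.subspace_diff[OF sub]
    \<comment> \<open>The projection onto parity \<open>p\<close>; it preserves \<open>W\<close>
      because \<open>W\<close> is spanned by its homogeneous elements.\<close>
    define hp :: "bool \<Rightarrow> nat \<Rightarrow> (nat \<Rightarrow>\<^sub>0 'k)" where "hp p b = (if par V b = p then bvec b else 0)" for p b
    have lk_hp: "lk (lin (hp p) x) b = (if par V b = p then lk x b else 0)" for p x b
      unfolding hp_def[abs_def] by (rule lookup_restrict)
    have hpW: "lin (hp p) w \<in> W" if "w \<in> W" for w p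
    proof -
      have "w \<in> pm.span (\<Union>p. W \<inter> hpart V p)" using that gr by simp
      then show ?thesis
      proof (rule pm.span_induct)
        show "pm.subspace {w. lin (hp p) w \<in> W}"
          using cl by (auto simp: pm.subspace_def lin_add lin_scal)
        fix x assume "x \<in> (\<Union>p. W \<inter> hpart V p)"
        then obtain q where q: "x \<in> W" "x \<in> hpart V q" by auto
        have "lin (hp p) x = (if p = q then x else 0)"
        proof (rule poly_mapping_eqI)
          fix b show "lk (lin (hp p) x) b = lk (if p = q then x else 0) b"
            using hpart_keysD[OF q(2), of b] by (auto simp: lk_hp in_keys_iff)
        qed
        then show "lin (hp p) x \<in> W" using q cl by auto
      qed
    qed
    define F where "F = {S. S \<subseteq> idx V \<and> (\<forall>w\<in>W. (\<forall>s\<in>S. lk w s = 0) \<longrightarrow> w = 0)}"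
    have "idx V \<in> F"
      unfolding F_def
    proof (intro CollectI conjI ballI impI poly_mapping_eqI)
      fix w b assume "w \<in> W" "\<forall>s\<in>idx V. lk w s = 0"
      then show "lk w b = lk 0 b" using vec_keysD[of w V b] WV by (auto simp: in_keys_iff)
    qed simp
    then obtain S where S: "S \<in> F" "\<And>S'. S' \<in> F \<Longrightarrow> card S \<le> card S'"
      using ex_has_least_nat[of "\<lambda>S. S \<in> F" "idx V" card] by blast
    have SV: "S \<subseteq> idx V" and sep: "\<And>w. w \<in> W \<Longrightarrow> \<forall>s\<in>S. lk w s = 0 \<Longrightarrow> w = 0"
      using S by (auto simp: F_def)
    have finS: "finite S" using SV fin finite_subset by blast
    have "\<forall>s\<in>S. \<exists>y. y \<in> W \<and> y \<in> hpart V (par V s) \<and> (\<forall>s'\<in>S. lk y s' = (if s' = s then 1 else 0))"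
    proof
      fix s assume s: "s \<in> S"
      \<comment> \<open>Minimality gives a nonzero \<open>w\<close> in \<open>W\<close> vanishing on
        \<open>S - {s}\<close>, hence nonzero at \<open>s\<close>. Scaling makes that value 1, and
        projection to the parity of \<open>s\<close> preserves both the value and the zeros: this is
        a homogeneous basis of \<open>W\<close> dual to the coordinates in \<open>S\<close>.\<close>
      have "S - {s} \<notin> F" using S(2)[of "S - {s}"] card_Diff1_less[OF finS s] by linarith
      then obtain w where w: "w \<in> W" "\<forall>s'\<in>S - {s}. lk w s' = 0" "w \<noteq> 0"
        using SV by (auto simp: F_def)
      then have nz: "lk w s \<noteq> 0" using sep[of w] by auto
      let ?y = "lin (hp (par V s)) (scal (1 / lk w s) w)"
      have "?y \<in> W" using w cl hpW by auto
      moreover from this have "?y \<in> hpart V (par V s)"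
        using WV by (auto simp: hpart_def vec_def in_keys_iff lk_hp split: if_splits)
      moreover have "\<forall>s'\<in>S. lk ?y s' = (if s' = s then 1 else 0)"
        using w(2) nz by (auto simp: lk_hp lookup_scal)
      ultimately show "\<exists>y. y \<in> W \<and> y \<in> hpart V (par V s) \<and> (\<forall>s'\<in>S. lk y s' = (if s' = s then 1 else 0))"
        by blast
    qed
    then obtain \<beta> where \<beta>: "\<And>s. s \<in> S \<Longrightarrow> \<beta> s \<in> W" "\<And>s. s \<in> S \<Longrightarrow> \<beta> s \<in> hpart V (par V s)"
      "\<And>s s'. s \<in> S \<Longrightarrow> s' \<in> S \<Longrightarrow> lk (\<beta> s) s' = (if s' = s then 1 else 0)"
      by (metis (no_types, lifting))
    define r :: "nat \<Rightarrow> (nat \<Rightarrow>\<^sub>0 'k)" where "r b = (if b \<in> S then bvec b else 0)" for b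
    have lk_r: "lk (lin r x) b = (if b \<in> S then lk x b else 0)" for x b
      unfolding r_def[abs_def] by (rule lookup_restrict)
    have lin\<beta>: "lin \<beta> x \<in> W" "\<forall>s\<in>S. lk (lin \<beta> x) s = lk x s" if "ky x \<subseteq> S" for x
    proof -
      show "lin \<beta> x \<in> W"
        unfolding lin_def using that \<beta>(1) by (intro pm.subspace_sum[OF sub] cl) auto
      show "\<forall>s\<in>S. lk (lin \<beta> x) s = lk x s"
      proof
        fix s assume s: "s \<in> S"
        have "lk (lin \<beta> x) s = (\<Sum>b\<in>ky x. lk x b * (if s = b then 1 else 0))"
          unfolding lookup_lin using that s by (intro sum.cong refl) (auto simp: \<beta>(3))
        then show "lk (lin \<beta> x) s = lk x s"
          by (auto simp: if_distrib[of "(*) _"] in_keys_iff cong: if_cong)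
      qed
    qed
    have kr: "ky (lin r x) \<subseteq> S" for x by (auto simp: in_keys_iff lk_r split: if_splits)
    \<comment> \<open>The difference lies in \<open>W\<close> and vanishes on \<open>S\<close>,
      which separates.\<close>
    have \<beta>r: "lin \<beta> (lin r w) = w" if "w \<in> W" for w
    proof -
      have "lin \<beta> (lin r w) - w = 0"
        using lin\<beta>[OF kr, of w] that by (intro sep cl) (auto simp: lookup_minus lk_r)
      then show ?thesis by simp
    qed
    have r\<beta>: "lin r (lin \<beta> x) = x" if "ky x \<subseteq> S" for x
      using lin\<beta>(2)[OF that] that by (intro poly_mapping_eqI) (auto simp: lk_r in_keys_iff)
    have Sne: "S \<noteq> {}"
      using sep W(1) cl(1) by auto
    have "S \<noteq> idx V"
    proof
      assume eq: "S = idx V"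
      have "x \<in> W" if "x \<in> vec V" for x
      proof -
        have x: "ky x \<subseteq> S" using that eq by (auto simp: vec_def)
        have "lin \<beta> x - x \<in> vec V" using lin\<beta>(1)[OF x] WV that by auto
        then have "lin \<beta> x - x = 0"
          using lin\<beta>(2)[OF x] eq by (intro poly_mapping_eqI) (auto simp: vec_def in_keys_iff lookup_minus subset_iff)
        then show ?thesis using lin\<beta>(1)[OF x] by simp
      qed
      then show False using W WV by auto
    qed
    then have card: "card S < card (idx V)" using SV fin psubset_card_mono by blast
    define V' :: "nat superspace" where "V' = \<lparr> idx = S, par = par V \<rparr>"
    define R :: "nat \<times> 'c \<Rightarrow> (nat \<times> 'c \<Rightarrow>\<^sub>0 'k)" where "R = (\<lambda>(w, c). r w \<otimes> bvec c)"
    \<comment> \<open>The coaction transported along the isomorphism \<open>\<beta>\<close> with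
      inverse \<open>r\<close>: apply \<open>\<beta>\<close>, then the coaction, then r \<otimes>
      id, which is \<open>R\<close>.\<close>
    define \<delta>' where "\<delta>' s = lin R (lin \<delta> (\<beta> s))" for s
    have R_tens: "lin R (x \<otimes> c) = lin r x \<otimes> c" for x c
      unfolding R_def by (simp add: lin_tens_tens)
    have ev: "even_map V (tens_space V N) \<delta>"
      and co: "\<And>v. v \<in> idx V \<Longrightarrow> lin (\<lambda>(w, c). lin (\<lambda>(w', d). bvec (w', (d, c))) (\<delta> w)) (\<delta> v)
          = lin (\<lambda>(w, c). bvec w \<otimes> comult N c) (\<delta> v)"
      and cou: "\<And>v. v \<in> idx V \<Longrightarrow> lin (\<lambda>(w, c). scal (counit N c) (bvec w)) (\<delta> v) = bvec v"
      using V by (auto simp: supercomodule_def)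
    have \<beta>V: "\<beta> s \<in> vec V" if "s \<in> S" for s using \<beta>(1)[OF that] WV by auto
    have lin\<delta>': "lin \<delta>' x = lin R (lin \<delta> (lin \<beta> x))" for x
      by (simp add: \<delta>'_def[abs_def] lin_lin)
    \<comment> \<open>\<open>K f\<close> is f \<otimes> id up to rebracketing, so that
      coassociativity compares \<open>K \<delta>\<close> with id tensored with the comultiplication;
      \<open>R3\<close> is \<open>r\<close> tensored with the identity of both algebra
      factors.\<close>
    define K :: "(nat \<Rightarrow> (nat \<times> 'c \<Rightarrow>\<^sub>0 'k)) \<Rightarrow> nat \<times> 'c \<Rightarrow> (nat \<times> 'c \<times> 'c \<Rightarrow>\<^sub>0 'k)"
      where "K f = (\<lambda>(w, c). lin (\<lambda>(w', d). bvec (w', (d, c))) (f w))"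
      for f
    define R3 :: "nat \<times> 'c \<times> 'c \<Rightarrow> (nat \<times> 'c \<times> 'c \<Rightarrow>\<^sub>0 'k)" where "R3 = (\<lambda>(w, c). r w \<otimes> bvec c)"
    have K_tens: "lin (K f) (x \<otimes> c) = lin (\<lambda>c'. lin (\<lambda>(w', d). bvec (w', (d, c'))) (lin f x)) c" for f x c
      unfolding K_def lin_tens by (subst lin_swap) (simp add: lin_lin)
    have R3_shift: "lin R3 (lin (\<lambda>(w', d). bvec (w', (d, c'))) u) = lin (\<lambda>(w', d). bvec (w', (d, c'))) (lin R u)" for c' u
      unfolding lin_lin
      by (intro lin_cong) (auto simp: R3_def R_def r_def lin_tens)
    have V': "supercomodule N V' \<delta>'"
      unfolding supercomodule_def
    proof (intro conjI ballI)
      show "even_map V' (tens_space V' N) \<delta>'"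
        unfolding even_map_def
      proof
        fix s assume "s \<in> idx V'"
        then have s: "s \<in> S" by (simp add: V'_def)
        have *: "lin \<delta> (\<beta> s) \<in> hpart (tens_space V N) (par V s)"
          by (rule even_map_hpart[OF ev \<beta>(2)[OF s]])
        show "\<delta>' s \<in> hpart (tens_space V' N) (par V' s)"
          unfolding \<delta>'_def
        proof (rule lin_hpart)
          fix wc assume wc: "wc \<in> ky (lin \<delta> (\<beta> s))"
          obtain w c where e: "wc = (w, c)" by (cases wc)
          have "c \<in> idx N" "(par V w \<noteq> par N c) = par V s"
            using hpart_keysD[OF * wc] e by (auto simp: tens_space_def)
          then show "R wc \<in> hpart (tens_space V' N) (par V' s)"
            by (auto simp: R_def e r_def V'_def tens_space_def)
        qed
      qed
    next
      fix s assume "s \<in> idx V'"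
      then have s: "s \<in> S" by (simp add: V'_def)
      let ?y = "lin \<delta> (\<beta> s)"
      have y: "?y \<in> pm.span {w' \<otimes> c | w' c. w' \<in> W \<and> c \<in> vec N}" by (rule st[OF \<beta>(1)[OF s]])
      have 1: "lin (K \<delta>') (lin R ?y) = lin R3 (lin (K \<delta>) ?y)"
        using y
      proof (rule span_lin_eq)
        fix x assume "x \<in> {w' \<otimes> c | w' c. w' \<in> W \<and> c \<in> vec N}"
        then obtain w c where x: "x = w \<otimes> c" and w: "w \<in> W" by auto
        show "lin (K \<delta>') (lin R x) = lin R3 (lin (K \<delta>) x)"
          unfolding x R_tens K_tens lin\<delta>' \<beta>r[OF w]
            lin_lin[of R3 "\<lambda>c'. lin (\<lambda>(w', d). bvec (w', (d, c'))) (lin \<delta> w)"] R3_shift ..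
      qed
      have 2: "lin (K \<delta>) ?y = lin (\<lambda>(w, c). bvec w \<otimes> comult N c) ?y"
        unfolding lin_lin by (rule lin_cong) (use co vec_keysD[OF \<beta>V[OF s]] in \<open>simp add: K_def\<close>)
      have 3: "lin R3 (lin (\<lambda>(w, c). bvec w \<otimes> comult N c) ?y) = lin (\<lambda>(w, c). bvec w \<otimes> comult N c) (lin R ?y)"
        unfolding lin_lin[of _ _ ?y]
        by (intro lin_cong) (auto simp: R3_def R_def lin_tens r_def lin_bvec_pair)
      show "lin (\<lambda>(w, c). lin (\<lambda>(w', d). bvec (w', (d, c))) (\<delta>' w)) (\<delta>' s)
          = lin (\<lambda>(w, c). bvec w \<otimes> comult N c) (\<delta>' s)"
        using 1 unfolding 2 3 by (simp add: K_def \<delta>'_def)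
      have "lin (\<lambda>(w, c). scal (counit N c) (bvec w)) (\<delta>' s) = lin r (lin (\<lambda>(w, c). scal (counit N c) (bvec w)) ?y)"
        unfolding \<delta>'_def lin_lin[of _ _ ?y]
        by (intro lin_cong) (auto simp: R_def r_def lin_tens)
      also have "lin (\<lambda>(w, c). scal (counit N c) (bvec w)) ?y = lin bvec (\<beta> s)"
        unfolding lin_lin by (rule lin_cong) (use cou vec_keysD[OF \<beta>V[OF s]] in simp)
      also have "lin r (lin bvec (\<beta> s)) = bvec s"
        using r\<beta>[of "bvec s"] s by simp
      finally show "lin (\<lambda>(w, c). scal (counit N c) (bvec w)) (\<delta>' s) = bvec s" .
    qed
    obtain v where v: "v \<in> vec V'" "v \<noteq> 0" "lin \<delta>' v = v \<otimes> unit_el N"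
      using less.hyps[OF _ V'] card finS Sne by (auto simp: V'_def)
    have kv: "ky v \<subseteq> S" using v(1) by (auto simp: vec_def V'_def)
    let ?w = "lin \<beta> v"
    have w: "?w \<in> W" "?w \<noteq> 0" using lin\<beta>(1)[OF kv] r\<beta>[OF kv] v(2) by auto
    \<comment> \<open>The map \<beta> \<otimes> id undoes \<open>R\<close> on tensors from
      \<open>W\<close>, so the fixed vector found for the smaller space is carried back.\<close>
    have "lin (\<lambda>(w, c). \<beta> w \<otimes> bvec c) (lin R (lin \<delta> ?w)) = lin bvec (lin bvec (lin \<delta> ?w))"
      using st[OF w(1)]
    proof (rule span_lin_eq)
      fix x assume "x \<in> {w' \<otimes> c | w' c. w' \<in> W \<and> c \<in> vec N}"
      then obtain w c where x: "x = w \<otimes> c" and w: "w \<in> W" by auto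
      show "lin (\<lambda>(w, c). \<beta> w \<otimes> bvec c) (lin R x) = lin bvec (lin bvec x)"
        unfolding x R_tens lin_tens_tens \<beta>r[OF w] by simp
    qed
    then have "lin \<delta> ?w = ?w \<otimes> unit_el N"
      using v(3) unfolding lin\<delta>' by (simp add: lin_tens_tens)
    then show ?thesis using w WV by auto
  qed
qed


section \<open>The unipotent radical\<close>

text \<open>The counit as a linear map into the space based on \<open>unit\<close>, so that the
  rules for \<open>lin\<close> apply.\<close>

lemma lin_counit_lookup: "lin_counit C x = lk (lin (\<lambda>b. Poly_Mapping.single () (counit C b)) x) ()"
  by (simp add: lin_counit_def lookup_lin)

lemma lin_counit_diff: "lin_counit C (x - y) = lin_counit C x - lin_counit C y"
  and lin_counit_scal: "lin_counit C (scal a x) = a * lin_counit C x"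
  and lin_counit_single: "lin_counit C (Poly_Mapping.single b k) = k * counit C b"
  by (simp_all add: lin_counit_lookup lin_diff lin_scal lookup_minus lookup_scal)

lemma lin_counit_lin: "lin_counit C (lin f x) = (\<Sum>b\<in>ky x. lk x b * lin_counit C (f b))"
  unfolding lin_counit_lookup lin_lin by (rule lookup_lin)

lemma lin_counit_const: "lin (\<lambda>b. scal (counit C b) u) x = scal (lin_counit C x) u"
  by (simp add: lin_def lin_counit_def pm.scale_sum_left)

lemma lin_one_pt: "lin (one_pt C A) x = scal (lin_counit C x) (unit_el A)"
  by (simp add: one_pt_def lin_counit_const)

text \<open>The ground field as coordinate algebra of the trivial group. The basis index
  \<open>i\<close> is a parameter because a closed supersubgroup must use the index type of the
  ambient group.\<close>

definition triv_hopf :: "'b \<Rightarrow> ('b, 'k::field) hopf" where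
  "triv_hopf i = \<lparr> idx = {i}, par = (\<lambda>_. False), mul = (\<lambda>_. bvec i), unit_el = bvec i,
     comult = (\<lambda>_. bvec (i, i)), counit = (\<lambda>_. 1), antip = (\<lambda>_. bvec i) \<rparr>"

lemma triv_hopf_simps [simp]:
  "idx (triv_hopf i) = {i}" "par (triv_hopf i) = (\<lambda>_. False)" "mul (triv_hopf i) = (\<lambda>_. bvec i)"
  "unit_el (triv_hopf i) = bvec i" "comult (triv_hopf i) = (\<lambda>_. bvec (i, i))"
  "counit (triv_hopf i) = (\<lambda>_. 1)" "antip (triv_hopf i) = (\<lambda>_. bvec i)"
  by (simp_all add: triv_hopf_def)

lemma vec_singleton: "idx V = {i} \<Longrightarrow> x \<in> vec V \<Longrightarrow> x = Poly_Mapping.single i (lk x i)"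
  by (rule poly_mapping_eqI) (auto simp: vec_def lookup_single when_def in_keys_iff)

lemma supercomm_alg_triv_hopf: "supercomm_alg (triv_hopf i)"
  unfolding supercomm_alg_def by (auto intro!: superalgebraI supercommutativeI)

lemma supergroup_triv_hopf: "supergroup (triv_hopf i :: ('b, 'k::field) hopf)"
proof -
  have hom: "superalg_hom (triv_hopf i) (tens_alg (triv_hopf i) (triv_hopf i)) (comult (triv_hopf i :: ('b, 'k) hopf))"
    by (rule superalg_homI) (auto simp: mul_tens_alg)
  have "lin_counit (triv_hopf i) (amul (triv_hopf i) x y) = lin_counit (triv_hopf i) x * lin_counit (triv_hopf i :: ('b, 'k) hopf) y"
    if xy: "x \<in> vec (triv_hopf i :: ('b, 'k) hopf)" "y \<in> vec (triv_hopf i :: ('b, 'k) hopf)" for x y :: "'b \<Rightarrow>\<^sub>0 'k"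
  proof -
    obtain a b where "x = Poly_Mapping.single i a" "y = Poly_Mapping.single i b"
      using vec_singleton[OF _ xy(1)] vec_singleton[OF _ xy(2)] by (metis triv_hopf_simps(1))
    then show ?thesis by (simp add: lin_counit_single)
  qed
  moreover have "hpart (triv_hopf i :: ('b, 'k) hopf) True = {0 :: 'b \<Rightarrow>\<^sub>0 'k}"
    by (auto simp: hpart_def)
  ultimately show ?thesis
    using supercomm_alg_triv_hopf[of i] hom
    by (auto simp: supergroup_def supercomm_alg_def lin_counit_single even_map_def lin_counit_def[of _ 0])
qed

text \<open>Every element of V \<otimes> K is w \<otimes> 1 for a unique w, and the counit axiom
  forces w = v.\<close>

lemma unipotent_triv_hopf: "unipotent (triv_hopf i :: ('b, 'k::field) hopf)"
  unfolding unipotent_def trivial_supercomodule_def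
proof (intro allI impI ballI)
  fix V :: "nat superspace" and \<delta> :: "nat \<Rightarrow> (nat \<times> 'b \<Rightarrow>\<^sub>0 'k)" and v
  assume s: "simple_supercomodule (triv_hopf i) V \<delta>" and v: "v \<in> idx V"
  then have d: "\<delta> v \<in> hpart (tens_space V (triv_hopf i :: ('b, 'k) hopf)) (par V v)"
    and c: "lin (\<lambda>(w, c). bvec w) (\<delta> v) = bvec v"
    by (auto simp: simple_supercomodule_def supercomodule_def even_map_def)
  have k: "snd wc = i" if "wc \<in> ky (\<delta> v)" for wc
    using hpart_keysD[OF d that] by (auto simp: tens_space_def)
  have "lin bvec (\<delta> v) = lin (\<lambda>wc. bvec (fst wc) \<otimes> bvec i) (\<delta> v)"
    by (rule lin_cong) (use k in force)
  also have "\<dots> = lin (\<lambda>(w, c). bvec w) (\<delta> v) \<otimes> bvec i"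
    unfolding tens_lin_left by (simp add: case_prod_beta)
  finally show "\<delta> v = bvec v \<otimes> unit_el (triv_hopf i)"
    unfolding c by simp
qed

section \<open>Parities of the matrix entries\<close>

lemma hpart_mult_intros:
  assumes "supercomm_alg A"
  shows "x \<in> hpart A False \<Longrightarrow> y \<in> hpart A p \<Longrightarrow> amul A x y \<in> hpart A p"
    and "x \<in> hpart A True \<Longrightarrow> y \<in> hpart A True \<Longrightarrow> amul A x y \<in> hpart A False"
    and "x \<in> hpart A True \<Longrightarrow> y \<in> hpart A False \<Longrightarrow> amul A x y \<in> hpart A True"
  using amul_hpart[OF supercomm_alg_superalgebra[OF assms], of x _ y] by fastforce+

text \<open>The odd vectors of the basis \<open>1\<close>, \<open>P 1\<close>, \<open>Q 1\<close>,
  \<open>P Q 1\<close>.\<close>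

definition parV :: "nat \<Rightarrow> bool" where "parV i \<longleftrightarrow> i = 1 \<or> i = 2"

lemma rep_hpart:
  assumes A: "supercomm_alg A" and h: "superalg_hom T_alg A h" and ij: "i < 4" "j < 4"
  shows "rep A h i j \<in> hpart A (parV i \<noteq> parV j)"
proof -
  note x = X_pt_hpart[OF A X_part_hom[OF h]] and g = G_pt_hpart[OF A G_part_hom[OF h]]
  have 1: "rep_X A (X_part h) i j \<in> hpart A (parV i \<noteq> parV j)" if "i < 4" "j < 4" for i j
    using that x unfolding less_4_iff
    by (elim disjE) (simp_all add: rep_X_def mat_X_def mat4_def parV_def hpart_mult_intros[OF A] hpart_diff hpart_minus del: One_nat_def)
  have 2: "rep_G A (G_part h) i j \<in> hpart A (parV i \<noteq> parV j)" if "i < 4" "j < 4" for i j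
    using that g supercomm_alg_unit_hpart[OF A] unfolding less_4_iff
    by (elim disjE) (simp_all add: rep_G_def mat_G_def mat4_def parV_def hpart_mult_intros[OF A] hpart_minus del: One_nat_def)
  show ?thesis
    unfolding rep_def mat_mult_def
  proof (rule hpart_sum)
    fix k :: nat assume "k \<in> {..<4}"
    then have "amul A (rep_X A (X_part h) i k) (rep_G A (G_part h) k j) \<in> hpart A ((parV i \<noteq> parV k) \<noteq> (parV k \<noteq> parV j))"
      using ij by (intro amul_hpart supercomm_alg_superalgebra A 1 2) auto
    moreover have "((parV i \<noteq> parV k) \<noteq> (parV k \<noteq> parV j)) = (parV i \<noteq> parV j)" by auto
    ultimately show "amul A (rep_X A (X_part h) i k) (rep_G A (G_part h) k j) \<in> hpart A (parV i \<noteq> parV j)" by simp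
  qed
qed

lemma id4_apply: "i < 4 \<Longrightarrow> j < 4 \<Longrightarrow> id4 A i j = (if i = j then unit_el A else 0)"
  unfolding less_4_iff by (elim disjE) (simp_all add: id4_def mat4_def Let_def)

section \<open>The trivial supersubgroup belongs to the family\<close>

context example_action
begin

text \<open>The projection is the unit point of H over the ground field. Its compatibility with
  comultiplication and antipode is 1 1 = 1 and 1^{-1} = 1 in the group of points.\<close>

lemma normal_unipotent_trivial: "normal_unipotent H (trivial_supersubgroup H)"
proof -
  define N :: "(x_idx \<times> g_idx, 'k) hopf" where "N = triv_hopf (eX, eG)"
  have N: "supercomm_alg N" by (simp add: N_def supercomm_alg_triv_hopf)
  let ?\<pi> = "one_pt H N"
  have hom: "superalg_hom T_alg N ?\<pi>" by (rule one_pt_H_hom[OF N])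
  have mult: "mult_pt H N ?\<pi> ?\<pi> = ?\<pi>" by (rule mult_pt_H_one[OF N hom])
  have inv: "inv_pt H ?\<pi> = ?\<pi>"
    using mult_pt_H_inv[OF N hom] mult_pt_H_one[OF N inv_pt_H_hom[OF N hom]] by simp
  have "closed_supersubgroup H N ?\<pi>"
    unfolding closed_supersubgroup_def
  proof (intro conjI ballI)
    show "supergroup N" by (simp add: N_def supergroup_triv_hopf)
    show "superalg_hom H N ?\<pi>" using hom by (simp add: superalg_hom_H)
    have "y \<in> lin ?\<pi> ` vec H" if y: "y \<in> vec N" for y :: "_ \<Rightarrow>\<^sub>0 'k"
    proof -
      obtain k where "y = Poly_Mapping.single (eX, eG) k"
        using vec_singleton[OF _ y, of "(eX, eG)"] by (auto simp: N_def)
      then have "y = lin ?\<pi> (Poly_Mapping.single (eX, eG) k)"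
        by (simp add: N_def one_pt_def counit_XG)
      moreover have "Poly_Mapping.single (eX, eG) k \<in> vec H"
        by (simp add: vec_def)
      ultimately show ?thesis by blast
    qed
    then show "lin ?\<pi> ` vec H = vec N"
      using hom_vec[OF hom] by (auto simp: vec_H)
    fix b
    have "lin (\<lambda>(c, d). ?\<pi> c \<otimes> ?\<pi> d) (comult H b) = lin (comult N) (mult_pt H N ?\<pi> ?\<pi> b)"
      unfolding mult_pt_def lin_lin
      by (intro lin_cong) (auto simp: N_def one_pt_def pair_pt_def)
    then show "lin (\<lambda>(c, d). ?\<pi> c \<otimes> ?\<pi> d) (comult H b) = lin (comult N) (?\<pi> b)"
      unfolding mult .
    show "lin_counit N (?\<pi> b) = counit H b"
      by (simp add: N_def one_pt_def lin_counit_single)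
    have "lin ?\<pi> (antip H b) = ?\<pi> b" using inv by (metis inv_pt_def)
    then show "lin ?\<pi> (antip H b) = lin (antip N) (?\<pi> b)"
      by (simp add: N_def one_pt_def)
  qed
  moreover have "trivial_supersubgroup H = defining_ideal H ?\<pi>"
    by (auto simp: trivial_supersubgroup_def defining_ideal_def lin_one_pt N_def
        dest: arg_cong[where f = "\<lambda>x. lk x (eX, eG)"])
  moreover have "unipotent N" by (simp add: N_def unipotent_triv_hopf)
  moreover have "normal_supersubgroup H (trivial_supersubgroup H)"
    unfolding normal_supersubgroup_def
  proof (intro allI impI ballI)
    fix A :: "((x_idx \<times> g_idx) \<times> (x_idx \<times> g_idx), 'k) superalg" and n h
    assume "superalgebra A \<and> supercommutative A"
      and n: "n \<in> sub_points H (trivial_supersubgroup H) A" and "h \<in> points H A"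
    then have A: "supercomm_alg A" and h: "superalg_hom T_alg A h" by (auto simp: supercomm_alg_def points_def superalg_hom_H)
    have nh: "superalg_hom T_alg A n" and n0: "\<And>f. f \<in> trivial_supersubgroup H \<Longrightarrow> lin n f = 0"
      using n by (auto simp: sub_points_def points_def superalg_hom_H)
    have "n b = one_pt H A b" for b
    proof -
      \<comment> \<open>Subtracting its counit moves any basis vector into the augmentation ideal,
        which \<open>n\<close> kills; so \<open>n\<close> is the unit point, and conjugation fixes
        it.\<close>
      have "bvec b - scal (counit H b) (unit_el H) \<in> trivial_supersubgroup H"
        by (auto simp: trivial_supersubgroup_def vec_def lin_counit_diff lin_counit_scal lin_counit_single counit_XG
            simp del: scal_single)
      from n0[OF this] have "n b = scal (counit H b) (lin n (unit_el H))"
        by (simp add: lin_diff lin_scal del: scal_single)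
      then show ?thesis using hom_unit[OF nh] by (simp add: one_pt_def)
    qed
    then have n1: "n = one_pt H A" by auto
    have "mult_pt H A (mult_pt H A (inv_pt H h) n) h = one_pt H A"
      unfolding n1 mult_pt_H_one[OF A inv_pt_H_hom[OF A h]] by (rule mult_pt_H_inv[OF A h])
    then show "mult_pt H A (mult_pt H A (inv_pt H h) n) h \<in> sub_points H (trivial_supersubgroup H) A"
      using n n1 by simp
  qed
  ultimately show ?thesis
    unfolding normal_unipotent_def by blast
qed

section \<open>Coefficients that generate \<open>V\<close> from any nonzero vector\<close>

lemma rep_coeff_gen:
  "X_part bvec b = (bvec (b, eG) :: _ \<Rightarrow>\<^sub>0 'k)" "G_part bvec c = (bvec (eX, c) :: _ \<Rightarrow>\<^sub>0 'k)"
  by (simp_all add: X_part_apply G_part_apply)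

lemmas rep_coeff_expand = rep_coeff_def rep_def rep_X_def rep_G_def mat_X_def mat_G_def mat_mult_mat4 mat4_def rep_coeff_gen mul_tens_alg mul_X mul_G
  lookup_add lookup_minus lookup_single when_def lookup_scal

text \<open>
  The coefficients of \<open>\<tau> z\<^sub>1\<close> times \<open>uv\<close>, \<open>v\<close>, \<open>u\<close>, \<open>1\<close> pick out the entries of the first row of the
  matrix, so they carry any nonzero vector to the first basis vector; the coefficients of \<open>\<tau>\<close> times
  \<open>u\<close>, \<open>v\<close>, \<open>uv\<close> carry that one to the others.
\<close>

lemma lookup_rep_coeff_a:
  assumes "i < 4" "l < 4" "j < 4"
  shows "lk (rep_coeff i l) ((1, 1, False, False), [(True, True), qI, pI, eG] ! j) =
    (if i = 0 \<and> l = j then if j = 1 then - 1 else 1 else 0)"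
  \<comment> \<open>In the matrix of X the monomial \<tau> z_1 occurs only at position (0, 3), where
    it meets the last row (p q, - q, p, 1) of the matrix of G. This explains the order of the list
    and the sign at \<open>j = 1\<close>.\<close>
  using assms unfolding less_4_iff
  by (elim disjE; simp add: rep_coeff_expand amul_add_left amul_add_right amul_diff_left)

lemma lookup_rep_coeff_t:
  assumes "i < 4"
  shows "lk (rep_coeff i 0) (tI, pI) = (if i = 1 then 1 else 0)"
    "lk (rep_coeff i 0) (tI, qI) = (if i = 2 then 1 else 0)"
    "lk (rep_coeff i 0) (tI, (True, True)) = (if i = 3 then 1 else 0)"
  using assms unfolding less_4_iff
  by - (elim disjE; simp add: rep_coeff_expand amul_add_left amul_add_right amul_diff_left)+

end

lemma lookup_sum_bvec_tens:
  fixes f :: "nat \<Rightarrow> ('c \<Rightarrow>\<^sub>0 'k::field)"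
  assumes "i < n"
  shows "lk (\<Sum>k<n. bvec k \<otimes> f k) (i, c) = lk (f i) c"
proof -
  have "lk (\<Sum>k<n. bvec k \<otimes> f k) (i, c) = (\<Sum>k<n. if k = i then lk (f i) c else 0)"
    unfolding lookup_sum by (intro sum.cong refl) (simp add: lookup_single when_def)
  then show ?thesis using assms by simp
qed

section \<open>Fixed vectors of a normal supersubgroup\<close>

context example_action
begin

lemma supercomodule_rep:
  fixes N :: "('c, 'k) hopf"
  assumes N: "supercomm_alg N" and \<pi>: "superalg_hom T_alg N \<pi>"
    and com: "\<And>b. lin (\<lambda>(c, d). \<pi> c \<otimes> \<pi> d) (comult H b) = lin (comult N) (\<pi> b)"
    and cou: "\<And>b. lin_counit N (\<pi> b) = counit H b" and cou1: "lin_counit N (unit_el N) = 1"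
  shows "supercomodule N \<lparr> idx = {..<4}, par = parV \<rparr> (\<lambda>j. \<Sum>i<4. bvec i \<otimes> rep N \<pi> i j)"
    (is "supercomodule N ?V ?\<delta>")
  unfolding supercomodule_def
proof (intro conjI ballI)
  note m = hom_rep_coeff[OF N \<pi>]
  show "even_map ?V (tens_space ?V N) ?\<delta>"
    unfolding even_map_def
  proof
    fix j assume j: "j \<in> idx ?V"
    show "?\<delta> j \<in> hpart (tens_space ?V N) (par ?V j)"
    proof (rule hpart_sum)
      fix i :: nat assume "i \<in> {..<4}"
      then have "bvec i \<otimes> rep N \<pi> i j \<in> hpart (tens_space ?V N) (parV i \<noteq> (parV i \<noteq> parV j))"
        using j by (intro tens_hpart rep_hpart N \<pi>) auto
      moreover have "(parV i \<noteq> (parV i \<noteq> parV j)) = par ?V j" by auto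
      ultimately show "bvec i \<otimes> rep N \<pi> i j \<in> hpart (tens_space ?V N) (par ?V j)" by simp
    qed
  qed
next
  note m = hom_rep_coeff[OF N \<pi>]
  fix j assume "j \<in> idx ?V"
  then have j: "j < 4" by simp
  have comm: "lin (comult N) (rep N \<pi> i j) = (\<Sum>k<4. rep N \<pi> i k \<otimes> rep N \<pi> k j)" for i
  proof -
    have "lin (comult N) (rep N \<pi> i j) = lin (\<lambda>(c, d). \<pi> c \<otimes> \<pi> d) (lin (comult H) (rep_coeff i j))"
      unfolding m[symmetric] lin_lin com ..
    then show ?thesis by (simp add: comult_rep_coeff lin_sum lin_tens_tens m)
  qed
  have c: "lin_counit N (rep N \<pi> i j) = (if i = j then 1 else 0)" if i: "i < 4" for i
  proof -
    have "lin_counit N (lin \<pi> x) = lin_counit H x" for x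
      by (simp add: lin_counit_lin cou lin_counit_def[of H])
    then have "lin_counit N (rep N \<pi> i j) = lin_counit H (rep_coeff i j)" by (simp flip: m)
    \<comment> \<open>At the unit point of H over \<open>N\<close> each coefficient takes its counit
      times the unit of K[N], and the matrix there is the identity. The counit of \<open>N\<close>
      then extracts the scalar.\<close>
    moreover have "scal (lin_counit H (rep_coeff i j)) (unit_el N) = (if i = j then unit_el N else 0)"
      using hom_rep_coeff[OF N one_pt_H_hom[OF N]] rep_one[OF N] id4_apply[OF i j, of N]
      by (simp flip: lin_one_pt)
    from arg_cong[OF this, of "lin_counit N"] have "lin_counit H (rep_coeff i j) = (if i = j then 1 else 0)"
      using cou1 by (auto simp: lin_counit_scal lin_counit_def[of N 0] split: if_splits)
    ultimately show ?thesis by simp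
  qed
  have "lin (\<lambda>(w, c). lin (\<lambda>(w', d). bvec (w', (d, c))) (?\<delta> w)) (?\<delta> j) =
      (\<Sum>k<4. \<Sum>i<4. lin (\<lambda>c. lin (\<lambda>d. bvec (i, (d, c))) (rep N \<pi> i k)) (rep N \<pi> k j))"
    by (simp add: lin_sum lin_tens) (simp add: lin_def scal_sum sum.swap[of _ "{..<4}" "ky _"])
  also have "\<dots> = (\<Sum>k<4. \<Sum>i<4. bvec i \<otimes> rep N \<pi> i k \<otimes> rep N \<pi> k j)"
  proof (intro sum.cong refl)
    fix i k :: nat
    have "lin (\<lambda>c. lin (\<lambda>d. bvec (i, (d, c))) (rep N \<pi> i k)) (rep N \<pi> k j)
        = lin (\<lambda>c. lin (\<lambda>d. bvec i \<otimes> bvec d \<otimes> bvec c) (rep N \<pi> i k)) (rep N \<pi> k j)" by simp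
    also have "\<dots> = bvec i \<otimes> rep N \<pi> i k \<otimes> rep N \<pi> k j"
      by (simp only: tens_lin_left[symmetric] tens_lin_right[symmetric] lin_bvec)
    finally show "lin (\<lambda>c. lin (\<lambda>d. bvec (i, (d, c))) (rep N \<pi> i k)) (rep N \<pi> k j) =
        bvec i \<otimes> rep N \<pi> i k \<otimes> rep N \<pi> k j" .
  qed
  also have "\<dots> = (\<Sum>i<4. bvec i \<otimes> lin (comult N) (rep N \<pi> i j))"
    by (subst sum.swap) (simp add: comm tens_sum_right)
  also have "\<dots> = lin (\<lambda>(w, c). bvec w \<otimes> comult N c) (?\<delta> j)"
    by (simp add: lin_sum lin_tens_tens)
  finally show "lin (\<lambda>(w, c). lin (\<lambda>(w', d). bvec (w', (d, c))) (?\<delta> w)) (?\<delta> j)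
          = lin (\<lambda>(w, c). bvec w \<otimes> comult N c) (?\<delta> j)" .
  have "lin (\<lambda>(w, c). scal (counit N c) (bvec w)) (?\<delta> j) = (\<Sum>i<4. scal (lin_counit N (rep N \<pi> i j)) (bvec i))"
    by (simp add: lin_sum lin_tens lin_counit_const del: scal_single)
  also have "\<dots> = (\<Sum>i<4. if i = j then bvec j else 0)"
    by (intro sum.cong refl) (auto simp: c)
  finally show "lin (\<lambda>(w, c). scal (counit N c) (bvec w)) (?\<delta> j) = bvec j"
    using j by simp
qed

text \<open>
  Over \<open>K[N] \<otimes> K[H]\<close> let \<open>n\<close> and \<open>h\<close> be the universal points of \<open>N\<close> and \<open>H\<close>.  As \<open>h\<^sup>-\<^sup>1 n h\<close> fixes \<open>x\<close>, the
  point \<open>n\<close> fixes \<open>h x\<close>; the claim compares the coefficients of the basis vector \<open>\<gamma>\<close> of \<open>K[H]\<close>.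
\<close>

lemma normal_fixed_stable:
  fixes N :: "(x_idx \<times> g_idx, 'k) hopf"
  assumes N: "supercomm_alg N" and \<pi>: "superalg_hom T_alg N \<pi>"
    and nor: "normal_supersubgroup H (defining_ideal H \<pi>)"
    and fx: "\<And>i. i < 4 \<Longrightarrow> (\<Sum>j<4. scal (x j) (rep N \<pi> i j)) = scal (x i) (unit_el N)"
    and i: "i < 4"
  shows "(\<Sum>k<4. scal (\<Sum>j<4. x j * lk (rep_coeff k j) \<gamma>) (rep N \<pi> i k)) =
    scal (\<Sum>j<4. x j * lk (rep_coeff i j) \<gamma>) (unit_el N)"
proof -
  define A where "A = tens_alg N (T_alg :: (x_idx \<times> g_idx, 'k) superalg)"
  have A: "supercomm_alg A" unfolding A_def by (intro supercomm_alg_tens_alg N supercomm_alg_T)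
  note i1 = inc1_hom[OF N supercomm_alg_T(1)] and i2 = inc2_hom[OF N supercomm_alg_T(1)]
  define n where "n = (\<lambda>b. lin (inc1 T_alg) (\<pi> b))"
  have n: "superalg_hom T_alg A n"
    unfolding n_def A_def by (rule superalg_hom_comp[OF \<pi> i1])
  define h :: "x_idx \<times> g_idx \<Rightarrow> ((x_idx \<times> g_idx) \<times> (x_idx \<times> g_idx) \<Rightarrow>\<^sub>0 'k)" where "h = inc2 N"
  have h: "superalg_hom T_alg A h" unfolding h_def A_def by (rule i2)
  define n' where "n' = mult_pt H A (mult_pt H A (inv_pt H h) n) h"
  have "n \<in> sub_points H (defining_ideal H \<pi>) A"
    using n unfolding sub_points_def points_def defining_ideal_def
    by (auto simp: superalg_hom_H n_def lin_lin[symmetric])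
  moreover have "h \<in> points H A" using h by (simp add: points_def superalg_hom_H)
  ultimately have "n' \<in> sub_points H (defining_ideal H \<pi>) A"
    using nor A unfolding normal_supersubgroup_def n'_def supercomm_alg_def by blast
  then have n': "superalg_hom T_alg A n'" and n'0: "\<And>f. f \<in> defining_ideal H \<pi> \<Longrightarrow> lin n' f = 0"
    by (auto simp: sub_points_def points_def superalg_hom_H)
  note ih = inv_pt_H_hom[OF A h]
  note ihn = mult_pt_H_hom[OF A ih n]
  note v = mat_in_rep[OF A h] mat_in_rep[OF A n] mat_in_rep[OF A ih]
  \<comment> \<open>The conjugate is h^{-1} n h, so on matrices h n' = n h.\<close>
  have MT': "mat_mult A (rep A h) (rep A n') = mat_mult A (rep A n) (rep A h)"
  proof -
    have "mat_mult A (rep A h) (rep A n') = mat_mult A (mat_mult A (rep A h) (rep A (inv_pt H h))) (mat_mult A (rep A n) (rep A h))"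
      unfolding n'_def rep_mult[OF A ihn h] rep_mult[OF A ih n]
      by (simp add: mat_mult_assoc[OF A] mat_in_mat_mult[OF A] v)
    also have "\<dots> = mat_mult A (rep A n) (rep A h)"
      unfolding rep_inv[OF A h]
      by (rule id4_mat_mult(1)[OF A mat_in_mat_mult[OF A v(2,1)]]) (auto simp: mat_mult_def rep_outside[OF A h] rep_outside[OF A n])
    finally show ?thesis .
  qed
  have fx': "(\<Sum>j<4. scal (x j) (rep A n' i j)) = scal (x i) (unit_el A)" if i: "i < 4" for i
  proof -
    \<comment> \<open>That \<open>N\<close> fixes \<open>x\<close> says that this element of K[H]
      lies in the defining ideal. By normality \<open>n'\<close> kills the ideal, so
      \<open>n'\<close> fixes \<open>x\<close> as well.\<close>
    let ?f = "(\<Sum>j<4. scal (x j) (rep_coeff i j)) - scal (x i) (unit_el T_alg)"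
    have "lin \<pi> ?f = 0"
      using fx[OF i] hom_unit[OF \<pi>] by (simp add: lin_diff lin_sum lin_scal hom_rep_coeff[OF N \<pi>] del: tens_alg_simps)
    then have "?f \<in> defining_ideal H \<pi>"
      by (simp add: defining_ideal_def vec_def)
    from n'0[OF this] show ?thesis
      using hom_unit[OF n'] by (simp add: lin_diff lin_sum lin_scal hom_rep_coeff[OF A n'] del: tens_alg_simps)
  qed
  have nm: "rep A n i k = rep N \<pi> i k \<otimes> unit_el T_alg" for i k
  proof -
    have "rep A n i k = lin (inc1 T_alg) (lin \<pi> (rep_coeff i k))"
      unfolding hom_rep_coeff[OF A n, symmetric] unfolding n_def lin_lin ..
    then show ?thesis unfolding hom_rep_coeff[OF N \<pi>] lin_inc1 .
  qed
  have hm: "rep A h i k = unit_el N \<otimes> rep_coeff i k" for i k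
    unfolding hom_rep_coeff[OF A h, symmetric] unfolding h_def lin_inc2 ..
  have cv: "rep_coeff i k \<in> vec (T_alg :: (x_idx \<times> g_idx, 'k) superalg)" for i k
    by (simp add: vec_def)
  have mv: "rep N \<pi> i k \<in> vec N" for i k
    using mat_in_rep[OF N \<pi>] by (simp add: mat_in_def)
  \<comment> \<open>In matrix form n h x = h n' x = h x, an identity in K[N] \<otimes> K[H].\<close>
  have eq: "(\<Sum>j<4. scal (x j) (\<Sum>k<4. rep N \<pi> i k \<otimes> rep_coeff k j)) = (\<Sum>k<4. scal (x k) (unit_el N \<otimes> rep_coeff i k))"
  proof -
    have "(\<Sum>j<4. scal (x j) (\<Sum>k<4. rep N \<pi> i k \<otimes> rep_coeff k j)) = (\<Sum>j<4. scal (x j) (mat_mult A (rep A n) (rep A h) i j))"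
      unfolding mat_mult_def nm hm unfolding A_def amul_inc1_inc2[OF N supercomm_alg_T(1) mv cv] ..
    also have "\<dots> = (\<Sum>k<4. amul A (rep A h i k) (\<Sum>j<4. scal (x j) (rep A n' k j)))"
      unfolding MT'[symmetric] mat_mult_def by (simp add: scal_sum amul_sum_right) (rule sum.swap)
    also have "\<dots> = (\<Sum>k<4. scal (x k) (rep A h i k))"
      using v(1) by (intro sum.cong refl) (simp add: fx' supercomm_alg_unit_right[OF A] mat_in_def)
    finally show ?thesis unfolding hm .
  qed
  show ?thesis
  proof (rule poly_mapping_eqI)
    fix c
    have "lk (\<Sum>k<4. scal (\<Sum>j<4. x j * lk (rep_coeff k j) \<gamma>) (rep N \<pi> i k)) c =
        (\<Sum>j<4. x j * (\<Sum>k<4. lk (rep N \<pi> i k) c * lk (rep_coeff k j) \<gamma>))"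
      unfolding lookup_sum lookup_scal sum_distrib_right sum_distrib_left
      by (subst sum.swap) (simp add: mult_ac)
    also have "\<dots> = (\<Sum>k<4. x k * (lk (unit_el N) c * lk (rep_coeff i k) \<gamma>))"
      using arg_cong[OF eq, of "\<lambda>z. lk z (c, \<gamma>)"] by (simp add: lookup_sum lookup_scal)
    also have "\<dots> = lk (scal (\<Sum>j<4. x j * lk (rep_coeff i j) \<gamma>) (unit_el N)) c"
      by (simp add: lookup_scal sum_distrib_right sum_distrib_left mult_ac)
    finally show "lk (\<Sum>k<4. scal (\<Sum>j<4. x j * lk (rep_coeff k j) \<gamma>) (rep N \<pi> i k)) c =
      lk (scal (\<Sum>j<4. x j * lk (rep_coeff i j) \<gamma>) (unit_el N)) c" .
  qed
qed

text \<open>Inclusion of supersubgroups reverses ideals, so this bounds every normal unipotent one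
  by the trivial one. It is enough that the projection is the unit point, since that kills the
  augmentation ideal.\<close>

lemma normal_unipotent_ge_trivial:
  assumes "normal_unipotent H J"
  shows "trivial_supersubgroup H \<subseteq> J"
proof -
  obtain N \<pi> where cs: "closed_supersubgroup H N \<pi>" and J: "J = defining_ideal H \<pi>" and un: "unipotent N"
    and nor: "normal_supersubgroup H J"
    using assms unfolding normal_unipotent_def by blast
  have sN: "supergroup N" and \<pi>: "superalg_hom T_alg N \<pi>"
    and com: "\<And>b. lin (\<lambda>(c, d). \<pi> c \<otimes> \<pi> d) (comult H b) = lin (comult N) (\<pi> b)"
    and cou: "\<And>b. lin_counit N (\<pi> b) = counit H b"
    using cs by (auto simp: closed_supersubgroup_def superalg_hom_H)
  have N: "supercomm_alg N" and cou1: "lin_counit N (unit_el N) = 1"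
    using sN unfolding supergroup_def supercomm_alg_def by blast+
  let ?V = "\<lparr> idx = {..<4}, par = parV \<rparr>" and ?\<delta> = "\<lambda>j. \<Sum>i<4. bvec i \<otimes> rep N \<pi> i j"
  define fixed where "fixed x \<longleftrightarrow> (\<forall>i<4. (\<Sum>j<4. scal (x j) (rep N \<pi> i j)) = scal (x i) (unit_el N))"
    for x :: "nat \<Rightarrow> 'k"
  have "\<exists>v\<in>vec ?V. v \<noteq> 0 \<and> lin ?\<delta> v = v \<otimes> unit_el N"
    by (rule unipotent_fixed_vector[OF un supercomodule_rep[OF N \<pi> com cou cou1]])
      (simp_all add: lessThan_empty_iff)
  then obtain v where v: "v \<in> vec ?V" "v \<noteq> 0" "lin ?\<delta> v = v \<otimes> unit_el N"
    by blast
  have kv: "ky v \<subseteq> {..<4}" using v(1) by (simp add: vec_def)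
  have fv: "fixed (lk v)"
    unfolding fixed_def
  proof (intro allI impI poly_mapping_eqI)
    fix i :: nat and c assume i: "i < 4"
    have "lk (lin ?\<delta> v) (i, c) = (\<Sum>j\<in>ky v. lk v j * lk (rep N \<pi> i j) c)"
      unfolding lookup_lin lookup_sum_bvec_tens[OF i] ..
    also have "\<dots> = (\<Sum>j<4. lk v j * lk (rep N \<pi> i j) c)"
      by (rule sum.mono_neutral_left) (use kv in \<open>auto simp: in_keys_iff\<close>)
    also have "\<dots> = lk (\<Sum>j<4. scal (lk v j) (rep N \<pi> i j)) c"
      by (simp add: lookup_sum lookup_scal)
    finally show "lk (\<Sum>j<4. scal (lk v j) (rep N \<pi> i j)) c = lk (scal (lk v i) (unit_el N)) c"
      unfolding v(3) by (simp add: lookup_scal)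
  qed
  have stable: "fixed (\<lambda>k. \<Sum>j<4. x j * lk (rep_coeff k j) \<gamma>)" if "fixed x" for x \<gamma>
    using normal_fixed_stable[OF N \<pi> nor[unfolded J], of x _ \<gamma>] that by (simp add: fixed_def)
  have fixed_cong: "fixed y" if "fixed x" "\<And>i. i < 4 \<Longrightarrow> x i = y i" for x y
    using that by (simp add: fixed_def)
  have fixed_scale: "fixed (\<lambda>i. a * x i)" if "fixed x" for a x
    unfolding fixed_def
  proof (intro allI impI)
    fix i :: nat assume "i < 4"
    then have "scal a (\<Sum>j<4. scal (x j) (rep N \<pi> i j)) = scal a (scal (x i) (unit_el N))"
      using that by (simp add: fixed_def)
    then show "(\<Sum>j<4. scal (a * x j) (rep N \<pi> i j)) = scal (a * x i) (unit_el N)"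
      by (simp add: scal_sum)
  qed
  define e :: "nat \<Rightarrow> nat \<Rightarrow> 'k" where "e j = (\<lambda>i. if i = j then 1 else 0)" for j
  have e0: "fixed (e 0)"
  proof -
    obtain j where j: "j < 4" "lk v j \<noteq> 0"
      using v(2) kv by (metis in_keys_iff keys_eq_empty lessThan_iff subsetD ex_in_conv)
    \<comment> \<open>\<open>\<gamma>\<close> selects the coefficient that sends the
      \<open>j\<close>-th coordinate to position 0 and annihilates the others, and \<open>s\<close>
      is its sign. Dividing by the nonzero \<open>lk v j * s\<close> leaves the first basis
      vector.\<close>
    define \<gamma> and s :: 'k where "\<gamma> = ((1, 1, False, False) :: x_idx, [(True, True), qI, pI, eG] ! j)"
      and "s = (if j = 1 then - 1 else 1)"
    then have s: "\<And>k l. k < 4 \<Longrightarrow> l < 4 \<Longrightarrow> lk (rep_coeff k l) \<gamma> = (if k = 0 \<and> l = j then s else 0)" "s \<noteq> 0"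
      using lookup_rep_coeff_a[OF _ _ j(1)] by auto
    have "fixed (\<lambda>k. (1 / (lk v j * s)) * (\<Sum>l<4. lk v l * lk (rep_coeff k l) \<gamma>))"
      by (rule fixed_scale[OF stable[OF fv]])
    then show ?thesis
    proof (rule fixed_cong)
      fix k :: nat assume k: "k < 4"
      have "(\<Sum>l<4. lk v l * lk (rep_coeff k l) \<gamma>) = (\<Sum>l<4. if l = j then (if k = 0 then lk v j * s else 0) else 0)"
        by (intro sum.cong refl) (auto simp: s(1) k)
      then show "(1 / (lk v j * s)) * (\<Sum>l<4. lk v l * lk (rep_coeff k l) \<gamma>) = e 0 k"
        using j s(2) by (simp add: e_def)
    qed
  qed
  have e0_step: "fixed (\<lambda>k. lk (rep_coeff k 0) \<gamma>)" for \<gamma>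
    by (rule fixed_cong[OF stable[OF e0, of \<gamma>]]) (simp add: sum_4 e_def)
  have "fixed (e 1)" "fixed (e 2)" "fixed (e 3)"
    by (rule fixed_cong[OF e0_step[of "(tI, pI)"]], simp add: lookup_rep_coeff_t e_def)
      (rule fixed_cong[OF e0_step[of "(tI, qI)"]], simp add: lookup_rep_coeff_t e_def,
       rule fixed_cong[OF e0_step[of "(tI, (True, True))"]], simp add: lookup_rep_coeff_t e_def)
  then have e: "fixed (e j)" if "j < 4" for j
    using e0 that unfolding less_4_iff by blast
  \<comment> \<open>All four basis vectors are fixed, so the matrix of \<open>\<pi>\<close> is the
    identity, which is the matrix of the unit point; faithfulness then identifies the
    points.\<close>
  have "rep N \<pi> i j = rep N (one_pt H N) i j" for i j
  proof (cases "i < 4 \<and> j < 4")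
    case True
    then have "(\<Sum>l<4. scal (e j l) (rep N \<pi> i l)) = scal (e j i) (unit_el N)"
      using e by (simp add: fixed_def)
    moreover have "(\<Sum>l<4. scal (e j l) (rep N \<pi> i l)) = (\<Sum>l<4. if l = j then rep N \<pi> i j else 0)"
      by (intro sum.cong refl) (auto simp: e_def)
    ultimately show ?thesis
      using True by (auto simp: rep_one[OF N] id4_apply e_def)
  qed (simp add: rep_outside[OF N \<pi>] rep_outside[OF N one_pt_H_hom[OF N]])
  then have "\<pi> = one_pt H N"
    by (intro rep_inject[OF N \<pi> one_pt_H_hom[OF N]]) auto
  then show ?thesis
    by (auto simp: J trivial_supersubgroup_def defining_ideal_def lin_one_pt)
qed

lemma unipotent_radical_trivial: "is_unipotent_radical H (trivial_supersubgroup H)"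
  using normal_unipotent_trivial normal_unipotent_ge_trivial by (simp add: is_unipotent_radical_def)

end

section \<open>The exponential in the image of \<tau>\<close>

lemma aexp_nilpotent:
  assumes "apow A x 3 = 0"
  shows "aexp A x = unit_el A + apow A x 1 + scal (1 / 2) (apow A x 2)"
proof -
  have z: "apow A x (n + 3) = 0" for n
    by (induction n) (simp_all only: assms add_0 add_Suc apow.simps amul_zero)
  \<comment> \<open>\<open>Sum_any\<close> is a finite sum only over a finite support, which has to
    be exhibited before it can be expanded.\<close>
  have "{k. scal (1 / fact k) (apow A x k) \<noteq> 0} \<subseteq> {..<3}"
    using z by (metis (mono_tags, lifting) le_add_diff_inverse2 lessThan_iff mem_Collect_eq not_le_imp_less scal_0(2) subsetI)
  then have "aexp A x = (\<Sum>k<3. scal (1 / fact k) (apow A x k))"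
    unfolding aexp_def by (rule Sum_any.expand_superset[OF finite_lessThan])
  moreover have "(\<Sum>k<3. f k) = f 0 + f 1 + f 2" for f :: "nat \<Rightarrow> ('a \<Rightarrow>\<^sub>0 'b)"
    by (simp add: eval_nat_numeral)
  ultimately show ?thesis by (simp del: apow.simps(2))
qed

lemma gen_simps:
  "gen_tau = bvec tI" "gen_z1 = bvec aI" "gen_z2 = bvec bI" "gen_z3 = bvec cI" "gen_u = bvec pI" "gen_v = bvec qI"
  by (simp_all add: gen_tau_def gen_z1_def gen_z2_def gen_z3_def gen_u_def gen_v_def)

theorem corollary8p2:
  fixes \<rho> :: "x_idx \<Rightarrow> (x_idx \<times> g_idx \<Rightarrow>\<^sub>0 'k::field_char_0)"
  assumes "right_action_by_automorphisms X_grp G_grp \<rho>"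
    and "lin \<rho> gen_z1 = gen_z1 \<otimes> unit_el G_grp"
    and "lin \<rho> gen_z2 = gen_z2 \<otimes> unit_el G_grp - gen_z1 \<otimes> gen_v"
    and "lin \<rho> gen_z3 = gen_z3 \<otimes> unit_el G_grp + gen_z1 \<otimes> gen_u"
    and "lin \<rho> gen_tau =
           amul (tens_alg X_grp G_grp) (gen_tau \<otimes> unit_el G_grp)
             (aexp (tens_alg X_grp G_grp)
               (gen_z1 \<otimes> amul G_grp gen_u gen_v + gen_z2 \<otimes> gen_u + gen_z3 \<otimes> gen_v))"
  shows "is_unipotent_radical (semidirect X_grp G_grp \<rho>)
           (trivial_supersubgroup (semidirect X_grp G_grp \<rho>))"
proof -
  let ?T = "T_alg :: (x_idx \<times> g_idx, 'k) superalg"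
  let ?y = "bvec (aI, (True, True)) + bvec (bI, pI) + bvec (cI, qI) :: x_idx \<times> g_idx \<Rightarrow>\<^sub>0 'k"
  have y: "?y \<in> vec ?T" by (simp add: vec_def)
  have y1: "apow ?T ?y 1 = ?y"
    using supercomm_alg_unit_right[OF supercomm_alg_T(1) y] by (simp del: tens_alg_simps)
  \<comment> \<open>Only the two mixed products of z_2 \<otimes> u and z_3 \<otimes> v survive. The
    sign rule makes each of them - z_2 z_3 \<otimes> uv, so they add up instead of
    cancelling.\<close>
  have y2: "apow ?T ?y 2 = Poly_Mapping.single ((0, 0, True, True), (True, True)) (- 2)"
    unfolding numeral_2_eq_2 apow.simps(2)[of _ _ "Suc 0"] y1[unfolded One_nat_def]
    by (simp add: amul_add_left amul_add_right mul_tens_alg mul_X mul_G flip: single_add)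
  \<comment> \<open>Every term of \<open>?y\<close> contains u or v, and both already occur in the
    square.\<close>
  have y3: "apow ?T ?y 3 = 0"
    unfolding numeral_3_eq_3 apow.simps(2)[of _ _ "Suc (Suc 0)"] y2[unfolded numeral_2_eq_2]
    by (simp add: amul_add_left mul_tens_alg mul_X mul_G)
  interpret example_action \<rho>
  proof
    show "superalg_hom X_grp ?T \<rho>"
      using assms(1) by (simp add: right_action_by_automorphisms_def)
    show "\<rho> aI = bvec (aI, eG)" "\<rho> bI = bvec (bI, eG) - bvec (aI, qI)" "\<rho> cI = bvec (cI, eG) + bvec (aI, pI)"
      using assms(2-4) by (simp_all add: gen_simps)
    have "\<rho> tI = amul ?T (bvec (tI, eG)) (aexp ?T ?y)"
      using assms(5) by (simp add: gen_simps mul_G)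
    also have "\<dots> = bvec (tI, eG) + bvec ((1, 0, True, False), pI) + bvec ((1, 0, False, True), qI)
      + bvec ((1, 1, False, False), (True, True)) - bvec ((1, 0, True, True), (True, True))"
      unfolding aexp_nilpotent[OF y3] y1 y2
      by (simp add: single_uminus amul_add_left amul_add_right amul_diff_right mul_tens_alg mul_X mul_G)
    finally show "\<rho> tI = bvec (tI, eG) + bvec ((1, 0, True, False), pI) + bvec ((1, 0, False, True), qI)
      + bvec ((1, 1, False, False), (True, True)) - bvec ((1, 0, True, True), (True, True))" .
  qed
  show ?thesis by (rule unipotent_radical_trivial)
qed

end
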